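(* Let $(V,\lfloor-,-\rfloor)$ be a $0$-bounded $\mathbf{b}_\infty$ algebra. Then $\overline{V}=\prod_{n\ge 0}V_n$ is given a monoid structure with the product defined by $$\forall x,y\in\overline{V},\quad x\lozenge y=\lfloor e^x,e^y\rfloor.$$ It is isomorphic to the monoid of characters of both $(S(V^* ),m,\Delta_* )$ and $(T(V^* ),m_{conc},\Delta_* )$.
   Context: $K$ is a field of characteristic zero. A $\mathbf{b}_\infty$ algebra is a vector space $V$ with a linear map $\lfloor-,-\rfloor:S(V)\otimes S(V)\to V$, with restrictions $\lfloor-,-\rfloor_{k,l}$ to $S^k(V)\otimes S^l(V)$, such that $\lfloor-,-\rfloor_{0,k}=\lfloor-,-\rfloor_{k,0}$ is $\mathrm{Id}_V$ if $k=1$ and $0$ otherwise, and such that for all $u=x_1\cdots x_k$, $v=y_1\cdots y_l$, $w=z_1\cdots z_m$ in $S(V)$, $$\sum_{\{I_1,\ldots,I_p\}\text{ partition of }[l+m]}\lfloor u,\lfloor v,w\rfloor_{I_1}\cdots\lfloor v,w\rfloor_{I_p}\rfloor=\sum_{\{I_1,\ldots,I_p\}\text{ partition of }[k+l]}\lfloor\lfloor u,v\rfloor_{I_1}\cdots\lfloor u,v\rfloor_{I_p},w\rfloor,$$ where $[n]=\{1,\ldots,n\}$ and, for $u=x_1\cdots x_k$, $v=y_1\cdots y_l$ and $I\subseteq[k+l]$, $\lfloor u,v\rfloor_I=\lfloor\prod_{i\in I,\,i\le k}x_i,\prod_{j\in I,\,j>k}y_{j-k}\rfloor$. A graded $\mathbf{b}_\infty$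 algebra $V=\bigoplus_{n\ge0}V_n$ (brackets homogeneous of degree $0$) is $0$-bounded if all $V_n$ are finite-dimensional and for all $m,n\ge 0$ there is $B(m,n)\ge0$ such that $k+l\ge B(m,n)$ implies $\lfloor S^k(V_0)S(V)_m,S^l(V_0)S(V)_n\rfloor=(0)$. $V^*=\bigoplus_n V_n^*$ is the graded dual. For $x,y\in\overline V$, $\lfloor e^x,e^y\rfloor=\sum_{k,l\ge 0}\frac{1}{k!\,l!}\lfloor x^k,y^l\rfloor$. The pairing between $S(V^* )$ and $S(V)$ is $\ll f_1\cdots f_k,x_1\cdots x_l\gg=\delta_{k,l}\sum_{\sigma\in\mathfrak{S}_k}\prod_i f_i(x_{\sigma(i)})$. The coproduct $\Delta_*$ on $S(V^* )$ is the unique algebra morphism $S(V^* )\to S(V^* )\otimes S(V^* )$ with $\ll\Delta_*(f),X\otimes Y\gg=\ll f,\lfloor X,Y\rfloor\gg$ for $f\in V^*$, $X,Y\in S(V)$; it makes $S(V^* )$, with its usual product $m$, a bialgebra. Characters are algebra morphisms to $K$, with the convolution product $\alpha*\beta=(\alpha\otimes\beta)\circ\Delta_*$. The bialgebra $(T(V^* ),m_{conc},\Delta_* )$, with $m_{conc}$ the concatenation, is the one the paper attaches to a $\mathbf{B}_\infty$ bracket $\langle-,-\rangle:T(V)\otimes T(V)\to V$ on $V$: $\Delta_*$ is the algebra morphism with $\ll\Delta_*(f),X\otimes Y\gg'=f(\langle X,Y\rangle)$ for $f\in V^*$, $X,Y\in T(V)$, where $\ll f_1\cdots f_k,x_1\cdots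 x_l\gg'=\delta_{k,l}f_1(x_1)\cdots f_k(x_k)$ and $f$ is extended by $0$ off $V$. Here a $\mathbf{B}_\infty$ bracket is a map such that $\langle 1,-\rangle$ and $\langle -,1\rangle$ restricted to $V^{\otimes k}$ are $\mathrm{Id}_V$ if $k=1$ and $0$ otherwise, and $\langle u*v,w\rangle=\langle u,v*w\rangle$ with $u*v=\sum_{i\ge1}\sum_{u=u_1\cdots u_i,\,v=v_1\cdots v_i}\langle u_1,v_1\rangle\cdots\langle u_i,v_i\rangle$ (factorizations into possibly empty words, $1*1=1$). It is $0$-bounded if it is graded with finite-dimensional $V_n$ and for all $m,n$ there is $B(m,n)$ such that, for $p_1+\cdots+p_k=m$ and $q_1+\cdots+q_l=n$, $\sharp\{i\mid p_i=0\}+\sharp\{j\mid q_j=0\}>B(m,n)$ implies $\langle V_{p_1}\cdots V_{p_k},V_{q_1}\cdots V_{q_l}\rangle=(0)$. Such a bracket induces the $\mathbf{b}_\infty$ bracket $\lfloor x_1\cdots x_k,y_1\cdots y_l\rfloor=\sum_{\sigma\in\mathfrak{S}_k,\tau\in\mathfrak{S}_l}\langle x_{\sigma(1)}\cdots x_{\sigma(k)},y_{\tau(1)}\cdots y_{\tau(l)}\rangle$, and then $(S(V^* ),m,\Delta_* )$ is the abelianization of $(T(V^* ),m_{conc},\Delta_* )$. The paper defines the coproduct on $T(V^* )$ only for $0$-bounded $\mathbf{B}_\infty$ algebras. *)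

theory Defs
  imports
    Complex_Main
    "HOL-Algebra.QuotRing"
    "HOL-Algebra.Module"
    "HOL-Library.Poly_Mapping"
    "HOL-Library.Function_Algebras"
    "HOL-Library.Disjoint_Sets"
    "HOL-Combinatorics.Permutations"
begin

section \<open>Algebras by generators and relations\<close>

text \<open>
  The ground field is the type \<open>'k\<close>. A \<open>'k\<close>-algebra is a record of type \<open>('k, 'a) module\<close>,
  a ring together with a scalar multiplication. Tensor algebras, symmetric algebras and tensor
  products are all obtained as quotients of the algebra of a monoid by the two-sided ideal
  generated by a set of relations.
\<close>

definition monoid_algebra ::
    "('m, 'z) monoid_scheme \<Rightarrow> ('k::field, 'm \<Rightarrow>\<^sub>0 'k) module" where
  "monoid_algebra M =
    \<lparr>carrier = {p. Poly_Mapping.keys p \<subseteq> carrier M},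
     monoid.mult = (\<lambda>p q. \<Sum>u\<in>Poly_Mapping.keys p. \<Sum>v\<in>Poly_Mapping.keys q.
        Poly_Mapping.single (u \<otimes>\<^bsub>M\<^esub> v) (Poly_Mapping.lookup p u * Poly_Mapping.lookup q v)),
     one = Poly_Mapping.single \<one>\<^bsub>M\<^esub> 1,
     zero = 0,
     add = (+),
     smult = (\<lambda>c. Poly_Mapping.map ((*) c))\<rparr>"

definition presented_algebra ::
    "('m, 'z) monoid_scheme \<Rightarrow> ('m \<Rightarrow>\<^sub>0 'k::field) set \<Rightarrow> ('k, ('m \<Rightarrow>\<^sub>0 'k) set) module" where
  "presented_algebra M R =
    (let A = monoid_algebra M; I = Idl\<^bsub>A\<^esub> R in
      ring.extend (A Quot I)
        (module.fields (\<lambda>c X. \<Union>p\<in>X. I +>\<^bsub>A\<^esub> (c \<odot>\<^bsub>A\<^esub> p))))"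

definition presented_class ::
    "('m, 'z) monoid_scheme \<Rightarrow> ('m \<Rightarrow>\<^sub>0 'k::field) set \<Rightarrow> ('m \<Rightarrow>\<^sub>0 'k) \<Rightarrow> ('m \<Rightarrow>\<^sub>0 'k) set" where
  "presented_class M R p = (Idl\<^bsub>monoid_algebra M\<^esub> R) +>\<^bsub>monoid_algebra M\<^esub> p"

text \<open>
  The linear functional induced on a presented algebra by prescribing its value \<open>\<phi> m\<close> on each
  monoid element \<open>m\<close>. It is only used for \<open>\<phi>\<close> compatible with the relations, in which case the
  image below is a singleton.
\<close>

definition quotient_lift :: "('m \<Rightarrow> 'k::field) \<Rightarrow> ('m \<Rightarrow>\<^sub>0 'k) set \<Rightarrow> 'k" where
  "quotient_lift \<phi> X =
    the_elem ((\<lambda>p. \<Sum>m\<in>Poly_Mapping.keys p. Poly_Mapping.lookup p m * \<phi> m) ` X)"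

definition alg_hom ::
    "('k, 'a, 'y) module_scheme \<Rightarrow> ('k, 'b, 'z) module_scheme \<Rightarrow> ('a \<Rightarrow> 'b) set" where
  "alg_hom A B =
    {h \<in> ring_hom A B. \<forall>c. \<forall>a\<in>carrier A. h (c \<odot>\<^bsub>A\<^esub> a) = c \<odot>\<^bsub>B\<^esub> h a}"

definition ground_field :: "('k::field, 'k) module" where
  "ground_field =
    \<lparr>carrier = UNIV, monoid.mult = (*), one = 1, zero = 0, add = (+), smult = (*)\<rparr>"

definition linear_on ::
    "('k, 'a, 'z) module_scheme \<Rightarrow> ('k \<Rightarrow> 'v::ab_group_add \<Rightarrow> 'v) \<Rightarrow> ('a \<Rightarrow> 'v) \<Rightarrow> bool" where
  "linear_on A scale h \<longleftrightarrow>
    (\<forall>X\<in>carrier A. \<forall>Y\<in>carrier A. h (X \<oplus>\<^bsub>A\<^esub> Y) = h X + h Y) \<and>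
    (\<forall>c. \<forall>X\<in>carrier A. h (c \<odot>\<^bsub>A\<^esub> X) = scale c (h X))"


section \<open>Tensor products of algebras\<close>

text \<open>
  The bilinearity relations are stable under multiplication by pairs \<open>(a, b)\<close>, so the ideal they
  generate is their linear span: the underlying vector space is the usual tensor product.
\<close>

definition bilinear_relations ::
    "('k::field, 'a, 'y) module_scheme \<Rightarrow> ('k, 'b, 'z) module_scheme \<Rightarrow> ('a \<times> 'b \<Rightarrow>\<^sub>0 'k) set" where
  "bilinear_relations A B =
    {Poly_Mapping.single (a \<oplus>\<^bsub>A\<^esub> a', b) 1
       - Poly_Mapping.single (a, b) 1 - Poly_Mapping.single (a', b) 1 | a a' b.
       a \<in> carrier A \<and> a' \<in> carrier A \<and> b \<in> carrier B} \<union>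
    {Poly_Mapping.single (a, b \<oplus>\<^bsub>B\<^esub> b') 1
       - Poly_Mapping.single (a, b) 1 - Poly_Mapping.single (a, b') 1 | a b b'.
       a \<in> carrier A \<and> b \<in> carrier B \<and> b' \<in> carrier B} \<union>
    {Poly_Mapping.single (c \<odot>\<^bsub>A\<^esub> a, b) 1 - Poly_Mapping.single (a, b) c | c a b.
       a \<in> carrier A \<and> b \<in> carrier B} \<union>
    {Poly_Mapping.single (a, c \<odot>\<^bsub>B\<^esub> b) 1 - Poly_Mapping.single (a, b) c | c a b.
       a \<in> carrier A \<and> b \<in> carrier B}"

definition tensor_product ::
    "('k::field, 'a, 'y) module_scheme \<Rightarrow> ('k, 'b, 'z) module_scheme
      \<Rightarrow> ('k, ('a \<times> 'b \<Rightarrow>\<^sub>0 'k) set) module" where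
  "tensor_product A B = presented_algebra (A \<times>\<times> B) (bilinear_relations A B)"

definition pure_tensor ::
    "('k::field, 'a, 'y) module_scheme \<Rightarrow> ('k, 'b, 'z) module_scheme
      \<Rightarrow> 'a \<Rightarrow> 'b \<Rightarrow> ('a \<times> 'b \<Rightarrow>\<^sub>0 'k) set" where
  "pure_tensor A B a b =
    presented_class (A \<times>\<times> B) (bilinear_relations A B) (Poly_Mapping.single (a, b) 1)"

text \<open>\<open>\<alpha> \<otimes> \<beta>\<close> for linear functionals \<open>\<alpha>\<close> and \<open>\<beta>\<close>, with values in \<open>K \<otimes> K = K\<close>.\<close>

definition tensor_functional ::
    "('a \<Rightarrow> 'k::field) \<Rightarrow> ('b \<Rightarrow> 'k) \<Rightarrow> ('a \<times> 'b \<Rightarrow>\<^sub>0 'k) set \<Rightarrow> 'k" where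
  "tensor_functional \<alpha> \<beta> = quotient_lift (\<lambda>(a, b). \<alpha> a * \<beta> b)"


section \<open>Tensor and symmetric algebras\<close>

text \<open>
  \<open>W\<close> is a subspace of the ambient vector space with scalar multiplication \<open>scale\<close>.
\<close>

type_synonym ('k, 'x) word_class = "('x list \<Rightarrow>\<^sub>0 'k) set"

definition free_monoid :: "'x set \<Rightarrow> 'x list monoid" where
  "free_monoid W = \<lparr>carrier = lists W, monoid.mult = (@), one = []\<rparr>"

definition linearity_relations ::
    "('k::field \<Rightarrow> 'x::ab_group_add \<Rightarrow> 'x) \<Rightarrow> 'x set \<Rightarrow> ('x list \<Rightarrow>\<^sub>0 'k) set" where
  "linearity_relations scale W =
    {Poly_Mapping.single [x + y] 1 - Poly_Mapping.single [x] 1 - Poly_Mapping.single [y] 1 | x y.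
       x \<in> W \<and> y \<in> W} \<union>
    {Poly_Mapping.single [scale c x] 1 - Poly_Mapping.single [x] c | c x. x \<in> W}"

definition commutation_relations :: "'x set \<Rightarrow> ('x list \<Rightarrow>\<^sub>0 'k::field) set" where
  "commutation_relations W =
    {Poly_Mapping.single [x, y] 1 - Poly_Mapping.single [y, x] 1 | x y. x \<in> W \<and> y \<in> W}"

definition tensor_algebra ::
    "('k::field \<Rightarrow> 'x::ab_group_add \<Rightarrow> 'x) \<Rightarrow> 'x set \<Rightarrow> ('k, ('k, 'x) word_class) module" where
  "tensor_algebra scale W =
    presented_algebra (free_monoid W) (linearity_relations scale W)"

definition symmetric_algebra ::
    "('k::field \<Rightarrow> 'x::ab_group_add \<Rightarrow> 'x) \<Rightarrow> 'x set \<Rightarrow> ('k, ('k, 'x) word_class) module" where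
  "symmetric_algebra scale W =
    presented_algebra (free_monoid W) (linearity_relations scale W \<union> commutation_relations W)"

text \<open>
  The class of a formal combination of words over \<open>W\<close>, and the product \<open>x\<^sub>1\<cdots>x\<^sub>k\<close> of a list of
  elements of \<open>W\<close>; the embedding of \<open>W\<close> is \<open>x \<mapsto> tensor_word scale W [x]\<close>, resp.
  \<open>x \<mapsto> symmetric_word scale W [x]\<close>.
\<close>

definition tensor_class ::
    "('k::field \<Rightarrow> 'x::ab_group_add \<Rightarrow> 'x) \<Rightarrow> 'x set \<Rightarrow> ('x list \<Rightarrow>\<^sub>0 'k) \<Rightarrow> ('k, 'x) word_class" where
  "tensor_class scale W = presented_class (free_monoid W) (linearity_relations scale W)"

definition symmetric_class ::
    "('k::field \<Rightarrow> 'x::ab_group_add \<Rightarrow> 'x) \<Rightarrow> 'x set \<Rightarrow> ('x list \<Rightarrow>\<^sub>0 'k) \<Rightarrow> ('k, 'x) word_class" where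
  "symmetric_class scale W =
    presented_class (free_monoid W) (linearity_relations scale W \<union> commutation_relations W)"

definition tensor_word ::
    "('k::field \<Rightarrow> 'x::ab_group_add \<Rightarrow> 'x) \<Rightarrow> 'x set \<Rightarrow> 'x list \<Rightarrow> ('k, 'x) word_class" where
  "tensor_word scale W xs = tensor_class scale W (Poly_Mapping.single xs 1)"

definition symmetric_word ::
    "('k::field \<Rightarrow> 'x::ab_group_add \<Rightarrow> 'x) \<Rightarrow> 'x set \<Rightarrow> 'x list \<Rightarrow> ('k, 'x) word_class" where
  "symmetric_word scale W xs = symmetric_class scale W (Poly_Mapping.single xs 1)"


section \<open>Graded vector spaces, graded duals and pairings\<close>

definition graded_space ::
    "('k::field \<Rightarrow> 'v::ab_group_add \<Rightarrow> 'v) \<Rightarrow> (nat \<Rightarrow> 'v set) \<Rightarrow> bool" where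
  "graded_space scale V \<longleftrightarrow>
    (\<forall>n. module.subspace scale (V n)) \<and>
    (\<forall>v. \<exists>!f. (\<forall>n. f n \<in> V n) \<and> finite {n. f n \<noteq> 0} \<and> v = (\<Sum>n | f n \<noteq> 0. f n))"

definition finite_dimensional_components ::
    "('k::field \<Rightarrow> 'v::ab_group_add \<Rightarrow> 'v) \<Rightarrow> (nat \<Rightarrow> 'v set) \<Rightarrow> bool" where
  "finite_dimensional_components scale V \<longleftrightarrow>
    (\<forall>n. \<exists>B. finite B \<and> V n = module.span scale B)"

text \<open>
  Elements of \<open>\<Oplus>\<^sub>n V\<^sub>n\<^sup>*\<close> are the linear forms on \<open>V\<close> that vanish on almost all \<open>V\<^sub>n\<close>.
\<close>

definition graded_dual ::
    "('k::field \<Rightarrow> 'v::ab_group_add \<Rightarrow> 'v) \<Rightarrow> (nat \<Rightarrow> 'v set) \<Rightarrow> ('v \<Rightarrow> 'k) set" where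
  "graded_dual scale V =
    {f. Vector_Spaces.linear scale (*) f \<and> finite {n. \<exists>x\<in>V n. f x \<noteq> 0}}"

definition dual_scale :: "'k::field \<Rightarrow> ('v \<Rightarrow> 'k) \<Rightarrow> 'v \<Rightarrow> 'k" where
  "dual_scale c f = (\<lambda>x. c * f x)"

text \<open>Words \<open>x\<^sub>1\<cdots>x\<^sub>k\<close> in homogeneous letters with \<open>deg x\<^sub>1 + \<cdots> + deg x\<^sub>k = m\<close>.\<close>

definition homogeneous_words :: "(nat \<Rightarrow> 'v set) \<Rightarrow> nat \<Rightarrow> 'v list set" where
  "homogeneous_words V m = {xs. \<exists>ps. list_all2 (\<lambda>x p. x \<in> V p) xs ps \<and> sum_list ps = m}"

definition power_words :: "'v set \<Rightarrow> nat \<Rightarrow> 'v list set" where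
  "power_words U k = {xs. length xs = k \<and> set xs \<subseteq> U}"

text \<open>
  The subspaces of \<open>S(V)\<close> and \<open>T(V)\<close> spanned by a set of words (\<open>V\<close> being the whole type);
  e.g. \<open>S\<^sup>k(U)\<close> is spanned by \<open>power_words U k\<close> and \<open>S(V)\<^sub>m\<close> by \<open>homogeneous_words V m\<close>.
\<close>

definition symmetric_span ::
    "('k::field \<Rightarrow> 'v::ab_group_add \<Rightarrow> 'v) \<Rightarrow> 'v list set \<Rightarrow> ('k, 'v) word_class set" where
  "symmetric_span scale M = symmetric_class scale UNIV ` {p. Poly_Mapping.keys p \<subseteq> M}"

definition tensor_span ::
    "('k::field \<Rightarrow> 'v::ab_group_add \<Rightarrow> 'v) \<Rightarrow> 'v list set \<Rightarrow> ('k, 'v) word_class set" where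
  "tensor_span scale M = tensor_class scale UNIV ` {p. Poly_Mapping.keys p \<subseteq> M}"

definition symmetric_pairing ::
    "('k::field, 'v \<Rightarrow> 'k) word_class \<Rightarrow> ('k, 'v) word_class \<Rightarrow> 'k" where
  "symmetric_pairing F X =
    quotient_lift (\<lambda>fs. quotient_lift (\<lambda>xs.
      if length fs = length xs
      then \<Sum>\<sigma> | \<sigma> permutes {..<length fs}. \<Prod>i<length fs. (fs ! i) (xs ! \<sigma> i)
      else 0) X) F"

definition tensor_pairing ::
    "('k::field, 'v \<Rightarrow> 'k) word_class \<Rightarrow> ('k, 'v) word_class \<Rightarrow> 'k" where
  "tensor_pairing F X =
    quotient_lift (\<lambda>fs. quotient_lift (\<lambda>xs.
      if length fs = length xs then \<Prod>i<length fs. (fs ! i) (xs ! i) else 0) X) F"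


section \<open>\<open>b\<^sub>\<infinity>\<close> algebras\<close>

type_synonym ('k, 'v) bracket =
  "(('k, 'v) word_class \<times> ('k, 'v) word_class \<Rightarrow>\<^sub>0 'k) set \<Rightarrow> 'v"

definition sbracket ::
    "('k::field \<Rightarrow> 'v::ab_group_add \<Rightarrow> 'v) \<Rightarrow> ('k, 'v) bracket
      \<Rightarrow> ('k, 'v) word_class \<Rightarrow> ('k, 'v) word_class \<Rightarrow> 'v" where
  "sbracket scale br X Y =
    br (pure_tensor (symmetric_algebra scale UNIV) (symmetric_algebra scale UNIV) X Y)"

text \<open>\<open>\<lfloor>u,v\<rfloor>\<^sub>I\<close>, with positions in \<open>uv\<close> numbered from \<open>0\<close>.\<close>

definition sbracket_part ::
    "('k::field \<Rightarrow> 'v::ab_group_add \<Rightarrow> 'v) \<Rightarrow> ('k, 'v) bracket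
      \<Rightarrow> 'v list \<Rightarrow> 'v list \<Rightarrow> nat set \<Rightarrow> 'v" where
  "sbracket_part scale br xs ys I =
    sbracket scale br
      (symmetric_word scale UNIV (nths xs I))
      (symmetric_word scale UNIV (nths ys {j. length xs + j \<in> I}))"

definition sbracket_blocks ::
    "('k::field \<Rightarrow> 'v::ab_group_add \<Rightarrow> 'v) \<Rightarrow> ('k, 'v) bracket
      \<Rightarrow> 'v list \<Rightarrow> 'v list \<Rightarrow> nat set set \<Rightarrow> ('k, 'v) word_class" where
  "sbracket_blocks scale br xs ys P =
    (\<Otimes>\<^bsub>symmetric_algebra scale UNIV\<^esub>I\<in>P.
      symmetric_word scale UNIV [sbracket_part scale br xs ys I])"

definition b_infinity_algebra ::
    "('k::field \<Rightarrow> 'v::ab_group_add \<Rightarrow> 'v) \<Rightarrow> ('k, 'v) bracket \<Rightarrow> bool" where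
  "b_infinity_algebra scale br \<longleftrightarrow>
    vector_space scale \<and>
    linear_on (tensor_product (symmetric_algebra scale UNIV) (symmetric_algebra scale UNIV)) scale br \<and>
    (\<forall>x. sbracket scale br \<one>\<^bsub>symmetric_algebra scale UNIV\<^esub> (symmetric_word scale UNIV [x]) = x \<and>
         sbracket scale br (symmetric_word scale UNIV [x]) \<one>\<^bsub>symmetric_algebra scale UNIV\<^esub> = x) \<and>
    (\<forall>k. k \<noteq> 1 \<longrightarrow> (\<forall>X\<in>symmetric_span scale (power_words UNIV k).
         sbracket scale br \<one>\<^bsub>symmetric_algebra scale UNIV\<^esub> X = 0 \<and>
         sbracket scale br X \<one>\<^bsub>symmetric_algebra scale UNIV\<^esub> = 0)) \<and>
    (\<forall>xs ys zs.
      (\<Sum>P | partition_on {..<length ys + length zs} P.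
         sbracket scale br (symmetric_word scale UNIV xs) (sbracket_blocks scale br ys zs P)) =
      (\<Sum>P | partition_on {..<length xs + length ys} P.
         sbracket scale br (sbracket_blocks scale br xs ys P) (symmetric_word scale UNIV zs)))"

definition zero_bounded_b_infinity_algebra ::
    "('k::field \<Rightarrow> 'v::ab_group_add \<Rightarrow> 'v) \<Rightarrow> (nat \<Rightarrow> 'v set) \<Rightarrow> ('k, 'v) bracket \<Rightarrow> bool" where
  "zero_bounded_b_infinity_algebra scale V br \<longleftrightarrow>
    b_infinity_algebra scale br \<and>
    graded_space scale V \<and>
    (\<forall>m n. \<forall>X\<in>symmetric_span scale (homogeneous_words V m).
       \<forall>Y\<in>symmetric_span scale (homogeneous_words V n). sbracket scale br X Y \<in> V (m + n)) \<and>
    finite_dimensional_components scale V \<and>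
    (\<forall>m n. \<exists>B::nat. \<forall>k l. k + l \<ge> B \<longrightarrow>
       (\<forall>X0\<in>symmetric_span scale (power_words (V 0) k).
        \<forall>X\<in>symmetric_span scale (homogeneous_words V m).
        \<forall>Y0\<in>symmetric_span scale (power_words (V 0) l).
        \<forall>Y\<in>symmetric_span scale (homogeneous_words V n).
          sbracket scale br
            (X0 \<otimes>\<^bsub>symmetric_algebra scale UNIV\<^esub> X)
            (Y0 \<otimes>\<^bsub>symmetric_algebra scale UNIV\<^esub> Y) = 0))"


section \<open>The product on the completion\<close>

definition completion :: "(nat \<Rightarrow> 'v set) \<Rightarrow> (nat \<Rightarrow> 'v) set" where
  "completion V = {x. \<forall>n. x n \<in> V n}"

text \<open>
  The component of degree \<open>n\<close> of \<open>\<lfloor>x\<^sup>k, y\<^sup>l\<rfloor>\<close>, where \<open>x = \<Sum>\<^sub>p x\<^sub>p\<close> and \<open>y = \<Sum>\<^sub>q y\<^sub>q\<close>, by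
  multilinearity and homogeneity.
\<close>

definition sbracket_powers ::
    "('k::field \<Rightarrow> 'v::ab_group_add \<Rightarrow> 'v) \<Rightarrow> ('k, 'v) bracket
      \<Rightarrow> (nat \<Rightarrow> 'v) \<Rightarrow> nat \<Rightarrow> (nat \<Rightarrow> 'v) \<Rightarrow> nat \<Rightarrow> nat \<Rightarrow> 'v" where
  "sbracket_powers scale br x k y l n =
    (\<Sum>(ps, qs) | length ps = k \<and> length qs = l \<and> sum_list ps + sum_list qs = n.
       sbracket scale br
         (symmetric_word scale UNIV (map x ps)) (symmetric_word scale UNIV (map y qs)))"

text \<open>
  \<open>\<lfloor>e\<^sup>x, e\<^sup>y\<rfloor>\<close>; in the \<open>0\<close>-bounded case, only finitely many pairs \<open>(k, l)\<close> contribute to the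
  component of degree \<open>n\<close>.
\<close>

definition lozenge ::
    "('k::field_char_0 \<Rightarrow> 'v::ab_group_add \<Rightarrow> 'v) \<Rightarrow> ('k, 'v) bracket
      \<Rightarrow> (nat \<Rightarrow> 'v) \<Rightarrow> (nat \<Rightarrow> 'v) \<Rightarrow> nat \<Rightarrow> 'v" where
  "lozenge scale br x y =
    (\<lambda>n. Sum_any (\<lambda>(k, l). scale (1 / (fact k * fact l)) (sbracket_powers scale br x k y l n)))"

definition lozenge_monoid ::
    "('k::field_char_0 \<Rightarrow> 'v::ab_group_add \<Rightarrow> 'v) \<Rightarrow> (nat \<Rightarrow> 'v set) \<Rightarrow> ('k, 'v) bracket
      \<Rightarrow> (nat \<Rightarrow> 'v) monoid" where
  "lozenge_monoid scale V br =
    \<lparr>carrier = completion V, monoid.mult = lozenge scale br, one = (\<lambda>n. 0)\<rparr>"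


section \<open>Characters\<close>

definition characters :: "('k::field, 'a, 'z) module_scheme \<Rightarrow> ('a \<Rightarrow> 'k) set" where
  "characters A = alg_hom A ground_field \<inter> extensional (carrier A)"

definition character_monoid ::
    "('k::field, 'a, 'z) module_scheme \<Rightarrow> ('a \<Rightarrow> ('a \<times> 'a \<Rightarrow>\<^sub>0 'k) set) \<Rightarrow> ('a \<Rightarrow> 'k)
      \<Rightarrow> ('a \<Rightarrow> 'k) monoid" where
  "character_monoid A \<Delta> \<epsilon> =
    \<lparr>carrier = characters A,
     monoid.mult = (\<lambda>\<alpha> \<beta>. restrict (\<lambda>a. tensor_functional \<alpha> \<beta> (\<Delta> a)) (carrier A)),
     one = restrict \<epsilon> (carrier A)\<rparr>"

text \<open>The counit of \<open>S(V\<^sup>*)\<close> and \<open>T(V\<^sup>*)\<close> is the coefficient of the empty word.\<close>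

definition word_counit :: "('k::field, 'x) word_class \<Rightarrow> 'k" where
  "word_counit = quotient_lift (\<lambda>fs. if fs = [] then 1 else 0)"

abbreviation symmetric_dual ::
    "('k::field \<Rightarrow> 'v::ab_group_add \<Rightarrow> 'v) \<Rightarrow> (nat \<Rightarrow> 'v set)
      \<Rightarrow> ('k, ('k, 'v \<Rightarrow> 'k) word_class) module" where
  "symmetric_dual scale V \<equiv> symmetric_algebra dual_scale (graded_dual scale V)"

abbreviation tensor_dual ::
    "('k::field \<Rightarrow> 'v::ab_group_add \<Rightarrow> 'v) \<Rightarrow> (nat \<Rightarrow> 'v set)
      \<Rightarrow> ('k, ('k, 'v \<Rightarrow> 'k) word_class) module" where
  "tensor_dual scale V \<equiv> tensor_algebra dual_scale (graded_dual scale V)"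

text \<open>
  \<open>\<ll>D, X \<otimes> Y\<gg>\<close> is the value at \<open>D\<close> of \<open>\<ll>-, X\<gg> \<otimes> \<ll>-, Y\<gg>\<close>.
\<close>

definition symmetric_coproduct ::
    "('k::field \<Rightarrow> 'v::ab_group_add \<Rightarrow> 'v) \<Rightarrow> (nat \<Rightarrow> 'v set) \<Rightarrow> ('k, 'v) bracket
      \<Rightarrow> ('k, 'v \<Rightarrow> 'k) word_class
      \<Rightarrow> (('k, 'v \<Rightarrow> 'k) word_class \<times> ('k, 'v \<Rightarrow> 'k) word_class \<Rightarrow>\<^sub>0 'k) set" where
  "symmetric_coproduct scale V br =
    (THE \<Delta>.
      \<Delta> \<in> alg_hom (symmetric_dual scale V)
            (tensor_product (symmetric_dual scale V) (symmetric_dual scale V)) \<and>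
      \<Delta> \<in> extensional (carrier (symmetric_dual scale V)) \<and>
      (\<forall>f\<in>graded_dual scale V.
       \<forall>X\<in>carrier (symmetric_algebra scale UNIV). \<forall>Y\<in>carrier (symmetric_algebra scale UNIV).
         tensor_functional (\<lambda>F. symmetric_pairing F X) (\<lambda>F. symmetric_pairing F Y)
           (\<Delta> (symmetric_word dual_scale (graded_dual scale V) [f])) =
         symmetric_pairing (symmetric_word dual_scale (graded_dual scale V) [f])
           (symmetric_word scale UNIV [sbracket scale br X Y])))"

definition symmetric_character_monoid ::
    "('k::field \<Rightarrow> 'v::ab_group_add \<Rightarrow> 'v) \<Rightarrow> (nat \<Rightarrow> 'v set) \<Rightarrow> ('k, 'v) bracket
      \<Rightarrow> (('k, 'v \<Rightarrow> 'k) word_class \<Rightarrow> 'k) monoid" where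
  "symmetric_character_monoid scale V br =
    character_monoid (symmetric_dual scale V) (symmetric_coproduct scale V br) word_counit"


section \<open>\<open>B\<^sub>\<infinity>\<close> brackets\<close>

definition tbracket ::
    "('k::field \<Rightarrow> 'v::ab_group_add \<Rightarrow> 'v) \<Rightarrow> ('k, 'v) bracket
      \<Rightarrow> ('k, 'v) word_class \<Rightarrow> ('k, 'v) word_class \<Rightarrow> 'v" where
  "tbracket scale ang X Y =
    ang (pure_tensor (tensor_algebra scale UNIV) (tensor_algebra scale UNIV) X Y)"

text \<open>
  The product \<open>u * v\<close> of two words. A list \<open>[(u\<^sub>1, v\<^sub>1), \<dots>, (u\<^sub>i, v\<^sub>i)]\<close> encodes factorizations
  \<open>u = u\<^sub>1\<cdots>u\<^sub>i\<close> and \<open>v = v\<^sub>1\<cdots>v\<^sub>i\<close>. Those with some \<open>u\<^sub>j = v\<^sub>j = 1\<close> are left out: they contribute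
  \<open>0\<close> since \<open>\<langle>1, 1\<rangle> = 0\<close>, and without them the sum is finite. The empty list occurs only for
  \<open>u = v = 1\<close>, and accounts for the convention \<open>1 * 1 = 1\<close>.
\<close>

definition factorizations :: "'v list \<Rightarrow> 'v list \<Rightarrow> ('v list \<times> 'v list) list set" where
  "factorizations us vs =
    {ws. concat (map fst ws) = us \<and> concat (map snd ws) = vs \<and> ([], []) \<notin> set ws}"

definition star_product ::
    "('k::field \<Rightarrow> 'v::ab_group_add \<Rightarrow> 'v) \<Rightarrow> ('k, 'v) bracket
      \<Rightarrow> 'v list \<Rightarrow> 'v list \<Rightarrow> ('k, 'v) word_class" where
  "star_product scale ang us vs =
    (\<Oplus>\<^bsub>tensor_algebra scale UNIV\<^esub>ws\<in>factorizations us vs.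
      tensor_word scale UNIV
        (map (\<lambda>(u, v). tbracket scale ang (tensor_word scale UNIV u) (tensor_word scale UNIV v)) ws))"

definition B_infinity_algebra ::
    "('k::field \<Rightarrow> 'v::ab_group_add \<Rightarrow> 'v) \<Rightarrow> ('k, 'v) bracket \<Rightarrow> bool" where
  "B_infinity_algebra scale ang \<longleftrightarrow>
    vector_space scale \<and>
    linear_on (tensor_product (tensor_algebra scale UNIV) (tensor_algebra scale UNIV)) scale ang \<and>
    (\<forall>x. tbracket scale ang \<one>\<^bsub>tensor_algebra scale UNIV\<^esub> (tensor_word scale UNIV [x]) = x \<and>
         tbracket scale ang (tensor_word scale UNIV [x]) \<one>\<^bsub>tensor_algebra scale UNIV\<^esub> = x) \<and>
    (\<forall>k. k \<noteq> 1 \<longrightarrow> (\<forall>X\<in>tensor_span scale (power_words UNIV k).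
         tbracket scale ang \<one>\<^bsub>tensor_algebra scale UNIV\<^esub> X = 0 \<and>
         tbracket scale ang X \<one>\<^bsub>tensor_algebra scale UNIV\<^esub> = 0)) \<and>
    (\<forall>us vs ws.
      tbracket scale ang (star_product scale ang us vs) (tensor_word scale UNIV ws) =
      tbracket scale ang (tensor_word scale UNIV us) (star_product scale ang vs ws))"

definition zero_bounded_B_infinity_algebra ::
    "('k::field \<Rightarrow> 'v::ab_group_add \<Rightarrow> 'v) \<Rightarrow> (nat \<Rightarrow> 'v set) \<Rightarrow> ('k, 'v) bracket \<Rightarrow> bool" where
  "zero_bounded_B_infinity_algebra scale V ang \<longleftrightarrow>
    B_infinity_algebra scale ang \<and>
    graded_space scale V \<and>
    (\<forall>m n. \<forall>X\<in>tensor_span scale (homogeneous_words V m).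
       \<forall>Y\<in>tensor_span scale (homogeneous_words V n). tbracket scale ang X Y \<in> V (m + n)) \<and>
    finite_dimensional_components scale V \<and>
    (\<forall>m n. \<exists>B::nat. \<forall>ps qs.
       sum_list ps = m \<and> sum_list qs = n \<and> count_list ps 0 + count_list qs 0 > B \<longrightarrow>
       (\<forall>xs ys. list_all2 (\<lambda>x p. x \<in> V p) xs ps \<and> list_all2 (\<lambda>y q. y \<in> V q) ys qs \<longrightarrow>
          tbracket scale ang (tensor_word scale UNIV xs) (tensor_word scale UNIV ys) = 0))"

definition induces ::
    "('k::field \<Rightarrow> 'v::ab_group_add \<Rightarrow> 'v) \<Rightarrow> ('k, 'v) bracket \<Rightarrow> ('k, 'v) bracket \<Rightarrow> bool" where
  "induces scale ang br \<longleftrightarrow>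
    (\<forall>xs ys. sbracket scale br (symmetric_word scale UNIV xs) (symmetric_word scale UNIV ys) =
      (\<Sum>\<sigma> | \<sigma> permutes {..<length xs}. \<Sum>\<tau> | \<tau> permutes {..<length ys}.
        tbracket scale ang
          (tensor_word scale UNIV (permute_list \<sigma> xs)) (tensor_word scale UNIV (permute_list \<tau> ys))))"

definition tensor_coproduct ::
    "('k::field \<Rightarrow> 'v::ab_group_add \<Rightarrow> 'v) \<Rightarrow> (nat \<Rightarrow> 'v set) \<Rightarrow> ('k, 'v) bracket
      \<Rightarrow> ('k, 'v \<Rightarrow> 'k) word_class
      \<Rightarrow> (('k, 'v \<Rightarrow> 'k) word_class \<times> ('k, 'v \<Rightarrow> 'k) word_class \<Rightarrow>\<^sub>0 'k) set" where
  "tensor_coproduct scale V ang =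
    (THE \<Delta>.
      \<Delta> \<in> alg_hom (tensor_dual scale V)
            (tensor_product (tensor_dual scale V) (tensor_dual scale V)) \<and>
      \<Delta> \<in> extensional (carrier (tensor_dual scale V)) \<and>
      (\<forall>f\<in>graded_dual scale V.
       \<forall>X\<in>carrier (tensor_algebra scale UNIV). \<forall>Y\<in>carrier (tensor_algebra scale UNIV).
         tensor_functional (\<lambda>F. tensor_pairing F X) (\<lambda>F. tensor_pairing F Y)
           (\<Delta> (tensor_word dual_scale (graded_dual scale V) [f])) =
         f (tbracket scale ang X Y)))"

definition tensor_character_monoid ::
    "('k::field \<Rightarrow> 'v::ab_group_add \<Rightarrow> 'v) \<Rightarrow> (nat \<Rightarrow> 'v set) \<Rightarrow> ('k, 'v) bracket
      \<Rightarrow> (('k, 'v \<Rightarrow> 'k) word_class \<Rightarrow> 'k) monoid" where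
  "tensor_character_monoid scale V ang =
    character_monoid (tensor_dual scale V) (tensor_coproduct scale V ang) word_counit"

end

theory Submission
  imports Defs
begin

text \<open>
  An algebra morphism from \<open>S(V\<^sup>*)\<close> or \<open>T(V\<^sup>*)\<close> to \<open>K\<close> is determined by its restriction to \<open>V\<^sup>*\<close>,
  and a linear form on \<open>V\<^sup>*\<close> is the evaluation at a unique element of the completion, because all
  \<open>V\<^sub>n\<close> are finite-dimensional. The coproduct of a form \<open>f\<close> is a finite sum over words in dual
  bases, weighted by inverse factorials in the symmetric case; it is the only solution of the
  duality condition because the pairings are nondegenerate in characteristic zero. Summing by
  multilinearity, the convolution of the characters of \<open>x\<close> and \<open>y\<close> is the character of
  \<open>x \<lozenge> y = \<lfloor>e\<^sup>x, e\<^sup>y\<rfloor>\<close>, in the tensor case because \<open>\<lfloor>x\<^sup>k, y\<^sup>l\<rfloor> = k! l! \<langle>x\<^sup>k, y\<^sup>l\<rangle>\<close>. The monoid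
  axioms for characters are therefore those for \<open>\<lozenge>\<close>.

  For the associativity of \<open>\<lozenge>\<close>, project to the degrees below \<open>n\<close>: by \<open>0\<close>-boundedness the bracket becomes
  nilpotent and all sums are finite. Choosing one of the \<open>k\<close> blocks of a partition shows by
  induction on \<open>k\<close> that the sum of \<open>1/(a! b!)\<close> times the products of the blocks of \<open>x\<^sup>a\<close> and \<open>y\<^sup>b\<close> over all
  partitions with \<open>k\<close> blocks is \<open>(x \<lozenge> y)\<^sup>k/k!\<close>. Hence both \<open>(x \<lozenge> y) \<lozenge> z\<close> and \<open>x \<lozenge> (y \<lozenge> z)\<close> are the
  sum over \<open>a\<close>, \<open>b\<close>, \<open>c\<close> of \<open>1/(a! b! c!)\<close> times the two sides of the \<open>b\<^sub>\<infinity>\<close> identity for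
  \<open>x\<^sup>a\<close>, \<open>y\<^sup>b\<close>, \<open>z\<^sup>c\<close>.
\<close>

section \<open>Algebras of monoids and their quotients\<close>

text \<open>Both algebras are treated at once: a boolean \<open>c\<close> decides whether words
  commute, and its only numerical trace is the number of permutations in the pairing, k! or 1, which
  \<open>weight\<close> inverts. Tensor squares are quotients of algebras of monoids without a
  chosen basis, so equalities of tensors are congruences modulo an ideal. They are proved by
  pairing: every tensor is congruent to a finite combination of dual basis words whose coefficients
  are pairings. The obstacle is finiteness. V may be infinite-dimensional, and letters of degree 0
  make words arbitrarily long without raising the degree, so the dual of a bracket would in general
  be an infinite sum. Composed with a form of bounded degree, a 0-bounded bracket sees only letters
  of degree below some n and words of length below n. Since n depends on the form, the key
  statements hold for all sufficiently large n, and finitely many thresholds are merged by a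
  maximum.\<close>

abbreviation pscale :: "'k::field \<Rightarrow> ('m \<Rightarrow>\<^sub>0 'k) \<Rightarrow> ('m \<Rightarrow>\<^sub>0 'k)" where
  "pscale c \<equiv> Poly_Mapping.map ((*) c)"

abbreviation lookup :: "('m \<Rightarrow>\<^sub>0 'k::zero) \<Rightarrow> 'm \<Rightarrow> 'k" where
  "lookup \<equiv> Poly_Mapping.lookup"

abbreviation keys :: "('m \<Rightarrow>\<^sub>0 'k::zero) \<Rightarrow> 'm set" where
  "keys \<equiv> Poly_Mapping.keys"

abbreviation single :: "'m \<Rightarrow> 'k::zero \<Rightarrow> 'm \<Rightarrow>\<^sub>0 'k" where
  "single \<equiv> Poly_Mapping.single"

lemma lookup_pscale [simp]: "lookup (pscale c p) m = c * lookup p m"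
  by (transfer) (auto simp: when_def)

lemma pscale_single [simp]: "pscale c (single m a) = single m (c * a)"
  by (rule poly_mapping_eqI) (simp add: lookup_single when_def)

lemma keys_subset_iff: "keys p \<subseteq> S \<longleftrightarrow> (\<forall>m. m \<notin> S \<longrightarrow> lookup p m = 0)"
  by (metis in_keys_iff subset_iff)

lemma vector_space_pscale: "vector_space (pscale :: 'k::field \<Rightarrow> ('m \<Rightarrow>\<^sub>0 'k) \<Rightarrow> _)"
  by unfold_locales (auto intro!: poly_mapping_eqI simp: lookup_add algebra_simps)

lemma vector_space_mult: "vector_space ((*) :: 'k::field \<Rightarrow> 'k \<Rightarrow> 'k)"
  by unfold_locales (auto simp: algebra_simps)

lemma keys_pscale: "keys (pscale c p) \<subseteq> keys p"
  by (simp add: keys_subset_iff not_in_keys_iff_lookup_eq_zero)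

lemma keys_subset_pscale: "keys p \<subseteq> S \<Longrightarrow> keys (pscale c p) \<subseteq> S"
  by (simp add: keys_subset_iff)

lemma keys_subset_add: "keys p \<subseteq> S \<Longrightarrow> keys q \<subseteq> S \<Longrightarrow> keys (p + q) \<subseteq> S"
  by (simp add: keys_subset_iff lookup_add)

lemma keys_subset_diff: "keys p \<subseteq> S \<Longrightarrow> keys q \<subseteq> S \<Longrightarrow> keys (p - q) \<subseteq> (S :: 'm set)"
  for p q :: "'m \<Rightarrow>\<^sub>0 'k::ab_group_add"
  by (simp add: keys_subset_iff lookup_minus)

lemma keys_subset_uminus: "keys p \<subseteq> S \<Longrightarrow> keys (- p) \<subseteq> (S :: 'm set)"
  for p :: "'m \<Rightarrow>\<^sub>0 'k::ab_group_add"
  by (simp add: keys_subset_iff)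

lemma keys_subset_sum: "(\<And>i. i \<in> A \<Longrightarrow> keys (f i) \<subseteq> S) \<Longrightarrow> keys (sum f A) \<subseteq> S"
  by (induction A rule: infinite_finite_induct) (simp_all add: keys_subset_add)

lemma keys_subset_single: "m \<in> S \<Longrightarrow> keys (single m c) \<subseteq> S"
  by auto

lemma sum_single: "(\<Sum>m\<in>keys p. single m (lookup p m)) = (p :: 'm \<Rightarrow>\<^sub>0 'k::comm_monoid_add)"
proof (rule poly_mapping_eqI)
  fix k
  have "lookup (\<Sum>m\<in>keys p. single m (lookup p m)) k = (\<Sum>m\<in>keys p. if k = m then lookup p m else 0)"
    unfolding lookup_sum lookup_single when_def by (intro sum.cong) auto
  also have "\<dots> = (if k \<in> keys p then lookup p k else 0)"
    by (rule sum.delta') simp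
  finally show "lookup (\<Sum>m\<in>keys p. single m (lookup p m)) k = lookup p k"
    using not_in_keys_iff_lookup_eq_zero by metis
qed

lemma poly_mapping_induct [consumes 1, case_names zero single add]:
  fixes p :: "'m \<Rightarrow>\<^sub>0 'k::comm_monoid_add"
  assumes "keys p \<subseteq> S"
    and zero: "P 0"
    and single: "\<And>m c. m \<in> S \<Longrightarrow> P (single m c)"
    and add: "\<And>p q. keys p \<subseteq> S \<Longrightarrow> keys q \<subseteq> S \<Longrightarrow> P p \<Longrightarrow> P q \<Longrightarrow> P (p + q)"
  shows "P p"
proof -
  have "A \<subseteq> S \<Longrightarrow> P (\<Sum>m\<in>A. single m (lookup p m))" if "finite A" for A
    using that
  proof (induction A rule: finite_induct)
    case (insert x A)
    have "keys (\<Sum>m\<in>A. single m (lookup p m)) \<subseteq> S"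
      using insert by (intro keys_subset_sum) auto
    then show ?case
      using insert by (auto intro!: add single split: if_splits)
  qed (simp add: zero)
  from this[of "keys p"] show ?thesis
    using assms(1) by (simp add: sum_single)
qed

text \<open>Linear extension of \<open>\<phi>\<close> from monoid elements to formal combinations.
  The scalar multiplication \<open>s\<close> is a parameter so that the same rules serve for
  functionals and for maps between monoid algebras.\<close>

definition pext :: "('k::field \<Rightarrow> 'a::ab_group_add \<Rightarrow> 'a) \<Rightarrow> ('m \<Rightarrow> 'a) \<Rightarrow> ('m \<Rightarrow>\<^sub>0 'k) \<Rightarrow> 'a" where
  "pext s \<phi> p = (\<Sum>m\<in>keys p. s (lookup p m) (\<phi> m))"

context vector_space
begin

lemma pext_superset:
  assumes "finite A" "keys p \<subseteq> A"
  shows "pext scale \<phi> p = (\<Sum>m\<in>A. scale (lookup p m) (\<phi> m))"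
  unfolding pext_def using assms
  by (intro sum.mono_neutral_left) (auto simp: not_in_keys_iff_lookup_eq_zero)

lemma pext_zero [simp]: "pext scale \<phi> 0 = 0"
  by (simp add: pext_def)

lemma pext_single [simp]: "pext scale \<phi> (single m c) = scale c (\<phi> m)"
  by (auto simp: pext_def)

lemma pext_add: "pext scale \<phi> (p + q) = pext scale \<phi> p + pext scale \<phi> q"
proof -
  have "finite (keys p \<union> keys q)" "keys (p + q) \<subseteq> keys p \<union> keys q"
    by (simp_all add: Poly_Mapping.keys_add)
  then show ?thesis
    by (simp add: pext_superset[of "keys p \<union> keys q"] lookup_add scale_left_distrib sum.distrib)
qed

lemma pext_pscale: "pext scale \<phi> (pscale c p) = scale c (pext scale \<phi> p)"
  by (subst pext_superset[of "keys p"]) (auto simp: keys_pscale pext_def scale_sum_right)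

lemma pext_uminus: "pext scale \<phi> (- p) = - pext scale \<phi> p"
  using pext_add[of \<phi> p "- p"] by (simp add: eq_neg_iff_add_eq_0 add.commute)

lemma pext_diff: "pext scale \<phi> (p - q) = pext scale \<phi> p - pext scale \<phi> q"
  using pext_add[of \<phi> p "- q"] by (simp add: pext_uminus)

lemma pext_sum: "pext scale \<phi> (sum f A) = (\<Sum>i\<in>A. pext scale \<phi> (f i))"
  by (induction A rule: infinite_finite_induct) (auto simp: pext_add)

lemma pext_cong: "(\<And>m. m \<in> keys p \<Longrightarrow> \<phi> m = \<psi> m) \<Longrightarrow> pext scale \<phi> p = pext scale \<psi> p"
  by (simp add: pext_def)

lemma pext_fun_add: "pext scale (\<lambda>m. \<phi> m + \<psi> m) p = pext scale \<phi> p + pext scale \<psi> p"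
  by (simp add: pext_def scale_right_distrib sum.distrib)

lemma pext_fun_scale: "pext scale (\<lambda>m. scale c (\<phi> m)) p = scale c (pext scale \<phi> p)"
  by (simp add: pext_def scale_sum_right mult.commute)

end

interpretation P: vector_space "pscale :: 'k::field \<Rightarrow> ('m \<Rightarrow>\<^sub>0 'k) \<Rightarrow> _"
  by (rule vector_space_pscale)

text \<open>
  Not an interpretation: its simplification rule \<open>a * (b * x) = a * b * x\<close> would loop with
  associativity.
\<close>

lemmas K_pext_zero [simp] = vector_space.pext_zero[OF vector_space_mult]
lemmas K_pext_single [simp] = vector_space.pext_single[OF vector_space_mult]
lemmas K_pext_add = vector_space.pext_add[OF vector_space_mult]
lemmas K_pext_pscale = vector_space.pext_pscale[OF vector_space_mult]
lemmas K_pext_diff = vector_space.pext_diff[OF vector_space_mult]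
lemmas K_pext_sum = vector_space.pext_sum[OF vector_space_mult]
lemmas K_pext_cong = vector_space.pext_cong[OF vector_space_mult]
lemmas K_pext_fun_add = vector_space.pext_fun_add[OF vector_space_mult]
lemmas K_pext_fun_scale = vector_space.pext_fun_scale[OF vector_space_mult]

lemma pext_compose:
  fixes \<phi> :: "'m \<Rightarrow> 'a::ab_group_add"
  assumes "vector_space s"
    and "\<And>x y. h (x + y) = h x + h y" "\<And>c x. h (s' c x) = s c (h x)"
  shows "h (pext s' \<phi> p) = pext s (\<lambda>m. h (\<phi> m)) p"
proof -
  interpret S: vector_space s by fact
  have "h 0 = 0" using assms(2)[of 0 0] by simp
  then have "h (sum f A) = (\<Sum>i\<in>A. h (f i))" for f and A :: "'m set"
    by (induction A rule: infinite_finite_induct) (auto simp: assms(2))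
  then show ?thesis by (simp add: pext_def assms(3))
qed

text \<open>The double sum in \<open>monoid_algebra\<close>, written as an iterated linear
  extension; bilinearity then comes from the rules for \<open>pext\<close>, and identities can be
  checked on \<open>single\<close>s.\<close>

definition pmul :: "('m, 'z) monoid_scheme \<Rightarrow> ('m \<Rightarrow>\<^sub>0 'k::field) \<Rightarrow> ('m \<Rightarrow>\<^sub>0 'k) \<Rightarrow> ('m \<Rightarrow>\<^sub>0 'k)" where
  "pmul M p q = pext pscale (\<lambda>u. pext pscale (\<lambda>v. single (u \<otimes>\<^bsub>M\<^esub> v) 1) q) p"

lemma monoid_algebra_simps:
  "carrier (monoid_algebra M) = {p. keys p \<subseteq> carrier M}"
  "monoid.mult (monoid_algebra M) = pmul M"
  "one (monoid_algebra M) = single \<one>\<^bsub>M\<^esub> 1"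
  "zero (monoid_algebra M) = 0"
  "add (monoid_algebra M) = (+)"
  "smult (monoid_algebra M) = pscale"
  by (auto simp: monoid_algebra_def pmul_def pext_def fun_eq_iff P.scale_sum_right)

lemma pmul_add_left: "pmul M (p + p') q = pmul M p q + pmul M p' q"
  by (simp add: pmul_def P.pext_add)

lemma pmul_add_right: "pmul M p (q + q') = pmul M p q + pmul M p q'"
  by (simp add: pmul_def P.pext_add P.pext_fun_add)

lemma pmul_diff_left: "pmul M (p - p') q = pmul M p q - pmul M p' q"
  by (simp add: pmul_def P.pext_diff)

lemma pmul_diff_right: "pmul M p (q - q') = pmul M p q - pmul M p q'"
  using pmul_add_right[of M p "q - q'" q'] by simp

lemma pmul_pscale_left: "pmul M (pscale c p) q = pscale c (pmul M p q)"
  by (simp add: pmul_def P.pext_pscale)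

lemma pmul_pscale_right: "pmul M p (pscale c q) = pscale c (pmul M p q)"
  by (simp add: pmul_def P.pext_pscale P.pext_fun_scale)

lemma pmul_zero [simp]: "pmul M 0 q = 0" "pmul M p 0 = 0"
  using pmul_diff_left[of M 0 0 q] pmul_diff_right[of M p 0 0] by auto

lemma pmul_single [simp]: "pmul M (single u a) (single v b) = single (u \<otimes>\<^bsub>M\<^esub> v) (a * b)"
  by (simp add: pmul_def)

lemma keys_pmul:
  assumes "Group.monoid M" "keys p \<subseteq> carrier M" "keys q \<subseteq> carrier M"
  shows "keys (pmul M p q) \<subseteq> carrier M"
proof -
  interpret Group.monoid M by fact
  have "keys (pmul M p (single v b)) \<subseteq> carrier M" if "v \<in> carrier M" for v b
    using assms(2)
    by (induction p rule: poly_mapping_induct)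
       (use that in \<open>simp_all add: pmul_add_left keys_subset_add\<close>)
  with assms(3) show ?thesis
    by (induction q rule: poly_mapping_induct)
       (simp_all add: pmul_add_right keys_subset_add)
qed

lemma monoid_algebra_ring:
  assumes "Group.monoid M"
  shows "ring (monoid_algebra M :: ('k::field, _) module)"
proof -
  interpret Group.monoid M by fact
  have one_left: "pmul M (single \<one>\<^bsub>M\<^esub> 1) p = p" if "keys p \<subseteq> carrier M" for p :: "_ \<Rightarrow>\<^sub>0 'k"
    using that by (induction p rule: poly_mapping_induct) (auto simp: pmul_add_right)
  have one_right: "pmul M p (single \<one>\<^bsub>M\<^esub> 1) = p" if "keys p \<subseteq> carrier M" for p :: "_ \<Rightarrow>\<^sub>0 'k"
    using that by (induction p rule: poly_mapping_induct) (auto simp: pmul_add_left)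
  have assoc: "pmul M (pmul M p q) r = pmul M p (pmul M q r)"
    if "keys p \<subseteq> carrier M" "keys q \<subseteq> carrier M" "keys r \<subseteq> carrier M" for p q r :: "_ \<Rightarrow>\<^sub>0 'k"
    using that(1)
  proof (induction p rule: poly_mapping_induct)
    case (single u a)
    from that(2) show ?case
    proof (induction q rule: poly_mapping_induct)
      case (single v b)
      from that(3) show ?case
      proof (induction r rule: poly_mapping_induct)
        case (single w c)
        then show ?case
          using m_assoc[OF \<open>u \<in> carrier M\<close> \<open>v \<in> carrier M\<close>] by (simp add: mult.assoc)
      next
        case (add r r')
        then show ?case by (simp only: pmul_add_right)
      qed simp
    qed (simp_all add: pmul_add_left pmul_add_right)
  qed (simp_all add: pmul_add_left)
  show ?thesis
  proof (rule ringI)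
    show "abelian_group (monoid_algebra M :: ('k, _) module)"
    proof (rule abelian_groupI)
      fix x assume "x \<in> carrier (monoid_algebra M :: ('k, _) module)"
      then show "\<exists>y\<in>carrier (monoid_algebra M). y \<oplus>\<^bsub>monoid_algebra M\<^esub> x = \<zero>\<^bsub>monoid_algebra M\<^esub>"
        by (intro bexI[of _ "- x"]) (auto simp: monoid_algebra_simps)
    qed (simp_all add: monoid_algebra_simps add_ac keys_subset_add)
    show "Group.monoid (monoid_algebra M :: ('k, _) module)"
      by (rule Group.monoidI)
         (simp_all add: monoid_algebra_simps one_left one_right assoc keys_pmul assms)
  qed (auto simp: monoid_algebra_simps pmul_add_left pmul_add_right)
qed

lemma minus_monoid_algebra:
  assumes "Group.monoid M" "keys p \<subseteq> carrier M" "keys q \<subseteq> carrier M"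
  shows "p \<ominus>\<^bsub>monoid_algebra M\<^esub> q = p - (q :: _ \<Rightarrow>\<^sub>0 'k::field)"
proof -
  interpret ring "monoid_algebra M :: ('k, _) module" by (rule monoid_algebra_ring) fact
  have "\<ominus>\<^bsub>monoid_algebra M\<^esub> q = - q"
    by (rule minus_equality)
       (use assms in \<open>auto simp: monoid_algebra_simps keys_subset_uminus\<close>)
  then show ?thesis by (simp add: a_minus_def monoid_algebra_simps)
qed

section \<open>Quotients of monoid algebras by ideals of relations\<close>

locale presentation =
  fixes M :: "('m, 'z) monoid_scheme" and R :: "('m \<Rightarrow>\<^sub>0 'k::field) set"
  assumes M: "Group.monoid M" and R: "r \<in> R \<Longrightarrow> keys r \<subseteq> carrier M"
begin

abbreviation MA :: "('k, 'm \<Rightarrow>\<^sub>0 'k) module" where "MA \<equiv> monoid_algebra M"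
abbreviation PA :: "('k, ('m \<Rightarrow>\<^sub>0 'k) set) module" where "PA \<equiv> presented_algebra M R"
abbreviation cl :: "('m \<Rightarrow>\<^sub>0 'k) \<Rightarrow> ('m \<Rightarrow>\<^sub>0 'k) set" where "cl \<equiv> presented_class M R"

definition I :: "('m \<Rightarrow>\<^sub>0 'k) set" where "I = Idl\<^bsub>MA\<^esub> R"

lemma MA_ring: "ring MA"
  by (rule monoid_algebra_ring[OF M])

sublocale M: Group.monoid M by (rule M)

sublocale MA: ring MA by (rule MA_ring)

lemma R_carrier: "R \<subseteq> carrier MA"
  using R by (auto simp: monoid_algebra_simps)

sublocale I: ideal I MA
  unfolding I_def by (rule MA.genideal_ideal[OF R_carrier])

lemma R_I: "R \<subseteq> I"
  unfolding I_def by (rule MA.genideal_self[OF R_carrier])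

lemma I_least: "ideal J MA \<Longrightarrow> R \<subseteq> J \<Longrightarrow> I \<subseteq> J"
  unfolding I_def by (rule MA.genideal_minimal)

lemma I_keys: "p \<in> I \<Longrightarrow> keys p \<subseteq> carrier M"
  using I.a_subset by (auto simp: monoid_algebra_simps)

lemma I_zero [simp]: "0 \<in> I"
  using I.zero_closed by (simp add: monoid_algebra_simps)

lemma I_add: "p \<in> I \<Longrightarrow> q \<in> I \<Longrightarrow> p + q \<in> I"
  using I.a_closed by (simp add: monoid_algebra_simps)

lemma I_mul_left: "p \<in> I \<Longrightarrow> keys q \<subseteq> carrier M \<Longrightarrow> pmul M q p \<in> I"
  using I.I_l_closed by (simp add: monoid_algebra_simps)

lemma I_mul_right: "p \<in> I \<Longrightarrow> keys q \<subseteq> carrier M \<Longrightarrow> pmul M p q \<in> I"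
  using I.I_r_closed by (simp add: monoid_algebra_simps)

text \<open>Multiplication by the scalar \<open>c\<close> is multiplication by \<open>c\<close>
  times the unit of the algebra, so an ideal is a linear subspace.\<close>

lemma I_pscale: "p \<in> I \<Longrightarrow> pscale c p \<in> I"
proof -
  assume p: "p \<in> I"
  have "pmul M (single \<one>\<^bsub>M\<^esub> c) p = pscale c (pmul M (single \<one>\<^bsub>M\<^esub> 1) p)"
    using pmul_pscale_left[of M c "single \<one>\<^bsub>M\<^esub> 1" p] by simp
  also have "pmul M (single \<one>\<^bsub>M\<^esub> 1) p = p"
    using MA.l_one[of p] p I.a_subset by (auto simp: monoid_algebra_simps)
  finally show ?thesis
    using I_mul_left[OF p, of "single \<one>\<^bsub>M\<^esub> c"] by auto
qed

lemma I_uminus: "p \<in> I \<Longrightarrow> - p \<in> I"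
proof -
  have "pscale (- 1) p = - p" by (rule poly_mapping_eqI) simp
  then show "p \<in> I \<Longrightarrow> - p \<in> I" using I_pscale[of p "- 1"] by simp
qed

lemma cl_def: "cl p = (\<lambda>i. i + p) ` I"
  by (auto simp: presented_class_def I_def[symmetric] a_r_coset_def r_coset_def monoid_algebra_simps)

lemma cl_eq_iff: "cl p = cl q \<longleftrightarrow> p - q \<in> I"
proof
  assume "cl p = cl q"
  then have "0 + p \<in> (\<lambda>i. i + q) ` I" unfolding cl_def by (metis I_zero image_eqI)
  then show "p - q \<in> I" by auto
next
  have *: "cl p \<subseteq> cl q" if "p - q \<in> I" for p q
  proof
    fix x assume "x \<in> cl p"
    then obtain i where i: "i \<in> I" "x = i + p" by (auto simp: cl_def)
    then have "x = (i + (p - q)) + q" by simp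
    then show "x \<in> cl q" unfolding cl_def using i that I_add by blast
  qed
  assume d: "p - q \<in> I"
  with I_uminus[OF d] show "cl p = cl q" by (intro equalityI *) auto
qed

lemma cl_self: "p \<in> cl p"
  unfolding cl_def by (rule image_eqI[of _ _ 0]) auto

lemma mem_cl: "q \<in> cl p \<longleftrightarrow> q - p \<in> I"
  unfolding cl_def by (auto intro!: image_eqI[of _ _ "q - p"])

lemma presented_carrier: "carrier PA = cl ` {p. keys p \<subseteq> carrier M}"
  by (auto simp: presented_algebra_def Let_def ring.defs module.defs FactRing_def A_RCOSETS_defs
      presented_class_def a_r_coset_def monoid_algebra_simps)

lemma presented_one: "\<one>\<^bsub>PA\<^esub> = cl (single \<one>\<^bsub>M\<^esub> 1)"
  by (simp add: presented_algebra_def Let_def ring.defs module.defs FactRing_def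
      presented_class_def monoid_algebra_simps)

lemma presented_zero: "\<zero>\<^bsub>PA\<^esub> = cl 0"
  by (simp add: presented_algebra_def Let_def ring.defs module.defs FactRing_def cl_def I_def)

lemma presented_mult:
  "keys p \<subseteq> carrier M \<Longrightarrow> keys q \<subseteq> carrier M \<Longrightarrow> cl p \<otimes>\<^bsub>PA\<^esub> cl q = cl (pmul M p q)"
  using I.rcoset_mult_add[of p q]
  by (simp add: presented_algebra_def Let_def ring.defs module.defs FactRing_def
      presented_class_def monoid_algebra_simps I_def[symmetric])

lemma presented_add:
  "keys p \<subseteq> carrier M \<Longrightarrow> keys q \<subseteq> carrier M \<Longrightarrow> cl p \<oplus>\<^bsub>PA\<^esub> cl q = cl (p + q)"
  using I.a_rcos_sum[of p q]
  by (simp add: presented_algebra_def Let_def ring.defs module.defs FactRing_def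
      presented_class_def monoid_algebra_simps I_def[symmetric])

text \<open>The union over representatives in the definition collapses: they differ by elements of
  \<open>I\<close>, which is closed under scalars, so all of them give the same coset.\<close>

lemma presented_smult: "c \<odot>\<^bsub>PA\<^esub> cl p = cl (pscale c p)"
proof -
  have "c \<odot>\<^bsub>PA\<^esub> cl p = (\<Union>q\<in>cl p. cl (pscale c q))"
    by (simp add: presented_algebra_def Let_def ring.defs module.defs FactRing_def
      presented_class_def monoid_algebra_simps)
  also have "cl (pscale c q) = cl (pscale c p)" if "q \<in> cl p" for q
  proof -
    have "pscale c q - pscale c p = pscale c (q - p)"
      by (simp add: P.scale_right_diff_distrib)
    then show ?thesis using that by (simp add: cl_eq_iff mem_cl I_pscale)
  qed
  then have "(\<Union>q\<in>cl p. cl (pscale c q)) = cl (pscale c p)"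
    using cl_self[of p] by blast
  finally show ?thesis .
qed

lemma presented_cases:
  assumes "X \<in> carrier PA"
  obtains p where "keys p \<subseteq> carrier M" "X = cl p"
  using assms by (auto simp: presented_carrier)

lemma cl_carrier: "keys p \<subseteq> carrier M \<Longrightarrow> cl p \<in> carrier PA"
  by (auto simp: presented_carrier)

lemma presented_ring: "ring PA"
proof (rule ringI)
  show "abelian_group PA"
  proof (rule abelian_groupI)
    fix x assume "x \<in> carrier PA"
    then obtain p where p: "keys p \<subseteq> carrier M" "x = cl p" by (rule presented_cases)
    then show "\<exists>y\<in>carrier PA. y \<oplus>\<^bsub>PA\<^esub> x = \<zero>\<^bsub>PA\<^esub>"
      by (intro bexI[of _ "cl (- p)"]) (auto simp: presented_add presented_zero keys_subset_uminus cl_carrier simp del: keys_minus)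
  qed (auto elim!: presented_cases simp: presented_add presented_zero keys_subset_add cl_carrier add_ac)
  show "Group.monoid PA"
  proof (rule Group.monoidI)
    fix x y z assume "x \<in> carrier PA" "y \<in> carrier PA" "z \<in> carrier PA"
    then show "x \<otimes>\<^bsub>PA\<^esub> y \<otimes>\<^bsub>PA\<^esub> z = x \<otimes>\<^bsub>PA\<^esub> (y \<otimes>\<^bsub>PA\<^esub> z)"
      by (elim presented_cases)
         (use MA.m_assoc in \<open>simp add: presented_mult keys_pmul[OF M] monoid_algebra_simps\<close>)
  next
    fix x assume "x \<in> carrier PA"
    then obtain p where p: "keys p \<subseteq> carrier M" "x = cl p" by (rule presented_cases)
    then show "\<one>\<^bsub>PA\<^esub> \<otimes>\<^bsub>PA\<^esub> x = x" "x \<otimes>\<^bsub>PA\<^esub> \<one>\<^bsub>PA\<^esub> = x"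
      using MA.l_one[of p] MA.r_one[of p] by (auto simp: presented_mult presented_one monoid_algebra_simps)
  qed (auto elim!: presented_cases simp: presented_mult presented_one keys_pmul[OF M] cl_carrier)
qed (auto elim!: presented_cases
    simp: presented_mult presented_add keys_pmul[OF M] keys_subset_add pmul_add_left pmul_add_right)

sublocale PA: ring PA by (rule presented_ring)

lemma smult_closed: "X \<in> carrier PA \<Longrightarrow> c \<odot>\<^bsub>PA\<^esub> X \<in> carrier PA"
  by (elim presented_cases) (simp add: presented_smult cl_carrier keys_subset_pscale)

text \<open>The combinations that satisfy \<open>P\<close> form an ideal containing
  \<open>R\<close>, so minimality of \<open>I\<close> applies. Negation has no case of its own:
  \<open>- p\<close> is the product of \<open>p\<close> with minus the unit.\<close>

lemma I_induct [consumes 1, case_names zero rel add left right]: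
  assumes p: "p \<in> I"
    and zero: "P 0"
    and rel: "\<And>r. r \<in> R \<Longrightarrow> P r"
    and add: "\<And>p q. keys p \<subseteq> carrier M \<Longrightarrow> keys q \<subseteq> carrier M \<Longrightarrow> P p \<Longrightarrow> P q \<Longrightarrow> P (p + q)"
    and left: "\<And>p q. keys p \<subseteq> carrier M \<Longrightarrow> keys q \<subseteq> carrier M \<Longrightarrow> P p \<Longrightarrow> P (pmul M q p)"
    and right: "\<And>p q. keys p \<subseteq> carrier M \<Longrightarrow> keys q \<subseteq> carrier M \<Longrightarrow> P p \<Longrightarrow> P (pmul M p q)"
  shows "P p"
proof -
  define J where "J = {p. keys p \<subseteq> carrier M \<and> P p}"
  have "ideal J MA"
  proof (rule idealI)
    show "subgroup J (add_monoid MA)"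
    proof
      fix p assume p: "p \<in> J"
      then have "keys p \<subseteq> carrier M" by (simp add: J_def)
      then have "inv\<^bsub>add_monoid MA\<^esub> p = - p"
        using minus_monoid_algebra[OF M _ \<open>keys p \<subseteq> carrier M\<close>, of 0]
        by (simp add: a_minus_def a_inv_def monoid_algebra_simps)
      moreover have "- p = pmul M (single \<one>\<^bsub>M\<^esub> (- 1)) p"
        using pmul_pscale_left[of M "- 1" "single \<one>\<^bsub>M\<^esub> 1" p] MA.l_one[of p] \<open>keys p \<subseteq> carrier M\<close>
        by (intro poly_mapping_eqI) (simp add: monoid_algebra_simps)
      moreover have "P (pmul M (single \<one>\<^bsub>M\<^esub> (- 1)) p)"
        using p by (intro left) (auto simp: J_def)
      ultimately show "inv\<^bsub>add_monoid MA\<^esub> p \<in> J"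
        using \<open>keys p \<subseteq> carrier M\<close> by (simp add: J_def keys_pmul[OF M])
    qed (use add zero in \<open>auto simp add: monoid_algebra_simps J_def keys_subset_add\<close>)
  qed (use left right in \<open>simp_all add: monoid_algebra_simps MA.ring_axioms J_def keys_pmul[OF M]\<close>)
  moreover have "R \<subseteq> J" using rel R by (simp add: J_def subset_iff)
  ultimately show ?thesis using I_least p unfolding J_def by blast
qed

text \<open>
  The largest two-sided ideal contained in the kernel of a linear map consists of the \<open>p\<close> all of
  whose translates by monoid elements are killed.
\<close>

lemma pext_I:
  assumes s: "vector_space s"
    and "\<And>u v r. u \<in> carrier M \<Longrightarrow> v \<in> carrier M \<Longrightarrow> r \<in> R \<Longrightarrow>
      pext s \<phi> (pmul M (pmul M (single u 1) r) (single v 1)) = 0"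
    and p: "p \<in> I"
  shows "pext s \<phi> p = 0"
proof -
  interpret S: vector_space s by fact
  define J where "J = {p. keys p \<subseteq> carrier M \<and> (\<forall>u\<in>carrier M. \<forall>v\<in>carrier M.
    pext s \<phi> (pmul M (pmul M (single u 1) p) (single v 1)) = 0)}"
  have Jadd: "p + q \<in> J" if "p \<in> J" "q \<in> J" for p q
    using that by (simp add: J_def pmul_add_left pmul_add_right S.pext_add keys_subset_add)
  have assoc: "pmul M (pmul M a b) c = pmul M a (pmul M b c)"
    if "keys a \<subseteq> carrier M" "keys b \<subseteq> carrier M" "keys c \<subseteq> carrier M" for a b c :: "'m \<Rightarrow>\<^sub>0 'k"
    using MA.m_assoc[of a b c] that by (simp add: monoid_algebra_simps)
  have Jl: "pmul M q p \<in> J" if p: "p \<in> J" and q: "keys q \<subseteq> carrier M" for p q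
    using q
  proof (induction q rule: poly_mapping_induct)
    case (single w c)
    have "pmul M (pmul M (single u 1) (pmul M (single w c) p)) (single v 1) =
        pscale c (pmul M (pmul M (single (u \<otimes>\<^bsub>M\<^esub> w) 1) p) (single v 1))"
      if "u \<in> carrier M" "v \<in> carrier M" for u v
    proof -
      have "pmul M (single u 1) (pmul M (single w c) p) = pmul M (single (u \<otimes>\<^bsub>M\<^esub> w) c) p"
        using p that single by (subst assoc[symmetric]) (auto simp: J_def)
      also have "\<dots> = pscale c (pmul M (single (u \<otimes>\<^bsub>M\<^esub> w) 1) p)"
        by (simp flip: pmul_pscale_left)
      finally show ?thesis by (simp add: pmul_pscale_left)
    qed
    then show ?case
      using p single by (simp add: J_def S.pext_pscale keys_pmul[OF M])
  qed (auto simp: pmul_add_left intro: Jadd, auto simp: J_def)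
  have Jr: "pmul M p q \<in> J" if p: "p \<in> J" and q: "keys q \<subseteq> carrier M" for p q
    using q
  proof (induction q rule: poly_mapping_induct)
    case (single w c)
    have "pmul M (pmul M (single u 1) (pmul M p (single w c))) (single v 1) =
        pscale c (pmul M (pmul M (single u 1) p) (single (w \<otimes>\<^bsub>M\<^esub> v) 1))"
      if "u \<in> carrier M" "v \<in> carrier M" for u v
    proof -
      have "pmul M (single u 1) (pmul M p (single w c)) = pmul M (pmul M (single u 1) p) (single w c)"
        using p that single by (subst assoc[symmetric]) (auto simp: J_def)
      moreover have "pmul M \<dots> (single v 1) = pmul M (pmul M (single u 1) p) (single (w \<otimes>\<^bsub>M\<^esub> v) c)"
        using p that single by (subst assoc) (simp_all add: J_def keys_pmul[OF M])
      ultimately show ?thesis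
        by (simp flip: pmul_pscale_right)
    qed
    then show ?case
      using p single by (simp add: J_def S.pext_pscale keys_pmul[OF M])
  qed (auto simp: pmul_add_right intro: Jadd, auto simp: J_def)
  have "p \<in> J"
    using p
  proof (induction p rule: I_induct)
    case (rel r)
    then show ?case using assms(2) R by (simp add: J_def)
  qed (use Jadd Jl Jr in \<open>simp_all add: J_def\<close>)
  then have "pext s \<phi> (pmul M (pmul M (single \<one>\<^bsub>M\<^esub> 1) p) (single \<one>\<^bsub>M\<^esub> 1)) = 0"
    by (auto simp: J_def)
  then show ?thesis
    using MA.l_one[of p] MA.r_one[of p] I_keys[OF p] by (auto simp: monoid_algebra_simps)
qed

text \<open>A functional that kills \<open>I\<close> is constant on each coset, so the image in the
  definition is a singleton and \<open>the_elem\<close> returns its value.\<close>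

lemma quotient_lift_cl:
  assumes "\<And>p. p \<in> I \<Longrightarrow> pext (*) \<phi> p = 0"
  shows "quotient_lift \<phi> (cl p) = pext (*) \<phi> p"
proof -
  have "pext (*) \<phi> q = pext (*) \<phi> p" if "q \<in> cl p" for q
    using assms[of "q - p"] that by (auto simp: mem_cl K_pext_diff)
  then have "pext (*) \<phi> ` cl p = {pext (*) \<phi> p}" using cl_self[of p] by blast
  then show ?thesis by (simp add: quotient_lift_def pext_def[abs_def])
qed

end

section \<open>Morphisms out of presented algebras\<close>

context presentation
begin

lemma I_subspace: "P.subspace I"
  by (rule P.subspaceI) (auto intro: I_add I_pscale)

lemma presented_induct [consumes 1, case_names zero single add smult]:
  assumes X: "X \<in> carrier PA"
    and zero: "P \<zero>\<^bsub>PA\<^esub>"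
    and single: "\<And>m. m \<in> carrier M \<Longrightarrow> P (cl (single m 1))"
    and add: "\<And>X Y. X \<in> carrier PA \<Longrightarrow> Y \<in> carrier PA \<Longrightarrow> P X \<Longrightarrow> P Y \<Longrightarrow> P (X \<oplus>\<^bsub>PA\<^esub> Y)"
    and smult: "\<And>c X. X \<in> carrier PA \<Longrightarrow> P X \<Longrightarrow> P (c \<odot>\<^bsub>PA\<^esub> X)"
  shows "P X"
proof -
  from X obtain p where p: "keys p \<subseteq> carrier M" "X = cl p" by (rule presented_cases)
  from p(1) have "P (cl p)"
  proof (induction p rule: poly_mapping_induct)
    case zero
    then show ?case using \<open>P \<zero>\<^bsub>PA\<^esub>\<close> by (simp add: presented_zero)
  next
    case (single m c)
    have "P (c \<odot>\<^bsub>PA\<^esub> cl (single m 1))"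
      using single by (intro smult assms(3) cl_carrier) auto
    then show ?case by (simp add: presented_smult)
  next
    case (add p q)
    then have "P (cl p \<oplus>\<^bsub>PA\<^esub> cl q)" by (intro assms(4)) (auto intro: cl_carrier)
    then show ?case using add by (simp add: presented_add)
  qed
  with p show ?thesis by simp
qed

text \<open>Morphisms are only known to respect sums, products, units and scalars; written this way,
  zero can be evaluated under them.\<close>

lemma zero_smult: "\<zero>\<^bsub>PA\<^esub> = 0 \<odot>\<^bsub>PA\<^esub> \<one>\<^bsub>PA\<^esub>"
  by (simp add: presented_zero presented_one presented_smult)

lemma alg_hom_eqI:
  assumes h: "h \<in> alg_hom PA B" "h' \<in> alg_hom PA B"
    and eq: "\<And>m. m \<in> carrier M \<Longrightarrow> h (cl (single m 1)) = h' (cl (single m 1))"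
    and X: "X \<in> carrier PA"
  shows "h X = h' X"
  using X
proof (induction X rule: presented_induct)
  case zero
  then show ?case using h by (auto simp: zero_smult alg_hom_def ring_hom_def)
qed (use h eq in \<open>auto simp: alg_hom_def ring_hom_def\<close>)

lemma pext_pmul:
  assumes "\<And>u v. u \<in> carrier M \<Longrightarrow> v \<in> carrier M \<Longrightarrow> \<phi> (u \<otimes>\<^bsub>M\<^esub> v) = pmul N (\<phi> u) (\<phi> v)"
    and "keys p \<subseteq> carrier M" "keys q \<subseteq> carrier M"
  shows "pext pscale \<phi> (pmul M p q) = pmul N (pext pscale \<phi> p) (pext pscale \<phi> q)"
  using assms(2)
proof (induction p rule: poly_mapping_induct)
  case (single u a)
  from assms(3) show ?case
    by (induction q rule: poly_mapping_induct)
       (use single assms(1) in \<open>simp_all add: pmul_add_right P.pext_add pmul_pscale_left pmul_pscale_right\<close>)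
qed (simp_all add: pmul_add_left P.pext_add)

lemma pext_mult:
  fixes \<phi> :: "'m \<Rightarrow> 'k"
  assumes "\<And>u v. u \<in> carrier M \<Longrightarrow> v \<in> carrier M \<Longrightarrow> \<phi> (u \<otimes>\<^bsub>M\<^esub> v) = \<phi> u * \<phi> v"
    and "keys p \<subseteq> carrier M" "keys q \<subseteq> carrier M"
  shows "pext (*) \<phi> (pmul M p q) = pext (*) \<phi> p * pext (*) \<phi> q"
  using assms(2)
proof (induction p rule: poly_mapping_induct)
  case (single u a)
  from assms(3) show ?case
  proof (induction q rule: poly_mapping_induct)
    case (single v b)
    then show ?case using assms(1)[OF \<open>u \<in> carrier M\<close> \<open>v \<in> carrier M\<close>] by (simp add: mult_ac)
  qed (simp_all add: pmul_add_right K_pext_add distrib_left)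
qed (simp_all add: pmul_add_left K_pext_add distrib_right)

text \<open>The extension of a multiplicative \<open>\<phi>\<close> is itself multiplicative, so its
  kernel is an ideal and only the relations have to be tested, not their translates.\<close>

lemma pext_mult_I:
  fixes \<phi> :: "'m \<Rightarrow> 'k"
  assumes mult: "\<And>u v. u \<in> carrier M \<Longrightarrow> v \<in> carrier M \<Longrightarrow> \<phi> (u \<otimes>\<^bsub>M\<^esub> v) = \<phi> u * \<phi> v"
    and rel: "\<And>r. r \<in> R \<Longrightarrow> pext (*) \<phi> r = 0"
    and p: "p \<in> I"
  shows "pext (*) \<phi> p = 0"
  using p by (induction p rule: I_induct) (simp_all add: K_pext_add pext_mult mult rel)

lemma character_lift:
  fixes \<phi> :: "'m \<Rightarrow> 'k"
  assumes mult: "\<And>u v. u \<in> carrier M \<Longrightarrow> v \<in> carrier M \<Longrightarrow> \<phi> (u \<otimes>\<^bsub>M\<^esub> v) = \<phi> u * \<phi> v"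
    and one: "\<phi> \<one>\<^bsub>M\<^esub> = 1"
    and rel: "\<And>r. r \<in> R \<Longrightarrow> pext (*) \<phi> r = 0"
  shows "restrict (quotient_lift \<phi>) (carrier PA) \<in> characters PA"
    and "keys p \<subseteq> carrier M \<Longrightarrow> restrict (quotient_lift \<phi>) (carrier PA) (cl p) = pext (*) \<phi> p"
proof -
  have ql: "quotient_lift \<phi> (cl p) = pext (*) \<phi> p" for p
    by (rule quotient_lift_cl) (rule pext_mult_I[OF mult rel])
  then show "keys p \<subseteq> carrier M \<Longrightarrow> restrict (quotient_lift \<phi>) (carrier PA) (cl p) = pext (*) \<phi> p"
    by (simp add: cl_carrier)
  have "restrict (quotient_lift \<phi>) (carrier PA) \<in> ring_hom PA ground_field"
    by (rule ring_hom_memI)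
       (auto elim!: presented_cases simp: presented_mult presented_add cl_carrier keys_pmul[OF M]
         keys_subset_add ql K_pext_add pext_mult mult one presented_one ground_field_def)
  then show "restrict (quotient_lift \<phi>) (carrier PA) \<in> characters PA"
    by (auto simp: characters_def alg_hom_def smult_closed elim!: presented_cases)
       (simp add: presented_smult ql K_pext_pscale ground_field_def)
qed

lemma character_eqI:
  assumes "h \<in> characters PA" "h' \<in> characters PA"
    and eq: "\<And>m. m \<in> carrier M \<Longrightarrow> h (cl (single m 1)) = h' (cl (single m 1))"
  shows "h = h'"
proof (rule extensionalityI)
  show "h \<in> extensional (carrier PA)" "h' \<in> extensional (carrier PA)"
    using assms by (auto simp: characters_def)
  show "h x = h' x" if "x \<in> carrier PA" for x
    by (rule alg_hom_eqI[of h ground_field h'])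
       (use assms(1,2) that eq in \<open>simp_all add: characters_def\<close>)
qed

text \<open>Universal property of the presentation with values in another presented algebra. The map
  on generators is given by representatives that multiply exactly in the algebra of
  \<open>N\<close>; only the relations are asked to hold modulo its ideal.\<close>

lemma hom_lift:
  fixes N :: "('n, 'y) monoid_scheme"
  assumes N: "presentation N S"
    and keys: "\<And>u. u \<in> carrier M \<Longrightarrow> keys (\<phi> u) \<subseteq> carrier N"
    and mult: "\<And>u v. u \<in> carrier M \<Longrightarrow> v \<in> carrier M \<Longrightarrow> \<phi> (u \<otimes>\<^bsub>M\<^esub> v) = pmul N (\<phi> u) (\<phi> v)"
    and one: "\<phi> \<one>\<^bsub>M\<^esub> = single \<one>\<^bsub>N\<^esub> 1"
    and rel: "\<And>r. r \<in> R \<Longrightarrow> pext pscale \<phi> r \<in> presentation.I N S"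
  obtains D where "D \<in> alg_hom PA (presented_algebra N S)" "D \<in> extensional (carrier PA)"
    "\<And>p. keys p \<subseteq> carrier M \<Longrightarrow> D (cl p) = presented_class N S (pext pscale \<phi> p)"
proof -
  interpret N: presentation N S by fact
  have hkeys: "keys (pext pscale \<phi> p) \<subseteq> carrier N" if "keys p \<subseteq> carrier M" for p
    unfolding pext_def using that keys by (intro keys_subset_sum keys_subset_pscale) auto
  have hI: "pext pscale \<phi> p \<in> N.I" if "p \<in> I" for p
    using that
    by (induction p rule: I_induct)
       (simp_all add: P.pext_add N.I_add pext_pmul[OF mult] rel hkeys N.I_mul_left N.I_mul_right)
  \<comment> \<open>Any representative of the class may be taken: two of them differ by an element
    of \<open>I\<close>, which \<open>hI\<close> sends into \<open>N.I\<close>.\<close>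
  define D where "D = (\<lambda>X\<in>carrier PA. N.cl (pext pscale \<phi> (SOME p. keys p \<subseteq> carrier M \<and> X = cl p)))"
  have D: "D (cl p) = N.cl (pext pscale \<phi> p)" if p: "keys p \<subseteq> carrier M" for p
  proof -
    define q where "q = (SOME q. keys q \<subseteq> carrier M \<and> cl p = cl q)"
    have "keys q \<subseteq> carrier M \<and> cl p = cl q"
      unfolding q_def by (rule someI[of _ p]) (use p in auto)
    then have "pext pscale \<phi> q - pext pscale \<phi> p \<in> N.I"
      using hI[of "q - p"] by (metis P.pext_diff cl_eq_iff)
    then have "N.cl (pext pscale \<phi> q) = N.cl (pext pscale \<phi> p)"
      by (simp add: N.cl_eq_iff)
    then show ?thesis by (simp add: D_def cl_carrier[OF p] q_def)
  qed
  show ?thesis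
  proof (rule that[OF _ _ D])
    have "D \<in> ring_hom PA N.PA"
      by (rule ring_hom_memI)
         (auto elim!: presented_cases simp: presented_mult presented_add presented_one D
           keys_pmul[OF M] keys_pmul[OF N.M] keys_subset_add P.pext_add hkeys N.cl_carrier
           pext_pmul[OF mult] N.presented_add N.presented_mult N.presented_one one)
    moreover have "D (c \<odot>\<^bsub>PA\<^esub> X) = c \<odot>\<^bsub>N.PA\<^esub> D X" if "X \<in> carrier PA" for c X
      using that
      by (elim presented_cases)
         (simp add: presented_smult D keys_subset_pscale P.pext_pscale N.presented_smult)
    ultimately show "D \<in> alg_hom PA N.PA"
      by (simp add: alg_hom_def)
    show "D \<in> extensional (carrier PA)" unfolding D_def by (rule restrict_extensional)
  qed
qed

end

section \<open>Tensor squares\<close>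

locale tensor_square = presentation M R
  for M :: "('m, 'z) monoid_scheme" and R :: "('m \<Rightarrow>\<^sub>0 'k::field) set"
begin

sublocale T: presentation "PA \<times>\<times> PA" "bilinear_relations PA PA"
proof (rule presentation.intro)
  show "Group.monoid (PA \<times>\<times> PA)"
    using PA.monoid_axioms by (intro DirProd_monoid)
  fix r assume "r \<in> bilinear_relations PA PA"
  then show "keys r \<subseteq> carrier (PA \<times>\<times> PA)"
    by (elim bilinear_relations_def[THEN equalityD1, THEN subsetD, elim_format] UnE CollectE exE conjE)
       (simp_all add: DirProd_def smult_closed keys_subset_diff)
qed

lemma T_carrier: "carrier (PA \<times>\<times> PA) = carrier PA \<times> carrier PA"
  by (simp add: DirProd_def)

lemma T_mult: "(a, b) \<otimes>\<^bsub>PA \<times>\<times> PA\<^esub> (a', b') = (a \<otimes>\<^bsub>PA\<^esub> a', b \<otimes>\<^bsub>PA\<^esub> b')"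
  by (simp add: DirProd_def)

lemma tensor_product_eq: "tensor_product PA PA = T.PA"
  by (simp add: tensor_product_def)

lemma pure_tensor_eq: "pure_tensor PA PA a b = T.cl (single (a, b) 1)"
  by (simp add: pure_tensor_def)

lemma T_add_left:
  "a \<in> carrier PA \<Longrightarrow> a' \<in> carrier PA \<Longrightarrow> b \<in> carrier PA \<Longrightarrow>
    single (a \<oplus>\<^bsub>PA\<^esub> a', b) 1 - (single (a, b) 1 + single (a', b) 1) \<in> T.I"
  unfolding diff_diff_eq[symmetric]
  by (intro T.R_I[THEN subsetD], unfold bilinear_relations_def) blast

lemma T_add_right:
  "a \<in> carrier PA \<Longrightarrow> b \<in> carrier PA \<Longrightarrow> b' \<in> carrier PA \<Longrightarrow>
    single (a, b \<oplus>\<^bsub>PA\<^esub> b') 1 - (single (a, b) 1 + single (a, b') 1) \<in> T.I"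
  unfolding diff_diff_eq[symmetric]
  by (intro T.R_I[THEN subsetD], unfold bilinear_relations_def) blast

lemma T_smult_left:
  "a \<in> carrier PA \<Longrightarrow> b \<in> carrier PA \<Longrightarrow> single (c \<odot>\<^bsub>PA\<^esub> a, b) 1 - single (a, b) c \<in> T.I"
  by (intro T.R_I[THEN subsetD], unfold bilinear_relations_def) blast

lemma T_smult_right:
  "a \<in> carrier PA \<Longrightarrow> b \<in> carrier PA \<Longrightarrow> single (a, c \<odot>\<^bsub>PA\<^esub> b) 1 - single (a, b) c \<in> T.I"
  by (intro T.R_I[THEN subsetD], unfold bilinear_relations_def) blast

text \<open>The product of \<open>PA\<close> is bilinear, so a bilinearity relation multiplied by
  pairs on both sides is again a bilinearity relation, which \<open>\<phi>\<close> kills.\<close>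

lemma pext_bilinear_I:
  assumes s: "vector_space s"
    and add_left: "\<And>a a' b. a \<in> carrier PA \<Longrightarrow> a' \<in> carrier PA \<Longrightarrow> b \<in> carrier PA \<Longrightarrow>
      \<phi> (a \<oplus>\<^bsub>PA\<^esub> a', b) = \<phi> (a, b) + \<phi> (a', b)"
    and add_right: "\<And>a b b'. a \<in> carrier PA \<Longrightarrow> b \<in> carrier PA \<Longrightarrow> b' \<in> carrier PA \<Longrightarrow>
      \<phi> (a, b \<oplus>\<^bsub>PA\<^esub> b') = \<phi> (a, b) + \<phi> (a, b')"
    and smult_left: "\<And>c a b. a \<in> carrier PA \<Longrightarrow> b \<in> carrier PA \<Longrightarrow> \<phi> (c \<odot>\<^bsub>PA\<^esub> a, b) = s c (\<phi> (a, b))"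
    and smult_right: "\<And>c a b. a \<in> carrier PA \<Longrightarrow> b \<in> carrier PA \<Longrightarrow> \<phi> (a, c \<odot>\<^bsub>PA\<^esub> b) = s c (\<phi> (a, b))"
    and p: "p \<in> T.I"
  shows "pext s \<phi> p = 0"
proof (rule T.pext_I[OF s _ p])
  interpret S: vector_space s by fact
  have sl: "x \<otimes>\<^bsub>PA\<^esub> (c \<odot>\<^bsub>PA\<^esub> a) \<otimes>\<^bsub>PA\<^esub> y = c \<odot>\<^bsub>PA\<^esub> (x \<otimes>\<^bsub>PA\<^esub> a \<otimes>\<^bsub>PA\<^esub> y)"
    if "x \<in> carrier PA" "a \<in> carrier PA" "y \<in> carrier PA" for x a y c
    using that
    by (elim presented_cases)
       (simp add: presented_smult presented_mult keys_pmul[OF M] keys_subset_pscale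
         pmul_pscale_right pmul_pscale_left)
  fix u v r assume "u \<in> carrier (PA \<times>\<times> PA)" "v \<in> carrier (PA \<times>\<times> PA)" "r \<in> bilinear_relations PA PA"
  then show "pext s \<phi> (pmul (PA \<times>\<times> PA) (pmul (PA \<times>\<times> PA) (single u 1) r) (single v 1)) = 0"
    by (auto simp: bilinear_relations_def T_carrier pmul_diff_left pmul_diff_right S.pext_diff T_mult
        PA.l_distr PA.r_distr add_left add_right sl smult_left smult_right smult_closed)
qed

lemma tensor_functional_cl:
  assumes "linear_on PA (*) \<alpha>" "linear_on PA (*) \<beta>"
  shows "tensor_functional \<alpha> \<beta> (T.cl p) = pext (*) (\<lambda>(a, b). \<alpha> a * \<beta> b) p"
  unfolding tensor_functional_def
proof (rule T.quotient_lift_cl)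
  fix p assume "p \<in> T.I"
  then show "pext (*) (\<lambda>(a, b). \<alpha> a * \<beta> b) p = 0"
    using assms
    by (intro pext_bilinear_I) (auto simp: vector_space_mult linear_on_def algebra_simps)
qed

lemma character_linear: "\<alpha> \<in> characters PA \<Longrightarrow> linear_on PA (*) \<alpha>"
  by (auto simp: characters_def alg_hom_def ring_hom_def linear_on_def ground_field_def)

text \<open>The product of two characters is multiplicative on pairs because the field is
  commutative, hence the tensor functional is multiplicative on the tensor square; composition with
  the morphism \<open>D\<close> gives a character.\<close>

lemma convolution_character:
  assumes ab: "\<alpha> \<in> characters PA" "\<beta> \<in> characters PA" and D: "D \<in> alg_hom PA T.PA"
  shows "(\<lambda>a\<in>carrier PA. tensor_functional \<alpha> \<beta> (D a)) \<in> characters PA"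
proof -
  let ?\<tau> = "tensor_functional \<alpha> \<beta>" and ?\<phi> = "\<lambda>(a, b). \<alpha> a * \<beta> b"
  have \<tau>: "?\<tau> (T.cl p) = pext (*) ?\<phi> p" for p
    using ab by (intro tensor_functional_cl character_linear)
  have mult: "?\<phi> (u \<otimes>\<^bsub>PA \<times>\<times> PA\<^esub> v) = ?\<phi> u * ?\<phi> v"
    if "u \<in> carrier (PA \<times>\<times> PA)" "v \<in> carrier (PA \<times>\<times> PA)" for u v
    using that ab
    by (auto simp: T_carrier T_mult characters_def alg_hom_def ring_hom_def ground_field_def)
  have one: "?\<phi> \<one>\<^bsub>PA \<times>\<times> PA\<^esub> = 1"
    using ab by (auto simp: DirProd_def characters_def alg_hom_def ring_hom_def ground_field_def)
  have Dc: "D x \<in> carrier T.PA" if "x \<in> carrier PA" for x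
    using D that by (auto simp: alg_hom_def ring_hom_def)
  have "?\<tau> (X \<oplus>\<^bsub>T.PA\<^esub> Y) = ?\<tau> X + ?\<tau> Y" "?\<tau> (X \<otimes>\<^bsub>T.PA\<^esub> Y) = ?\<tau> X * ?\<tau> Y"
    if "X \<in> carrier T.PA" "Y \<in> carrier T.PA" for X Y
  proof -
    from that(1) obtain p where "keys p \<subseteq> carrier (PA \<times>\<times> PA)" "X = T.cl p"
      by (rule T.presented_cases)
    moreover from that(2) obtain q where "keys q \<subseteq> carrier (PA \<times>\<times> PA)" "Y = T.cl q"
      by (rule T.presented_cases)
    ultimately have pq: "keys p \<subseteq> carrier (PA \<times>\<times> PA)" "X = T.cl p"
      "keys q \<subseteq> carrier (PA \<times>\<times> PA)" "Y = T.cl q" by blast+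
    have "?\<tau> (T.cl p \<oplus>\<^bsub>T.PA\<^esub> T.cl q) = ?\<tau> (T.cl p) + ?\<tau> (T.cl q)"
      unfolding T.presented_add[OF pq(1,3)] \<tau> by (rule K_pext_add)
    moreover have "?\<tau> (T.cl p \<otimes>\<^bsub>T.PA\<^esub> T.cl q) = ?\<tau> (T.cl p) * ?\<tau> (T.cl q)"
      unfolding T.presented_mult[OF pq(1,3)] \<tau> by (rule T.pext_mult[OF mult pq(1,3)])
    ultimately show "?\<tau> (X \<oplus>\<^bsub>T.PA\<^esub> Y) = ?\<tau> X + ?\<tau> Y" "?\<tau> (X \<otimes>\<^bsub>T.PA\<^esub> Y) = ?\<tau> X * ?\<tau> Y"
      unfolding pq(2,4) .
  qed
  moreover have "?\<tau> (c \<odot>\<^bsub>T.PA\<^esub> X) = c * ?\<tau> X" if "X \<in> carrier T.PA" for c X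
    using that by (auto elim!: T.presented_cases simp: T.presented_smult \<tau> K_pext_pscale)
  moreover have "?\<tau> \<one>\<^bsub>T.PA\<^esub> = 1"
    using one by (simp add: T.presented_one \<tau>)
  ultimately show ?thesis
    using D Dc by (auto simp: characters_def alg_hom_def ring_hom_def ground_field_def smult_closed)
qed

end

section \<open>Multilinear functions of words\<close>

definition words :: "'j set \<Rightarrow> nat \<Rightarrow> 'j list set" where
  "words J n = {u. set u \<subseteq> J \<and> length u = n}"

lemma finite_words [simp]: "finite J \<Longrightarrow> finite (words J n)"
  unfolding words_def by (rule finite_lists_length_eq)

lemma words_0 [simp]: "words J 0 = {[]}"
  by (auto simp: words_def)

lemma sum_words_Suc:
  "(\<Sum>u\<in>words J (Suc n). f u) = (\<Sum>j\<in>J. \<Sum>u\<in>words J n. f (j # u))"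
proof -
  have "words J (Suc n) = (\<lambda>(j, u). j # u) ` (J \<times> words J n)"
    by (force simp: words_def length_Suc_conv)
  moreover have "inj_on (\<lambda>(j, u). j # u) (J \<times> words J n)"
    by (auto intro!: inj_onI)
  ultimately show ?thesis
    by (simp add: sum.reindex sum.cartesian_product split_def)
qed

text \<open>The permutations that enter the pairing: all of them for symmetric words, only the
  identity for tensor words. A single formula then covers both pairings.\<close>

definition perms :: "bool \<Rightarrow> nat \<Rightarrow> (nat \<Rightarrow> nat) set" where
  "perms c n = (if c then {\<sigma>. \<sigma> permutes {..<n}} else {id})"

lemma perms_permutes: "\<sigma> \<in> perms c n \<Longrightarrow> \<sigma> permutes {..<n}"
  by (auto simp: perms_def permutes_id split: if_splits)

lemma finite_perms [simp]: "finite (perms c n)"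
  by (simp add: perms_def finite_permutations)

lemma card_perms [simp]: "card (perms c n) = (if c then fact n else 1)"
  by (simp add: perms_def card_permutations)

lemma sum_perms_inv: "(\<Sum>\<sigma>\<in>perms c n. f \<sigma>) = (\<Sum>\<sigma>\<in>perms c n. f (Hilbert_Choice.inv \<sigma>))"
  by (cases c) (simp_all add: perms_def sum_permutations_inverse[of f])

text \<open>Multilinearity modulo a subspace. For \<open>I = {0}\<close> this is the ordinary
  notion, satisfied by pairings and brackets; with \<open>I\<close> the ideal of relations it is
  satisfied by the map sending a word to its \<open>single\<close>. One expansion lemma serves
  both.\<close>

locale multilinear_mod = X: vector_space s + Y: vector_space t
  for s :: "'k::field \<Rightarrow> 'x::ab_group_add \<Rightarrow> 'x" and t :: "'k \<Rightarrow> 'y::ab_group_add \<Rightarrow> 'y" +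
  fixes W :: "'x set" and I :: "'y set" and m :: "'x list \<Rightarrow> 'y"
  assumes W: "X.subspace W" and I: "Y.subspace I"
    and add: "us \<in> lists W \<Longrightarrow> vs \<in> lists W \<Longrightarrow> x \<in> W \<Longrightarrow> y \<in> W \<Longrightarrow>
      m (us @ (x + y) # vs) - (m (us @ x # vs) + m (us @ y # vs)) \<in> I"
    and scale: "us \<in> lists W \<Longrightarrow> vs \<in> lists W \<Longrightarrow> x \<in> W \<Longrightarrow>
      m (us @ s a x # vs) - t a (m (us @ x # vs)) \<in> I"

text \<open>Only adjacent letters are exchanged, which is what the translates of the commutation
  relations provide; arbitrary rearrangements follow in \<open>symmetric_mod_mset\<close>.\<close>

definition symmetric_mod :: "'x set \<Rightarrow> 'y::ab_group_add set \<Rightarrow> ('x list \<Rightarrow> 'y) \<Rightarrow> bool" where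
  "symmetric_mod W I m \<longleftrightarrow> (\<forall>us\<in>lists W. \<forall>vs\<in>lists W. \<forall>x\<in>W. \<forall>y\<in>W.
    m (us @ x # y # vs) - m (us @ y # x # vs) \<in> I)"

context vector_space
begin

lemma subspace_cong_trans: "subspace I \<Longrightarrow> a - b \<in> I \<Longrightarrow> b - c \<in> I \<Longrightarrow> a - c \<in> I"
  using subspace_add[of I "a - b" "b - c"] by simp

lemma subspace_cong_sym: "subspace I \<Longrightarrow> a - b \<in> I \<Longrightarrow> b - a \<in> I"
  using subspace_neg[of I "a - b"] by simp

lemma subspace_cong_sum:
  "subspace I \<Longrightarrow> (\<And>i. i \<in> A \<Longrightarrow> f i - g i \<in> I) \<Longrightarrow> sum f A - sum g A \<in> I"
  by (simp add: subspace_sum flip: sum_subtractf)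

lemma subspace_cong_scale: "subspace I \<Longrightarrow> a - b \<in> I \<Longrightarrow> scale c a - scale c b \<in> I"
  by (simp add: subspace_scale flip: scale_right_diff_distrib)

text \<open>The step \<open>move\<close> carries one letter past a block by adjacent exchanges.
  Induction on \<open>xs\<close> then locates its first letter in \<open>ys\<close>, moves it to the
  front, and absorbs it into the prefix \<open>pre\<close>.\<close>

lemma symmetric_mod_mset:
  assumes "subspace I" "symmetric_mod W I m" "xs \<in> lists W" "ys \<in> lists W" "mset xs = mset ys"
  shows "m xs - m ys \<in> I"
proof -
  have move: "m (pre @ x # a @ b) - m (pre @ a @ x # b) \<in> I"
    if "pre \<in> lists W" "x \<in> W" "a \<in> lists W" "b \<in> lists W" for pre x a b
    using that
  proof (induction a arbitrary: pre)
    case Nil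
    then show ?case using \<open>subspace I\<close> by (simp add: subspace_0)
  next
    case (Cons y a)
    have "m (pre @ x # y # a @ b) - m (pre @ y # x # a @ b) \<in> I"
      using Cons.prems assms(2) by (auto simp: symmetric_mod_def)
    moreover have "m ((pre @ [y]) @ x # a @ b) - m ((pre @ [y]) @ a @ x # b) \<in> I"
      using Cons.prems by (intro Cons.IH) auto
    then have "m (pre @ y # x # a @ b) - m (pre @ y # a @ x # b) \<in> I" by simp
    ultimately show ?case
      unfolding append_Cons by (rule subspace_cong_trans[OF \<open>subspace I\<close>])
  qed
  have "m (pre @ xs) - m (pre @ ys) \<in> I" if "pre \<in> lists W" for pre
    using assms(3-5) that
  proof (induction xs arbitrary: ys pre)
    case Nil
    then show ?case using \<open>subspace I\<close> by (simp add: subspace_0)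
  next
    case (Cons x xs)
    then have "x \<in> set ys" by (metis list.set_intros(1) set_mset_mset)
    then obtain a b where ys: "ys = a @ x # b" by (auto simp: in_set_conv_decomp)
    have "m ((pre @ [x]) @ xs) - m ((pre @ [x]) @ a @ b) \<in> I"
      using Cons.prems ys by (intro Cons.IH) auto
    then have "m (pre @ x # xs) - m (pre @ x # a @ b) \<in> I" by simp
    moreover have "m (pre @ x # a @ b) - m (pre @ a @ x # b) \<in> I"
      using Cons.prems ys by (intro move) auto
    ultimately show ?case
      unfolding ys by (rule subspace_cong_trans[OF \<open>subspace I\<close>])
  qed
  from this[of "[]"] show ?thesis by simp
qed

end

context multilinear_mod
begin

lemma zero:
  assumes "us \<in> lists W" "vs \<in> lists W"
  shows "m (us @ 0 # vs) \<in> I"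
  using scale[OF assms X.subspace_0[OF W], of 0] by simp

lemma sum_slot:
  assumes "us \<in> lists W" "vs \<in> lists W" "\<And>j. j \<in> J \<Longrightarrow> x j \<in> W"
  shows "m (us @ (\<Sum>j\<in>J. x j) # vs) - (\<Sum>j\<in>J. m (us @ x j # vs)) \<in> I"
  using assms(3)
proof (induction J rule: infinite_finite_induct)
  case (insert j J)
  have "m (us @ (x j + (\<Sum>j\<in>J. x j)) # vs)
      - (m (us @ x j # vs) + m (us @ (\<Sum>j\<in>J. x j) # vs)) \<in> I"
    using insert assms by (intro add X.subspace_sum[OF W]) auto
  moreover have "m (us @ x j # vs) + m (us @ (\<Sum>j\<in>J. x j) # vs)
      - (m (us @ x j # vs) + (\<Sum>j\<in>J. m (us @ x j # vs))) \<in> I"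
    using insert by simp
  ultimately show ?case
    using insert Y.subspace_cong_trans[OF I] by simp
qed (use assms zero in auto)

text \<open>Every letter is replaced by its expansion in the family \<open>e\<close>, one slot after
  the other; \<open>pre\<close> holds the letters already replaced.\<close>

lemma expand:
  assumes "finite J" "\<And>j. j \<in> J \<Longrightarrow> e j \<in> W" "zs \<in> lists W" "pre \<in> lists W"
    and "\<And>z. z \<in> set zs \<Longrightarrow> z = (\<Sum>j\<in>J. s (\<zeta> z j) (e j))"
  shows "(\<Sum>u\<in>words J (length zs). t (\<Prod>i<length zs. \<zeta> (zs ! i) (u ! i)) (m (pre @ map e u)))
    - m (pre @ zs) \<in> I"
  using assms(3-5)
proof (induction zs arbitrary: pre)
  case Nil
  then show ?case using Y.subspace_0[OF I] by simp
next
  case (Cons z zs)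
  have W': "pre \<in> lists W" "zs \<in> lists W" using Cons.prems(1) Cons.hyps by simp_all
  define c where "c u = (\<Prod>i<length zs. \<zeta> (zs ! i) (u ! i))" for u
  have e: "map e u \<in> lists W" if "u \<in> words J n" for u n
    using that assms(2) by (auto simp: words_def subset_iff)
  let ?S = "\<Sum>u\<in>words J (length (z # zs)).
      t (\<Prod>i<length (z # zs). \<zeta> ((z # zs) ! i) (u ! i)) (m (pre @ map e u))"
  have "?S = (\<Sum>j\<in>J. t (\<zeta> z j) (\<Sum>u\<in>words J (length zs). t (c u) (m ((pre @ [e j]) @ map e u))))"
    by (simp add: sum_words_Suc prod.lessThan_Suc_shift Y.scale_sum_right c_def del: prod.lessThan_Suc)
  also have "\<dots> - (\<Sum>j\<in>J. t (\<zeta> z j) (m ((pre @ [e j]) @ zs))) \<in> I"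
    unfolding c_def
    using Cons.prems assms(2)
    by (intro Y.subspace_cong_sum[OF I] Y.subspace_cong_scale[OF I] Cons.IH) auto
  finally have "?S - (\<Sum>j\<in>J. t (\<zeta> z j) (m ((pre @ [e j]) @ zs))) \<in> I" .
  moreover have "(\<Sum>j\<in>J. t (\<zeta> z j) (m ((pre @ [e j]) @ zs))) - (\<Sum>j\<in>J. m (pre @ s (\<zeta> z j) (e j) # zs)) \<in> I"
    by (intro Y.subspace_cong_sum[OF I]) (simp add: Y.subspace_cong_sym[OF I scale] W' assms(2))
  moreover have "(\<Sum>j\<in>J. m (pre @ s (\<zeta> z j) (e j) # zs)) - m (pre @ (\<Sum>j\<in>J. s (\<zeta> z j) (e j)) # zs) \<in> I"
    by (rule Y.subspace_cong_sym[OF I], rule sum_slot)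
       (simp_all add: W' assms(2) X.subspace_scale[OF W])
  ultimately have "?S - m (pre @ (\<Sum>j\<in>J. s (\<zeta> z j) (e j)) # zs) \<in> I"
    using Y.subspace_cong_trans[OF I] by blast
  moreover have "(\<Sum>j\<in>J. s (\<zeta> z j) (e j)) = z"
    by (rule Cons.prems(2)[symmetric]) simp
  ultimately show ?case by (simp only:)
qed

text \<open>For a fixed permutation, permuting the word \<open>u\<close> is a bijection of the index
  words that changes \<open>m\<close> only modulo \<open>I\<close>. So each permutation contributes
  one copy of \<open>m zs\<close>; their number is the factor that \<open>weight\<close> later
  removes.\<close>

lemma symmetrized_expand:
  assumes J: "finite J" "\<And>j. j \<in> J \<Longrightarrow> e j \<in> W" and zs: "zs \<in> lists W"
    and \<zeta>: "\<And>z. z \<in> set zs \<Longrightarrow> z = (\<Sum>j\<in>J. s (\<zeta> z j) (e j))"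
    and sym: "c \<Longrightarrow> symmetric_mod W I m" and k: "length zs = k"
  shows "(\<Sum>u\<in>words J k. t (\<Sum>\<sigma>\<in>perms c k. \<Prod>i<k. \<zeta> (zs ! i) (u ! \<sigma> i)) (m (map e u)))
    - t (of_nat (card (perms c k))) (m zs) \<in> I"
proof -
  have "(\<Sum>u\<in>words J k. t (\<Prod>i<k. \<zeta> (zs ! i) (u ! \<sigma> i)) (m (map e u))) - m zs \<in> I"
    if "\<sigma> \<in> perms c k" for \<sigma>
  proof -
    note \<sigma> = perms_permutes[OF that]
    have perm: "permute_list \<sigma> u \<in> words J k" "mset (permute_list \<sigma> u) = mset u"
      "i < k \<Longrightarrow> permute_list \<sigma> u ! i = u ! \<sigma> i" if "u \<in> words J k" for u i
      using that \<sigma> by (auto simp: words_def permute_list_nth)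
    have bij: "bij_betw (permute_list \<sigma>) (words J k) (words J k)"
    proof -
      have "inj_on (permute_list \<sigma>) (words J k)"
      proof (rule inj_onI)
        fix u v assume uv: "u \<in> words J k" "v \<in> words J k" "permute_list \<sigma> u = permute_list \<sigma> v"
        have "u ! i = v ! i" if i: "i < k" for i
        proof -
          obtain j where "j < k" "i = \<sigma> j"
            using \<sigma> i by (metis lessThan_iff permutes_surj permutes_in_image surjD)
          then show ?thesis using perm(3)[OF uv(1)] perm(3)[OF uv(2)] uv(3) by metis
        qed
        then show "u = v" using uv by (auto simp: words_def intro: nth_equalityI)
      qed
      moreover have "permute_list \<sigma> ` words J k \<subseteq> words J k" using perm by auto
      ultimately show ?thesis
        using J(1) by (simp add: bij_betw_def endo_inj_surj)
    qed
    have swap: "m (map e u) - m (map e (permute_list \<sigma> u)) \<in> I" if u: "u \<in> words J k" for u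
    proof (cases c)
      case True
      then show ?thesis
        using u perm[OF u] J(2)
        by (intro Y.symmetric_mod_mset[OF I sym]) (auto simp: words_def subset_iff)
    next
      case False
      then show ?thesis
        using \<open>\<sigma> \<in> perms c k\<close> Y.subspace_0[OF I] by (simp add: perms_def)
    qed
    have "(\<Sum>u\<in>words J k. t (\<Prod>i<k. \<zeta> (zs ! i) (u ! \<sigma> i)) (m (map e u)))
      - (\<Sum>u\<in>words J k. t (\<Prod>i<k. \<zeta> (zs ! i) (permute_list \<sigma> u ! i)) (m (map e (permute_list \<sigma> u)))) \<in> I"
    proof (intro Y.subspace_cong_sum[OF I])
      fix u assume u: "u \<in> words J k"
      have "(\<Prod>i<k. \<zeta> (zs ! i) (permute_list \<sigma> u ! i)) = (\<Prod>i<k. \<zeta> (zs ! i) (u ! \<sigma> i))"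
        using perm(3)[OF u] by simp
      then show "t (\<Prod>i<k. \<zeta> (zs ! i) (u ! \<sigma> i)) (m (map e u))
          - t (\<Prod>i<k. \<zeta> (zs ! i) (permute_list \<sigma> u ! i)) (m (map e (permute_list \<sigma> u))) \<in> I"
        using Y.subspace_cong_scale[OF I swap[OF u]] by simp
    qed
    also have "(\<Sum>u\<in>words J k. t (\<Prod>i<k. \<zeta> (zs ! i) (permute_list \<sigma> u ! i)) (m (map e (permute_list \<sigma> u))))
      = (\<Sum>u\<in>words J k. t (\<Prod>i<k. \<zeta> (zs ! i) (u ! i)) (m (map e u)))"
      by (rule sum.reindex_bij_betw[OF bij])
    finally show ?thesis
      by (rule Y.subspace_cong_trans[OF I])
         (use expand[OF J zs _ \<zeta>, of "[]"] k in simp)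
  qed
  then have "(\<Sum>\<sigma>\<in>perms c k. \<Sum>u\<in>words J k. t (\<Prod>i<k. \<zeta> (zs ! i) (u ! \<sigma> i)) (m (map e u)))
      - (\<Sum>\<sigma>\<in>perms c k. m zs) \<in> I"
    by (rule Y.subspace_cong_sum[OF I])
  also have "(\<Sum>\<sigma>\<in>perms c k. m zs) = t (of_nat (card (perms c k))) (m zs)"
    by (simp only: Y.sum_constant_scale)
  also have "(\<Sum>\<sigma>\<in>perms c k. \<Sum>u\<in>words J k. t (\<Prod>i<k. \<zeta> (zs ! i) (u ! \<sigma> i)) (m (map e u)))
      = (\<Sum>u\<in>words J k. t (\<Sum>\<sigma>\<in>perms c k. \<Prod>i<k. \<zeta> (zs ! i) (u ! \<sigma> i)) (m (map e u)))"
    by (subst sum.swap) (simp add: Y.scale_sum_left)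
  finally show ?thesis .
qed

end

section \<open>The pairing of words\<close>

text \<open>Both pairings on the level of words: the permanent of the matrix of values for symmetric
  words, the product of its diagonal for tensor words.\<close>

definition pair :: "bool \<Rightarrow> ('v \<Rightarrow> 'k::field) list \<Rightarrow> 'v list \<Rightarrow> 'k" where
  "pair c fs xs = (if length fs = length xs
     then \<Sum>\<sigma>\<in>perms c (length fs). \<Prod>i<length fs. (fs ! i) (xs ! \<sigma> i) else 0)"

text \<open>Passing to inverse permutations moves the permutation from the vectors to the forms, so
  that linearity can be read off on either side.\<close>

lemma pair_flip:
  "pair c fs xs = (if length fs = length xs
     then \<Sum>\<sigma>\<in>perms c (length xs). \<Prod>i<length xs. (fs ! \<sigma> i) (xs ! i) else 0)"
proof -
  have "(\<Prod>i<n. (fs ! i) (xs ! \<sigma> i)) = (\<Prod>i<n. (fs ! Hilbert_Choice.inv \<sigma> i) (xs ! i))"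
    if "\<sigma> \<in> perms c n" for \<sigma> n
  proof -
    note \<sigma> = perms_permutes[OF that]
    have "(\<Prod>i<n. (fs ! Hilbert_Choice.inv \<sigma> i) (xs ! i))
      = (\<Prod>i<n. (fs ! Hilbert_Choice.inv \<sigma> (\<sigma> i)) (xs ! \<sigma> i))"
      by (rule prod.permute[OF \<sigma>, unfolded comp_def])
    then show ?thesis using permutes_inverses(2)[OF \<sigma>] by simp
  qed
  then show ?thesis
    unfolding pair_def
    by (subst (2) sum_perms_inv) simp
qed

text \<open>The factor at the position of \<open>x\<close> is isolated. In the remaining product
  \<open>undefined\<close> only fills the skipped position, which makes it visible that this product
  does not depend on \<open>x\<close>.\<close>

lemma prod_nth_middle:
  fixes h :: "nat \<Rightarrow> 'a \<Rightarrow> 'k::comm_monoid_mult"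
  assumes "n = Suc (length us + length vs)"
  shows "(\<Prod>i<n. h i ((us @ x # vs) ! i)) =
    h (length us) x * (\<Prod>i\<in>{..<n} - {length us}. h i ((us @ undefined # vs) ! i))"
proof -
  have "(\<Prod>i\<in>{..<n} - {length us}. h i ((us @ x # vs) ! i))
      = (\<Prod>i\<in>{..<n} - {length us}. h i ((us @ undefined # vs) ! i))"
    by (intro prod.cong) (auto simp: nth_append nth_Cons')
  then show ?thesis
    using assms by (subst prod.remove[of _ "length us"]) auto
qed

text \<open>The dependence on one form is a sum of evaluations with coefficients free of that form,
  so additivity and homogeneity in the slot are immediate. For words of different lengths the index
  set is empty.\<close>

lemma pair_slot_left:
  "\<exists>(S :: (nat \<Rightarrow> nat) set) a b. \<forall>f. pair c (us @ f # vs) xs = (\<Sum>\<sigma>\<in>S. f (a \<sigma>) * b \<sigma>)"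
proof (cases "Suc (length us + length vs) = length xs")
  case True
  let ?b = "\<lambda>\<sigma>. \<Prod>i\<in>{..<length xs} - {length us}. ((us @ undefined # vs) ! i) (xs ! \<sigma> i)"
  have "pair c (us @ f # vs) xs = (\<Sum>\<sigma>\<in>perms c (length xs). f (xs ! \<sigma> (length us)) * ?b \<sigma>)" for f
    using True by (simp add: pair_def prod_nth_middle[where h = "\<lambda>i f. f (xs ! _ i)"])
  then show ?thesis
    by (intro exI[of _ "perms c (length xs)"] exI[of _ "\<lambda>\<sigma>. xs ! \<sigma> (length us)"] exI[of _ ?b]) blast
qed (auto simp: pair_def intro!: exI[of _ "{}"])

text \<open>The counterpart of \<open>pair_slot_left\<close> for one vector. The predicate
  \<open>P\<close> records that the forms applied to it are among the given ones, because linearity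
  is known only for those.\<close>

lemma pair_slot_right:
  assumes "\<And>f. f \<in> set fs \<Longrightarrow> P f"
  shows "\<exists>(S :: (nat \<Rightarrow> nat) set) a b. (\<forall>\<sigma>\<in>S. P (a \<sigma>)) \<and>
    (\<forall>x. pair c fs (us @ x # vs) = (\<Sum>\<sigma>\<in>S. a \<sigma> x * b \<sigma>))"
proof (cases "Suc (length us + length vs) = length fs")
  case True
  let ?S = "perms c (length fs)"
  let ?a = "\<lambda>\<sigma>. fs ! \<sigma> (length us)"
  let ?b = "\<lambda>\<sigma>. \<Prod>i\<in>{..<length fs} - {length us}. (fs ! \<sigma> i) ((us @ undefined # vs) ! i)"
  have "pair c fs (us @ x # vs) = (\<Sum>\<sigma>\<in>?S. ?a \<sigma> x * ?b \<sigma>)" for x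
    using True by (simp add: pair_flip prod_nth_middle[where h = "\<lambda>i. fs ! _ i"])
  moreover have "P (?a \<sigma>)" if "\<sigma> \<in> ?S" for \<sigma>
  proof -
    have "\<sigma> (length us) < length fs"
      using permutes_in_image[OF perms_permutes[OF that], of "length us"] True by auto
    then show ?thesis by (simp add: assms)
  qed
  ultimately show ?thesis
    by (intro exI[of _ ?S] exI[of _ ?a] exI[of _ ?b]) blast
qed (auto simp: pair_def intro!: exI[of _ "{}"])

lemma pair_permute_left:
  assumes "\<tau> permutes {..<length fs}"
  shows "pair True (permute_list \<tau> fs) xs = pair True fs xs"
proof -
  have "(\<Prod>i<length fs. (permute_list \<tau> fs ! \<sigma> i) (xs ! i)) = (\<Prod>i<length fs. (fs ! (\<tau> \<circ> \<sigma>) i) (xs ! i))"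
    if "\<sigma> permutes {..<length fs}" for \<sigma>
    using permutes_in_image[OF that] assms by (intro prod.cong) (auto simp: permute_list_nth)
  then have "pair True (permute_list \<tau> fs) xs = (if length fs = length xs
     then \<Sum>\<sigma> | \<sigma> permutes {..<length fs}. (\<lambda>\<sigma>. \<Prod>i<length fs. (fs ! \<sigma> i) (xs ! i)) (\<tau> \<circ> \<sigma>) else 0)"
    by (auto simp: pair_flip perms_def intro!: sum.cong)
  then show ?thesis
    using setum_permutations_compose_left[OF assms, of "\<lambda>\<sigma>. \<Prod>i<length fs. (fs ! \<sigma> i) (xs ! i)"]
    by (auto simp: pair_flip perms_def)
qed

lemma pair_permute_right:
  assumes "\<tau> permutes {..<length xs}"
  shows "pair True fs (permute_list \<tau> xs) = pair True fs xs"
proof -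
  have "(\<Prod>i<length xs. (fs ! i) (permute_list \<tau> xs ! \<sigma> i)) = (\<Prod>i<length xs. (fs ! i) (xs ! (\<tau> \<circ> \<sigma>) i))"
    if "\<sigma> permutes {..<length xs}" for \<sigma>
    using permutes_in_image[OF that] assms by (intro prod.cong) (auto simp: permute_list_nth)
  then have "pair True fs (permute_list \<tau> xs) = (if length fs = length xs
     then \<Sum>\<sigma> | \<sigma> permutes {..<length xs}. (\<lambda>\<sigma>. \<Prod>i<length xs. (fs ! i) (xs ! \<sigma> i)) (\<tau> \<circ> \<sigma>) else 0)"
    by (auto simp: pair_def perms_def intro!: sum.cong)
  then show ?thesis
    using setum_permutations_compose_left[OF assms, of "\<lambda>\<sigma>. \<Prod>i<length xs. (fs ! i) (xs ! \<sigma> i)"]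
    by (auto simp: pair_def perms_def)
qed

lemma permute_list_swap:
  "\<exists>\<tau>. \<tau> permutes {..<length (us @ x # y # vs)} \<and> us @ y # x # vs = permute_list \<tau> (us @ x # y # vs)"
proof -
  let ?\<tau> = "transpose (length us) (Suc (length us))"
  have "?\<tau> permutes {..<length (us @ x # y # vs)}" by (rule permutes_swap_id) auto
  moreover have "us @ y # x # vs = permute_list ?\<tau> (us @ x # y # vs)"
    by (rule nth_equalityI)
       (auto simp: permute_list_nth[OF calculation] nth_append nth_Cons' transpose_def)
  ultimately show ?thesis by blast
qed

lemma symmetric_mod_pair_left: "symmetric_mod W {0} (\<lambda>fs. pair True fs xs)"
  unfolding symmetric_mod_def using permute_list_swap pair_permute_left
  by (metis eq_iff_diff_eq_0 singletonI)

lemma symmetric_mod_pair_right: "symmetric_mod W {0} (\<lambda>xs. pair True fs xs)"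
  unfolding symmetric_mod_def using permute_list_swap pair_permute_right
  by (metis eq_iff_diff_eq_0 singletonI)

section \<open>Algebras of words\<close>

definition word_relations ::
    "bool \<Rightarrow> ('k::field \<Rightarrow> 'x::ab_group_add \<Rightarrow> 'x) \<Rightarrow> 'x set \<Rightarrow> ('x list \<Rightarrow>\<^sub>0 'k) set" where
  "word_relations c s W = linearity_relations s W \<union> (if c then commutation_relations W else {})"

lemma free_monoid_simps [simp]:
  "carrier (free_monoid W) = lists W" "u \<otimes>\<^bsub>free_monoid W\<^esub> v = u @ v" "\<one>\<^bsub>free_monoid W\<^esub> = []"
  by (auto simp: free_monoid_def)

text \<open>The symmetric algebra for \<open>c = True\<close>, the tensor algebra for \<open>c = False\<close>.\<close>

locale word_algebra = vector_space s
  for s :: "'k::field_char_0 \<Rightarrow> 'x::ab_group_add \<Rightarrow> 'x" +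
  fixes W :: "'x set" and c :: bool
  assumes W: "subspace W"
begin

sublocale tensor_square "free_monoid W" "word_relations c s W"
proof (unfold tensor_square_def, rule presentation.intro)
  show "Group.monoid (free_monoid W)"
    by (rule Group.monoidI) auto
  fix r assume "r \<in> word_relations c s W"
  then consider x y where "x \<in> W" "y \<in> W" "r = single [x + y] 1 - single [x] 1 - single [y] 1"
    | a x where "x \<in> W" "r = single [s a x] 1 - single [x] a"
    | x y where "x \<in> W" "y \<in> W" "r = single [x, y] 1 - single [y, x] 1"
    by (auto simp: word_relations_def linearity_relations_def commutation_relations_def split: if_splits)
  then show "keys r \<subseteq> carrier (free_monoid W)"
    by cases (simp_all add: keys_subset_diff subspace_add[OF W] subspace_scale[OF W])
qed

abbreviation word :: "'x list \<Rightarrow> ('k, 'x) word_class" where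
  "word xs \<equiv> cl (single xs 1)"

lemma word_carrier: "xs \<in> lists W \<Longrightarrow> word xs \<in> carrier PA"
  by (rule cl_carrier) simp

lemma word_append: "us \<in> lists W \<Longrightarrow> vs \<in> lists W \<Longrightarrow> word us \<otimes>\<^bsub>PA\<^esub> word vs = word (us @ vs)"
  by (simp add: presented_mult)

lemma word_Nil: "\<one>\<^bsub>PA\<^esub> = word []"
  by (simp add: presented_one)

lemma translate_I:
  assumes "r \<in> word_relations c s W" "us \<in> lists W" "vs \<in> lists W"
  shows "pmul (free_monoid W) (pmul (free_monoid W) (single us 1) r) (single vs 1) \<in> I"
  using assms R_I by (intro I_mul_left I_mul_right) auto

text \<open>Translates of the linearity relations by words lie in the ideal, which is exactly
  multilinearity of the word map modulo \<open>I\<close>.\<close>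

sublocale single: multilinear_mod s pscale W I "\<lambda>us. single us 1"
proof unfold_locales
  show "subspace W" by (rule W)
  show "P.subspace I" by (rule I_subspace)
  fix us vs x y a assume *: "us \<in> lists W" "vs \<in> lists W" "x \<in> W"
  show "single (us @ (x + y) # vs) 1 - (single (us @ x # vs) 1 + single (us @ y # vs) 1) \<in> I" if "y \<in> W"
  proof -
    have "single [x + y] 1 - single [x] 1 - single [y] 1 \<in> word_relations c s W"
      unfolding word_relations_def linearity_relations_def using * that by blast
    from translate_I[OF this *(1,2)] show ?thesis
      by (simp add: pmul_diff_left pmul_diff_right pmul_add_left pmul_add_right diff_diff_eq)
  qed
  show "single (us @ s a x # vs) 1 - pscale a (single (us @ x # vs) 1) \<in> I"
  proof -
    have "single [s a x] 1 - single [x] a \<in> word_relations c s W"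
      unfolding word_relations_def linearity_relations_def using * by blast
    from translate_I[OF this *(1,2)] show ?thesis
      by (simp add: pmul_diff_left pmul_diff_right)
  qed
qed

lemma single_symmetric: "c \<Longrightarrow> symmetric_mod W I (\<lambda>us. single us 1)"
  unfolding symmetric_mod_def
proof (intro ballI)
  fix us vs x y assume c and *: "us \<in> lists W" "vs \<in> lists W" "x \<in> W" "y \<in> W"
  have "single [x, y] 1 - single [y, x] 1 \<in> word_relations c s W"
    unfolding word_relations_def commutation_relations_def using * \<open>c\<close> by auto
  from translate_I[OF this *(1,2)]
  show "single (us @ x # y # vs) 1 - single (us @ y # x # vs) 1 \<in> I"
    by (simp add: pmul_diff_left pmul_diff_right)
qed

lemma word_add:
  assumes "us \<in> lists W" "vs \<in> lists W" "x \<in> W" "y \<in> W"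
  shows "word (us @ (x + y) # vs) = word (us @ x # vs) \<oplus>\<^bsub>PA\<^esub> word (us @ y # vs)"
  using single.add[OF assms] assms by (simp add: presented_add cl_eq_iff)

lemma word_scale:
  assumes "us \<in> lists W" "vs \<in> lists W" "x \<in> W"
  shows "word (us @ s a x # vs) = a \<odot>\<^bsub>PA\<^esub> word (us @ x # vs)"
  unfolding presented_smult cl_eq_iff by (rule single.scale[OF assms])

lemma word_mset:
  assumes c "xs \<in> lists W" "ys \<in> lists W" "mset xs = mset ys"
  shows "word xs = word ys"
  unfolding cl_eq_iff
  using P.symmetric_mod_mset[OF I_subspace single_symmetric[OF assms(1)] assms(2-)] .

text \<open>By bilinearity it suffices to compare \<open>u @ v\<close> with \<open>v @ u\<close>,
  which have the same multiset of letters.\<close>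

lemma PA_commutative:
  assumes c "X \<in> carrier PA" "Y \<in> carrier PA"
  shows "X \<otimes>\<^bsub>PA\<^esub> Y = Y \<otimes>\<^bsub>PA\<^esub> X"
proof -
  obtain p where p: "keys p \<subseteq> lists W" "X = cl p"
    using assms(2) by (auto elim: presented_cases)
  obtain q where q: "keys q \<subseteq> lists W" "Y = cl q"
    using assms(3) by (auto elim: presented_cases)
  let ?m = "pmul (free_monoid W)"
  from p(1) have "?m p q - ?m q p \<in> I"
  proof (induction p rule: poly_mapping_induct)
    case (single u a)
    from q(1) show ?case
    proof (induction q rule: poly_mapping_induct)
      case (single v b)
      have "single (u @ v) 1 - single (v @ u) 1 \<in> I"
        using \<open>u \<in> lists W\<close> \<open>v \<in> lists W\<close>
        by (intro P.symmetric_mod_mset[OF I_subspace single_symmetric[OF assms(1)]]) auto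
      from I_pscale[OF this, of "a * b"] show ?case
        by (simp add: P.scale_right_diff_distrib mult.commute)
    next
      case (add q q')
      have "?m (single u a) (q + q') - ?m (q + q') (single u a)
        = (?m (single u a) q - ?m q (single u a)) + (?m (single u a) q' - ?m q' (single u a))"
        by (simp add: pmul_add_left pmul_add_right)
      with add show ?case by (simp only: I_add)
    qed simp
  next
    case (add p p')
    have "?m (p + p') q - ?m q (p + p') = (?m p q - ?m q p) + (?m p' q - ?m q p')"
      by (simp add: pmul_add_left pmul_add_right)
    with add show ?case by (simp only: I_add)
  qed simp
  with p q show ?thesis
    by (simp add: presented_mult cl_eq_iff)
qed

text \<open>Evaluated on a translate of a relation, the extension of \<open>m\<close> is a
  difference that multilinearity or symmetry makes zero. This is what makes functions of words well
  defined on the quotient.\<close>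

lemma pext_multilinear_I:
  assumes m: "multilinear_mod s t W {0} m" and sym: "c \<Longrightarrow> symmetric_mod W {0} m" and p: "p \<in> I"
  shows "pext t m p = 0"
proof -
  interpret m: multilinear_mod s t W "{0}" m by fact
  show ?thesis
  proof (rule pext_I[OF _ _ p])
    show "vector_space t" by (rule m.Y.vector_space_axioms)
    fix u v r assume uv: "u \<in> carrier (free_monoid W)" "v \<in> carrier (free_monoid W)"
      and "r \<in> word_relations c s W"
    then consider x y where "x \<in> W" "y \<in> W" "r = single [x + y] 1 - single [x] 1 - single [y] 1"
      | a x where "x \<in> W" "r = single [s a x] 1 - single [x] a"
      | x y where c "x \<in> W" "y \<in> W" "r = single [x, y] 1 - single [y, x] 1"
      by (auto simp: word_relations_def linearity_relations_def commutation_relations_def split: if_splits)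
    then show "pext t m (pmul (free_monoid W) (pmul (free_monoid W) (single u 1) r) (single v 1)) = 0"
    proof cases
      case 1
      then show ?thesis
        using m.add[of u v x y] uv by (simp add: pmul_diff_left pmul_diff_right pmul_add_left pmul_add_right
            m.Y.pext_diff m.Y.pext_add diff_diff_eq)
    next
      case 2
      then show ?thesis
        using m.scale[of u v x a] uv by (simp add: pmul_diff_left pmul_diff_right m.Y.pext_diff)
    next
      case 3
      then show ?thesis
        using sym uv by (simp add: pmul_diff_left pmul_diff_right m.Y.pext_diff symmetric_mod_def)
    qed
  qed
qed

text \<open>A pure tensor of two classes expands, modulo the bilinearity ideal, into pure tensors of
  words; arbitrary tensors are thereby reduced to words in both factors.\<close>

lemma T_single_cong:
  assumes "keys p \<subseteq> lists W" "keys q \<subseteq> lists W"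
  shows "single (cl p, cl q) 1 -
    pext pscale (\<lambda>u. pext pscale (\<lambda>v. single (word u, word v) 1) q) p \<in> T.I"
  using assms(1)
proof (induction p rule: poly_mapping_induct)
  case zero
  \<comment> \<open>No relation speaks of zero directly; a tensor with a zero factor vanishes
    because zero is 0 times itself.\<close>
  have "single (0 \<odot>\<^bsub>PA\<^esub> cl 0, cl q) 1 - single (cl 0, cl q) 0 \<in> T.I"
    using assms by (intro T_smult_left cl_carrier) auto
  then show ?case by (simp add: presented_smult)
next
  case (single u a)
  let ?X = "\<lambda>q. pext pscale (\<lambda>v. single (word u, word v) 1) q"
  have "single (a \<odot>\<^bsub>PA\<^esub> word u, cl q) 1 - single (word u, cl q) a \<in> T.I"
    using assms(2) single by (intro T_smult_left cl_carrier) auto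
  then have "single (cl (single u a), cl q) 1 - pscale a (single (word u, cl q) 1) \<in> T.I"
    by (simp add: presented_smult)
  moreover have "pscale a (single (word u, cl q) 1) - pscale a (?X q) \<in> T.I"
  proof (intro P.subspace_cong_scale[OF T.I_subspace])
    from assms(2) show "single (word u, cl q) 1 - ?X q \<in> T.I"
    proof (induction q rule: poly_mapping_induct)
      case zero
      have "single (word u, 0 \<odot>\<^bsub>PA\<^esub> cl 0) 1 - single (word u, cl 0) 0 \<in> T.I"
        using single by (intro T_smult_right cl_carrier) auto
      then show ?case by (simp add: presented_smult)
    next
      case (single v b)
      have "single (word u, b \<odot>\<^bsub>PA\<^esub> word v) 1 - single (word u, word v) b \<in> T.I"
        using \<open>u \<in> lists W\<close> \<open>v \<in> lists W\<close> by (intro T_smult_right cl_carrier) auto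
      then show ?case by (simp add: presented_smult)
    next
      case (add q q')
      have "single (word u, cl q \<oplus>\<^bsub>PA\<^esub> cl q') 1 - (single (word u, cl q) 1 + single (word u, cl q') 1) \<in> T.I"
        using add single by (intro T_add_right cl_carrier) auto
      from T.I_add[OF this T.I_add[OF add.IH]] show ?case
        using add by (simp add: presented_add P.pext_add algebra_simps)
    qed
  qed
  ultimately have "single (cl (single u a), cl q) 1 - pscale a (?X q) \<in> T.I"
    by (rule P.subspace_cong_trans[OF T.I_subspace])
  then show ?case by simp
next
  case (add p p')
  have "single (cl p \<oplus>\<^bsub>PA\<^esub> cl p', cl q) 1 - (single (cl p, cl q) 1 + single (cl p', cl q) 1) \<in> T.I"
    using add assms by (intro T_add_left cl_carrier) auto
  from T.I_add[OF this T.I_add[OF add.IH]] show ?case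
    using add by (simp add: presented_add P.pext_add algebra_simps)
qed

end

subsection \<open>Brackets\<close>

locale word_bracket = word_algebra +
  fixes t :: "'a \<Rightarrow> 'y::ab_group_add \<Rightarrow> 'y" and br :: "(('a, 'b) word_class \<times> ('a, 'b) word_class \<Rightarrow>\<^sub>0 'a) set \<Rightarrow> 'y"
  assumes t: "vector_space t" and br: "linear_on (tensor_product PA PA) t br"
begin

sublocale Y: vector_space t by (rule t)

definition bracket :: "('a, 'b) word_class \<Rightarrow> ('a, 'b) word_class \<Rightarrow> 'y" where
  "bracket X Y = br (pure_tensor PA PA X Y)"

lemma bracket_add_left:
  assumes "X \<in> carrier PA" "X' \<in> carrier PA" "Y \<in> carrier PA"
  shows "bracket (X \<oplus>\<^bsub>PA\<^esub> X') Y = bracket X Y + bracket X' Y"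
proof -
  have "pure_tensor PA PA (X \<oplus>\<^bsub>PA\<^esub> X') Y = pure_tensor PA PA X Y \<oplus>\<^bsub>T.PA\<^esub> pure_tensor PA PA X' Y"
    using assms T_add_left[OF assms] by (simp add: pure_tensor_eq T.presented_add T.cl_eq_iff)
  then show ?thesis
    using br assms by (simp add: bracket_def linear_on_def tensor_product_eq pure_tensor_eq T.cl_carrier)
qed

lemma bracket_add_right:
  assumes "X \<in> carrier PA" "Y \<in> carrier PA" "Y' \<in> carrier PA"
  shows "bracket X (Y \<oplus>\<^bsub>PA\<^esub> Y') = bracket X Y + bracket X Y'"
proof -
  have "pure_tensor PA PA X (Y \<oplus>\<^bsub>PA\<^esub> Y') = pure_tensor PA PA X Y \<oplus>\<^bsub>T.PA\<^esub> pure_tensor PA PA X Y'"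
    using assms T_add_right[OF assms] by (simp add: pure_tensor_eq T.presented_add T.cl_eq_iff)
  then show ?thesis
    using br assms by (simp add: bracket_def linear_on_def tensor_product_eq pure_tensor_eq T.cl_carrier)
qed

lemma bracket_smult_left:
  assumes "X \<in> carrier PA" "Y \<in> carrier PA"
  shows "bracket (a \<odot>\<^bsub>PA\<^esub> X) Y = t a (bracket X Y)"
proof -
  have "pure_tensor PA PA (a \<odot>\<^bsub>PA\<^esub> X) Y = a \<odot>\<^bsub>T.PA\<^esub> pure_tensor PA PA X Y"
    using assms T_smult_left[OF assms] by (simp add: pure_tensor_eq T.presented_smult T.cl_eq_iff)
  then show ?thesis
    using br assms by (simp add: bracket_def linear_on_def tensor_product_eq pure_tensor_eq T.cl_carrier)
qed

lemma bracket_smult_right: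
  assumes "X \<in> carrier PA" "Y \<in> carrier PA"
  shows "bracket X (a \<odot>\<^bsub>PA\<^esub> Y) = t a (bracket X Y)"
proof -
  have "pure_tensor PA PA X (a \<odot>\<^bsub>PA\<^esub> Y) = a \<odot>\<^bsub>T.PA\<^esub> pure_tensor PA PA X Y"
    using assms T_smult_right[OF assms] by (simp add: pure_tensor_eq T.presented_smult T.cl_eq_iff)
  then show ?thesis
    using br assms by (simp add: bracket_def linear_on_def tensor_product_eq pure_tensor_eq T.cl_carrier)
qed

definition wbr :: "'b list \<Rightarrow> 'b list \<Rightarrow> 'y" where
  "wbr us vs = bracket (word us) (word vs)"

lemma wbr_multilinear_left: "vs \<in> lists W \<Longrightarrow> multilinear_mod s t W {0} (\<lambda>us. wbr us vs)"
  by unfold_locales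
     (simp_all add: W Y.subspace_single_0 wbr_def word_add word_scale bracket_add_left bracket_smult_left word_carrier)

lemma wbr_multilinear_right: "us \<in> lists W \<Longrightarrow> multilinear_mod s t W {0} (\<lambda>vs. wbr us vs)"
  by unfold_locales
     (simp_all add: W Y.subspace_single_0 wbr_def word_add word_scale bracket_add_right bracket_smult_right word_carrier)

lemma wbr_mset:
  assumes c "us \<in> lists W" "us' \<in> lists W" "vs \<in> lists W" "vs' \<in> lists W" "mset us = mset us'" "mset vs = mset vs'"
  shows "wbr us vs = wbr us' vs'"
  unfolding wbr_def word_mset[OF assms(1,2,3,6)] word_mset[OF assms(1,4,5,7)] ..

lemma wbr_symmetric_left: "c \<Longrightarrow> vs \<in> lists W \<Longrightarrow> symmetric_mod W {0} (\<lambda>us. wbr us vs)"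
  unfolding symmetric_mod_def singleton_iff right_minus_eq
  by (intro ballI, rule wbr_mset) simp_all

lemma wbr_symmetric_right: "c \<Longrightarrow> us \<in> lists W \<Longrightarrow> symmetric_mod W {0} (\<lambda>vs. wbr us vs)"
  unfolding symmetric_mod_def singleton_iff right_minus_eq
  by (intro ballI, rule wbr_mset) simp_all

end

section \<open>Coproducts dual to brackets\<close>

definition class_pair :: "bool \<Rightarrow> ('k::field, 'v \<Rightarrow> 'k) word_class \<Rightarrow> ('k, 'v) word_class \<Rightarrow> 'k" where
  "class_pair c F X = quotient_lift (\<lambda>fs. quotient_lift (pair c fs) X) F"

lemma pext_swap:
  assumes "vector_space t"
  shows "pext t (\<lambda>u. pext t (\<lambda>v. \<phi> u v) q) p = pext t (\<lambda>v. pext t (\<lambda>u. \<phi> u v) p) q"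
proof -
  interpret t: vector_space t by fact
  show ?thesis
    unfolding pext_def t.scale_sum_right
    by (subst sum.swap) (simp add: mult.commute)
qed

lemma linear_on_pext:
  assumes "presentation M R" and "\<And>p. keys p \<subseteq> carrier M \<Longrightarrow> h (presented_class M R p) = pext (*) \<phi> p"
  shows "linear_on (presented_algebra M R) (*) h"
proof -
  interpret presentation M R by fact
  show ?thesis
    unfolding linear_on_def
    by (auto elim!: presented_cases simp: presented_add presented_smult assms(2) keys_subset_add
        keys_subset_pscale K_pext_add K_pext_pscale)
qed

lemma subspace_zero_mult: "module.subspace ((*) :: 'k::field \<Rightarrow> 'k \<Rightarrow> 'k) {0}"
  by (rule module.subspace_single_0[OF vector_space_mult[folded module_iff_vector_space]])

text \<open>The inverse of the number of permutations in the pairing: 1/k! for symmetric words and 1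
  for tensor words. Multiplied by it, dual basis words behave like dual bases.\<close>

definition weight :: "bool \<Rightarrow> nat \<Rightarrow> 'k::field_char_0" where
  "weight c k = 1 / of_nat (card (perms c k))"

text \<open>Used with \<open>J n\<close>, so that the single parameter \<open>n\<close> bounds both
  the degrees of the letters and the length of the words.\<close>

definition short_words :: "'j set \<Rightarrow> nat \<Rightarrow> 'j list set" where
  "short_words J n = {u. set u \<subseteq> J \<and> length u < n}"

lemma short_words_eq: "short_words J n = (\<Union>k<n. words J k)"
  by (auto simp: short_words_def words_def)

lemma finite_short_words [simp]: "finite J \<Longrightarrow> finite (short_words J n)"
  by (simp add: short_words_eq)

lemma sum_short_words:
  assumes "finite J"
  shows "(\<Sum>u\<in>short_words J n. f u) = (\<Sum>k<n. \<Sum>u\<in>words J k. f u)"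
  unfolding short_words_eq using assms
  by (subst sum.UNION_disjoint) (auto simp: words_def intro: finite_words[unfolded words_def])

lemma sum_short_words_length:
  assumes "finite J" "\<And>u. length u \<noteq> k \<Longrightarrow> f u = 0" "k < n"
  shows "(\<Sum>u\<in>short_words J n. f u) = (\<Sum>u\<in>words J k. f u)"
  using assms finite_short_words[of J n]
  by (intro sum.mono_neutral_right) (auto simp: short_words_def words_def)

text \<open>
  \<open>E j\<close> and \<open>D j\<close>, \<open>j \<in> \<Union>\<^sub>n J n\<close>, are dual bases of \<open>V\<close> and \<open>V\<^sup>*\<close>, and \<open>trunc n\<close> is
  the projection onto the span of \<open>E j\<close>, \<open>j \<in> J n\<close>.
\<close>

locale dual_words = U: word_algebra scale UNIV c + D: word_algebra dual_scale W c
  for scale :: "'k::field_char_0 \<Rightarrow> 'v::ab_group_add \<Rightarrow> 'v" and W :: "('v \<Rightarrow> 'k) set" and c :: bool +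
  fixes J :: "nat \<Rightarrow> 'j set" and E :: "'j \<Rightarrow> 'v" and D :: "'j \<Rightarrow> 'v \<Rightarrow> 'k"
    and trunc :: "nat \<Rightarrow> 'v \<Rightarrow> 'v"
  assumes W_linear: "f \<in> W \<Longrightarrow> Vector_Spaces.linear scale (*) f"
    and J: "finite (J n)" and D: "j \<in> J n \<Longrightarrow> D j \<in> W"
    and dual_expand: "f \<in> W \<Longrightarrow> \<exists>n0. \<forall>n\<ge>n0. f = (\<Sum>j\<in>J n. dual_scale (f (E j)) (D j))"
    and trunc: "trunc n v = (\<Sum>j\<in>J n. scale (D j v) (E j))"
    and D_trunc: "j \<in> J n \<Longrightarrow> D j (trunc n v) = D j v"
begin

section \<open>The pairing between the word algebras of V and of its graded dual\<close>

lemma W_add: "f \<in> W \<Longrightarrow> f (x + y) = f x + f y"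
  using module_hom.add[OF W_linear[unfolded Vector_Spaces.linear_iff_module_hom]] .

lemma W_scale: "f \<in> W \<Longrightarrow> f (scale a x) = a * f x"
  using module_hom.scale[OF W_linear[unfolded Vector_Spaces.linear_iff_module_hom]] .

lemma pair_multilinear_left: "multilinear_mod dual_scale (*) W {0} (\<lambda>fs. pair c fs xs)"
proof (rule multilinear_mod.intro)
  show "vector_space (dual_scale :: 'k \<Rightarrow> ('v \<Rightarrow> 'k) \<Rightarrow> _)" by (rule D.vector_space_axioms)
  show "vector_space ((*) :: 'k \<Rightarrow> 'k \<Rightarrow> 'k)" by (rule vector_space_mult)
  show "multilinear_mod_axioms dual_scale (*) W {0} (\<lambda>fs. pair c fs xs)"
  proof
    show "module.subspace (dual_scale :: 'k \<Rightarrow> ('v \<Rightarrow> 'k) \<Rightarrow> _) W" by (rule D.W)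
    show "module.subspace ((*) :: 'k \<Rightarrow> 'k \<Rightarrow> 'k) {0}" by (rule subspace_zero_mult)
    fix us vs :: "('v \<Rightarrow> 'k) list" and f g :: "'v \<Rightarrow> 'k" and a
    obtain S :: "(nat \<Rightarrow> nat) set" and A B
      where *: "pair c (us @ f # vs) xs = (\<Sum>\<sigma>\<in>S. f (A \<sigma>) * B \<sigma>)" for f
      using pair_slot_left by blast
    show "pair c (us @ (f + g) # vs) xs - (pair c (us @ f # vs) xs + pair c (us @ g # vs) xs) \<in> {0}"
      unfolding * by (simp add: distrib_right sum.distrib)
    show "pair c (us @ dual_scale a f # vs) xs - a * pair c (us @ f # vs) xs \<in> {0}"
      unfolding * by (simp add: dual_scale_def sum_distrib_left mult.assoc)
  qed
qed

lemma pair_multilinear_right: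
  assumes "fs \<in> lists W"
  shows "multilinear_mod scale (*) UNIV {0} (pair c fs)"
proof (rule multilinear_mod.intro)
  show "vector_space scale" by (rule U.vector_space_axioms)
  show "vector_space ((*) :: 'k \<Rightarrow> 'k \<Rightarrow> 'k)" by (rule vector_space_mult)
  show "multilinear_mod_axioms scale (*) UNIV {0} (pair c fs)"
  proof
    show "module.subspace scale UNIV" by (rule U.W)
    show "module.subspace ((*) :: 'k \<Rightarrow> 'k \<Rightarrow> 'k) {0}" by (rule subspace_zero_mult)
    fix us vs :: "'v list" and x y :: 'v and a
    obtain S :: "(nat \<Rightarrow> nat) set" and A B
      where AW: "\<forall>\<sigma>\<in>S. A \<sigma> \<in> W" and *: "pair c fs (us @ x # vs) = (\<Sum>\<sigma>\<in>S. A \<sigma> x * B \<sigma>)" for x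
      using pair_slot_right[of fs "\<lambda>f. f \<in> W" c us vs] assms by blast
    have add: "A \<sigma> (x + y) = A \<sigma> x + A \<sigma> y" and scale: "A \<sigma> (scale a x) = a * A \<sigma> x"
      if "\<sigma> \<in> S" for \<sigma>
      using that AW W_add W_scale by auto
    show "pair c fs (us @ (x + y) # vs) - (pair c fs (us @ x # vs) + pair c fs (us @ y # vs)) \<in> {0}"
      unfolding * by (simp add: add distrib_right sum.distrib)
    show "pair c fs (us @ scale a x # vs) - a * pair c fs (us @ x # vs) \<in> {0}"
      unfolding * by (simp add: scale sum_distrib_left mult.assoc)
  qed
qed

lemma pair_symmetric_left: "c \<Longrightarrow> symmetric_mod W {0} (\<lambda>fs. pair c fs xs)"
  using symmetric_mod_pair_left[of W xs] by simp

lemma pair_symmetric_right: "c \<Longrightarrow> symmetric_mod UNIV {0} (pair c fs)"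
  using symmetric_mod_pair_right[of UNIV fs] by simp

text \<open>Two quotients are lifted in turn. The inner lift is well defined only for words
  \<open>fs\<close> of linear forms, which are the ones that occur; for the outer one the two sums
  are exchanged, and multilinearity in \<open>fs\<close> is used for each fixed word of
  vectors.\<close>

lemma class_pair_cl:
  assumes p: "keys p \<subseteq> lists W"
  shows "class_pair c (D.cl p) (U.cl q) = pext (*) (\<lambda>fs. pext (*) (pair c fs) q) p"
proof -
  have inner: "quotient_lift (pair c fs) (U.cl q) = pext (*) (pair c fs) q" if "fs \<in> lists W" for fs
    using that
    by (intro U.quotient_lift_cl U.pext_multilinear_I[OF pair_multilinear_right pair_symmetric_right])
  have outer: "pext (*) (\<lambda>fs. quotient_lift (pair c fs) (U.cl q)) p
      = pext (*) (\<lambda>fs. pext (*) (pair c fs) q) p" if "keys p \<subseteq> lists W" for p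
    using that by (intro K_pext_cong inner) auto
  have "class_pair c (D.cl p) (U.cl q) = pext (*) (\<lambda>fs. quotient_lift (pair c fs) (U.cl q)) p"
    unfolding class_pair_def
  proof (rule D.quotient_lift_cl)
    fix r assume r: "r \<in> D.I"
    then have "pext (*) (\<lambda>fs. quotient_lift (pair c fs) (U.cl q)) r
        = pext (*) (\<lambda>fs. pext (*) (pair c fs) q) r"
      using D.I_keys by (intro outer) simp
    also have "\<dots> = pext (*) (\<lambda>xs. pext (*) (\<lambda>fs. pair c fs xs) r) q"
      by (rule pext_swap[OF vector_space_mult])
    also have "\<dots> = pext (*) (\<lambda>xs. 0) q"
      using D.pext_multilinear_I[OF pair_multilinear_left pair_symmetric_left r]
      by (intro K_pext_cong) simp
    finally show "pext (*) (\<lambda>fs. quotient_lift (pair c fs) (U.cl q)) r = 0"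
      by (simp add: pext_def)
  qed
  with outer[OF p] show ?thesis by simp
qed

lemma class_pair_words [simp]:
  "fs \<in> lists W \<Longrightarrow> class_pair c (D.word fs) (U.word xs) = pair c fs xs"
  by (simp add: class_pair_cl)

lemma class_pair_linear_left:
  assumes "X \<in> carrier U.PA"
  shows "linear_on D.PA (*) (\<lambda>F. class_pair c F X)"
proof -
  obtain q where "X = U.cl q" using assms by (rule U.presented_cases)
  then show ?thesis
    by (intro linear_on_pext[OF D.presentation_axioms]) (simp add: class_pair_cl)
qed

lemma class_pair_linear_right:
  assumes "F \<in> carrier D.PA"
  shows "linear_on U.PA (*) (\<lambda>X. class_pair c F X)"
proof -
  obtain p where p: "keys p \<subseteq> lists W" "F = D.cl p" using assms by (auto elim: D.presented_cases)
  have "class_pair c F (U.cl q) = pext (*) (\<lambda>xs. pext (*) (\<lambda>fs. pair c fs xs) p) q" for q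
    unfolding p(2) class_pair_cl[OF p(1)] by (rule pext_swap[OF vector_space_mult])
  then show ?thesis
    by (rule linear_on_pext[OF U.presentation_axioms])
qed

text \<open>Pairing of a representative of a tensor with the two words \<open>xs\<close> and
  \<open>ys\<close>. These functionals separate the elements of the tensor square, see
  \<open>nondegenerate\<close>.\<close>

definition word_functional :: "'v list \<Rightarrow> 'v list \<Rightarrow> (('k, 'v \<Rightarrow> 'k) word_class \<times> ('k, 'v \<Rightarrow> 'k) word_class \<Rightarrow>\<^sub>0 'k) \<Rightarrow> 'k" where
  "word_functional xs ys = pext (*) (\<lambda>(F, G). class_pair c F (U.word xs) * class_pair c G (U.word ys))"

lemma word_functional_I: "p \<in> D.T.I \<Longrightarrow> word_functional xs ys p = 0"
  unfolding word_functional_def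
  using class_pair_linear_left[OF U.word_carrier[of xs]] class_pair_linear_left[OF U.word_carrier[of ys]]
  by (intro D.pext_bilinear_I) (auto simp: vector_space_mult linear_on_def algebra_simps)

lemma word_functional_single:
  "fs \<in> lists W \<Longrightarrow> gs \<in> lists W \<Longrightarrow>
    word_functional xs ys (single (D.word fs, D.word gs) a) = a * (pair c fs xs * pair c gs ys)"
  by (simp add: word_functional_def)

section \<open>Recovering tensors from their pairings\<close>

lemma card_perms_nz [simp]: "of_nat (card (perms c k)) \<noteq> (0 :: 'k)"
  by (cases c) simp_all

lemma perms_nonempty [simp]: "perms c k \<noteq> {}"
  using card_perms_nz[of k] by (metis card.empty of_nat_0)

text \<open>The expansion of \<open>fs\<close> in words of dual basis forms: its coefficients are
  the pairings with the corresponding words of basis vectors, corrected by the weight.\<close>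

definition coord_word :: "nat \<Rightarrow> ('v \<Rightarrow> 'k) list \<Rightarrow> ('v \<Rightarrow> 'k) list \<Rightarrow>\<^sub>0 'k" where
  "coord_word n fs = (\<Sum>u\<in>short_words (J n) n.
     single (map D u) (weight c (length u) * pair c fs (map E u)))"

lemma map_D_W: "u \<in> short_words (J n) k \<Longrightarrow> map D u \<in> lists W"
  by (auto simp: short_words_def intro!: D)

text \<open>Each of the finitely many letters is a finite combination of basis forms from some
  degree bound on. Expanding all of them symmetrically yields the word as often as there are
  permutations, and the weight divides by that number.\<close>

lemma word_reconstruction:
  assumes "fs \<in> lists W"
  shows "\<exists>n0. \<forall>n\<ge>n0. single fs 1 - coord_word n fs \<in> D.I"
proof -
  have "\<exists>n0. \<forall>n\<ge>n0. \<forall>f\<in>set fs. f = (\<Sum>j\<in>J n. dual_scale (f (E j)) (D j))"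
    using assms
  proof (induction fs)
    case (Cons f fs)
    obtain n1 where n1: "\<forall>n\<ge>n1. \<forall>f\<in>set fs. f = (\<Sum>j\<in>J n. dual_scale (f (E j)) (D j))"
      using Cons by auto
    obtain n2 where n2: "\<forall>n\<ge>n2. f = (\<Sum>j\<in>J n. dual_scale (f (E j)) (D j))"
      using dual_expand[of f] Cons by auto
    have "\<forall>n\<ge>max n1 n2. \<forall>g\<in>set (f # fs). g = (\<Sum>j\<in>J n. dual_scale (g (E j)) (D j))"
      unfolding list.set ball_simps(7)
      using n1 n2 by (meson max.boundedE)
    then show ?case by blast
  qed auto
  then obtain n0 where n0: "\<And>n f. n \<ge> n0 \<Longrightarrow> f \<in> set fs \<Longrightarrow> f = (\<Sum>j\<in>J n. dual_scale (f (E j)) (D j))"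
    by blast
  \<comment> \<open>\<open>n0\<close> makes every letter of \<open>fs\<close> expand over
    \<open>J n\<close>; \<open>Suc (length fs)\<close> puts the words of the length of
    \<open>fs\<close>, the only ones pairing with it, among the short words.\<close>
  have "single fs 1 - coord_word n fs \<in> D.I" if n: "n \<ge> max n0 (Suc (length fs))" for n
  proof -
    define k where "k = length fs"
    have "(\<Sum>u\<in>words (J n) k. pscale (\<Sum>\<sigma>\<in>perms c k. \<Prod>i<k. (fs ! i) (E (u ! \<sigma> i))) (single (map D u) 1))
        - pscale (of_nat (card (perms c k))) (single fs 1) \<in> D.I"
    proof (rule D.single.symmetrized_expand[OF J _ assms _ D.single_symmetric, where \<zeta> = "\<lambda>f j. f (E j)"])
      show "f = (\<Sum>j\<in>J n. dual_scale (f (E j)) (D j))" if "f \<in> set fs" for f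
        using n0[OF _ that] n by simp
    qed (auto simp: D k_def)
    moreover have "(\<Sum>\<sigma>\<in>perms c k. \<Prod>i<k. (fs ! i) (E (u ! \<sigma> i))) = pair c fs (map E u)"
      if "u \<in> words (J n) k" for u
    proof -
      have "\<sigma> i < length u" if "\<sigma> \<in> perms c k" "i < k" for \<sigma> i
        using permutes_in_image[OF perms_permutes[OF that(1)], of i] that \<open>u \<in> words (J n) k\<close>
        by (auto simp: words_def)
      then show ?thesis
        using that by (auto simp: pair_def words_def k_def intro!: sum.cong prod.cong)
    qed
    ultimately have "(\<Sum>u\<in>words (J n) k. single (map D u) (pair c fs (map E u)))
        - single fs (of_nat (card (perms c k))) \<in> D.I"
      by simp
    from D.I_pscale[OF this, of "weight c k"]
    have "(\<Sum>u\<in>words (J n) k. single (map D u) (weight c k * pair c fs (map E u))) - single fs 1 \<in> D.I"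
      by (simp add: P.scale_right_diff_distrib P.scale_sum_right weight_def del: card_perms)
    also have "(\<Sum>u\<in>words (J n) k. single (map D u) (weight c k * pair c fs (map E u))) = coord_word n fs"
      unfolding coord_word_def
      using n J by (subst sum_short_words_length[of _ k])
        (auto simp: pair_def k_def words_def intro!: sum.cong)
    finally show ?thesis by (rule P.subspace_cong_sym[OF D.I_subspace])
  qed
  then show ?thesis by blast
qed

definition coord :: "nat \<Rightarrow> (('k, 'v \<Rightarrow> 'k) word_class \<times> ('k, 'v \<Rightarrow> 'k) word_class \<Rightarrow>\<^sub>0 'k) \<Rightarrow>
    (('k, 'v \<Rightarrow> 'k) word_class \<times> ('k, 'v \<Rightarrow> 'k) word_class \<Rightarrow>\<^sub>0 'k)" where
  "coord n p = (\<Sum>u\<in>short_words (J n) n. \<Sum>v\<in>short_words (J n) n.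
     single (D.word (map D u), D.word (map D v))
       (weight c (length u) * weight c (length v) * word_functional (map E u) (map E v) p))"

lemma coord_add: "coord n (p + q) = coord n p + coord n q"
  by (simp add: coord_def word_functional_def K_pext_add distrib_left single_add sum.distrib)

lemma coord_pscale: "coord n (pscale a p) = pscale a (coord n p)"
  by (simp add: coord_def word_functional_def K_pext_pscale P.scale_sum_right mult_ac)

lemma coord_I: "p \<in> D.T.I \<Longrightarrow> coord n p = 0"
  by (simp add: coord_def word_functional_I)

text \<open>The threshold depends on the tensor, so the property is asked for all large
  \<open>n\<close>; this keeps it stable under sums, where two thresholds are merged.\<close>

definition reconstructible where
  "reconstructible p \<longleftrightarrow> (\<exists>n0. \<forall>n\<ge>n0. p - coord n p \<in> D.T.I)"

lemma reconstructible_add: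
  assumes "reconstructible p" "reconstructible q"
  shows "reconstructible (p + q)"
proof -
  obtain n1 n2 where "\<forall>n\<ge>n1. p - coord n p \<in> D.T.I" "\<forall>n\<ge>n2. q - coord n q \<in> D.T.I"
    using assms by (auto simp: reconstructible_def)
  then have "\<forall>n\<ge>max n1 n2. (p - coord n p) + (q - coord n q) \<in> D.T.I"
    by (intro allI impI D.T.I_add) auto
  then show ?thesis
    unfolding reconstructible_def coord_add add_diff_add by blast
qed

lemma reconstructible_pscale: "reconstructible p \<Longrightarrow> reconstructible (pscale a p)"
  unfolding reconstructible_def coord_pscale
  by (auto simp flip: P.scale_right_diff_distrib intro: D.T.I_pscale)

lemma reconstructible_cong:
  assumes "reconstructible q" "p - q \<in> D.T.I"
  shows "reconstructible p"
proof -
  have "reconstructible (p - q)"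
    using assms(2) by (simp add: reconstructible_def coord_I)
  from reconstructible_add[OF this assms(1)] show ?thesis by simp
qed

lemma reconstructible_zero: "reconstructible 0"
  by (simp add: reconstructible_def coord_I)

text \<open>Each factor is replaced by its expansion \<open>coord_word\<close>, and bilinearity of
  the tensor turns the two single sums into the double sum of \<open>coord\<close>.\<close>

lemma reconstructible_words:
  assumes "fs \<in> lists W" "gs \<in> lists W"
  shows "reconstructible (single (D.word fs, D.word gs) 1)"
proof -
  obtain n1 n2 where n1: "\<And>n. n \<ge> n1 \<Longrightarrow> single fs 1 - coord_word n fs \<in> D.I"
    and n2: "\<And>n. n \<ge> n2 \<Longrightarrow> single gs 1 - coord_word n gs \<in> D.I"
    using word_reconstruction assms by meson
  have "single (D.word fs, D.word gs) 1 - coord n (single (D.word fs, D.word gs) 1) \<in> D.T.I"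
    if "n \<ge> max n1 n2" for n
  proof -
    have *: "D.word fs = D.cl (coord_word n fs)" "D.word gs = D.cl (coord_word n gs)"
      using n1 n2 that by (auto simp: D.cl_eq_iff)
    have k: "keys (coord_word n hs) \<subseteq> lists W" for hs
      unfolding coord_word_def using map_D_W by (intro keys_subset_sum keys_subset_single)
    have "single (D.cl (coord_word n fs), D.cl (coord_word n gs)) 1 -
        pext pscale (\<lambda>u. pext pscale (\<lambda>v. single (D.word u, D.word v) 1) (coord_word n gs)) (coord_word n fs)
      \<in> D.T.I"
      by (rule D.T_single_cong[OF k k])
    also have "pext pscale (\<lambda>u. pext pscale (\<lambda>v. single (D.word u, D.word v) 1) (coord_word n gs)) (coord_word n fs)
      = coord n (single (D.word fs, D.word gs) 1)"
      by (simp add: coord_word_def coord_def P.pext_sum P.scale_sum_right word_functional_single assms mult_ac)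
    finally show ?thesis using * by simp
  qed
  then show ?thesis unfolding reconstructible_def by blast
qed

lemma reconstructible_carrier:
  assumes "keys p \<subseteq> carrier (D.PA \<times>\<times> D.PA)"
  shows "reconstructible p"
  using assms
proof (induction p rule: poly_mapping_induct)
  case (single m a)
  then obtain p q where pq: "keys p \<subseteq> lists W" "keys q \<subseteq> lists W" "m = (D.cl p, D.cl q)"
    by (auto simp: D.T_carrier elim!: D.presented_cases)
  let ?p = "pext pscale (\<lambda>u. pext pscale (\<lambda>v. single (D.word u, D.word v) 1) q) p"
  have "reconstructible (pext pscale (\<lambda>v. single (D.word u, D.word v) 1) q)" if "u \<in> lists W" for u
    using pq(2)
  proof (induction q rule: poly_mapping_induct)
    case (single v b)
    have "reconstructible (pscale b (single (D.word u, D.word v) 1))"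
      using single that by (intro reconstructible_pscale reconstructible_words)
    then show ?case by simp
  qed (simp_all add: reconstructible_zero reconstructible_add P.pext_add)
  with pq(1) have "reconstructible ?p"
    by (induction p rule: poly_mapping_induct)
       (simp_all add: reconstructible_zero reconstructible_add P.pext_add reconstructible_pscale)
  then have "reconstructible (single m 1)"
    using D.T_single_cong[OF pq(1,2)] unfolding pq(3) by (rule reconstructible_cong)
  from reconstructible_pscale[OF this, of a] show ?case by simp
qed (simp_all add: reconstructible_zero reconstructible_add)

text \<open>The approximation \<open>coord n p\<close> has only pairings of \<open>p\<close> as
  coefficients, so it is zero, while \<open>p\<close> is congruent to it for large
  \<open>n\<close>.\<close>

lemma nondegenerate:
  assumes "keys p \<subseteq> carrier (D.PA \<times>\<times> D.PA)" "\<And>xs ys. word_functional xs ys p = 0"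
  shows "p \<in> D.T.I"
proof -
  obtain n where "p - coord n p \<in> D.T.I"
    using reconstructible_carrier[OF assms(1)] by (auto simp: reconstructible_def)
  then show ?thesis by (simp add: coord_def assms(2))
qed

end

lemma multilinear_mod_compose:
  assumes "multilinear_mod s t W {0} m" "vector_space t'"
    and add: "\<And>x y. f (x + y) = f x + f y" and scale: "\<And>a x. f (t a x) = t' a (f x)"
  shows "multilinear_mod s t' W {0} (\<lambda>us. f (m us))"
proof -
  interpret m: multilinear_mod s t W "{0}" m by fact
  interpret t': vector_space t' by fact
  show ?thesis
  proof unfold_locales
    show "m.X.subspace W" by (rule m.W)
    show "t'.subspace {0}" by (rule t'.subspace_single_0)
    fix us vs x y a assume *: "us \<in> lists W" "vs \<in> lists W" "x \<in> W"
    show "f (m (us @ (x + y) # vs)) - (f (m (us @ x # vs)) + f (m (us @ y # vs))) \<in> {0}" if "y \<in> W"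
      using m.add[OF * that] by (simp add: add)
    show "f (m (us @ s a x # vs)) - t' a (f (m (us @ x # vs))) \<in> {0}"
      using m.scale[OF *, of a] by (simp add: scale)
  qed
qed

lemma symmetric_mod_compose: "symmetric_mod W {0} m \<Longrightarrow> symmetric_mod W {0} (\<lambda>us. f (m us))"
  by (auto simp: symmetric_mod_def)

text \<open>The assumption \<open>bounded\<close> is the finiteness that a form extracts from the
  bracket: it sees only truncated letters, which range over a finite-dimensional space, and short
  words. It makes the dual of the bracket a finite sum.\<close>

locale dual_bracket = dual_words scale W c J E D trunc + B: word_bracket scale UNIV c scale br
  for scale :: "'k::field_char_0 \<Rightarrow> 'v::ab_group_add \<Rightarrow> 'v" and W :: "('v \<Rightarrow> 'k) set" and c :: bool
    and J :: "nat \<Rightarrow> 'j set" and E :: "'j \<Rightarrow> 'v" and D :: "'j \<Rightarrow> 'v \<Rightarrow> 'k"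
    and trunc :: "nat \<Rightarrow> 'v \<Rightarrow> 'v" and br :: "('k, 'v) bracket" +
  assumes bounded: "f \<in> W \<Longrightarrow> \<exists>n0. \<forall>n\<ge>n0. \<forall>us vs.
    f (B.wbr us vs) = f (B.wbr (map (trunc n) us) (map (trunc n) vs)) \<and>
    (length us \<ge> n \<or> length vs \<ge> n \<longrightarrow> f (B.wbr us vs) = 0)"
begin

definition bounded_by :: "('v \<Rightarrow> 'k) \<Rightarrow> nat \<Rightarrow> bool" where
  "bounded_by f n \<longleftrightarrow> (\<forall>us vs.
    f (B.wbr us vs) = f (B.wbr (map (trunc n) us) (map (trunc n) vs)) \<and>
    (length us \<ge> n \<or> length vs \<ge> n \<longrightarrow> f (B.wbr us vs) = 0))"

lemma trunc_idem: "trunc n (trunc n v) = trunc n v"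
  by (simp add: trunc[of n "trunc n v"] D_trunc) (simp add: trunc)

lemma wbr_multilinear:
  assumes "f \<in> W"
  shows "multilinear_mod scale (*) UNIV {0} (\<lambda>us. f (B.wbr us vs))"
    and "multilinear_mod scale (*) UNIV {0} (\<lambda>vs. f (B.wbr us vs))"
    and "c \<Longrightarrow> symmetric_mod UNIV {0} (\<lambda>us. f (B.wbr us vs))"
    and "c \<Longrightarrow> symmetric_mod UNIV {0} (\<lambda>vs. f (B.wbr us vs))"
proof -
  show "multilinear_mod scale (*) UNIV {0} (\<lambda>us. f (B.wbr us vs))"
    by (rule multilinear_mod_compose[OF B.wbr_multilinear_left vector_space_mult])
       (simp_all add: W_add W_scale assms)
  show "multilinear_mod scale (*) UNIV {0} (\<lambda>vs. f (B.wbr us vs))"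
    by (rule multilinear_mod_compose[OF B.wbr_multilinear_right vector_space_mult])
       (simp_all add: W_add W_scale assms)
  show "symmetric_mod UNIV {0} (\<lambda>us. f (B.wbr us vs))" if c
    by (rule symmetric_mod_compose, rule B.wbr_symmetric_left[OF that]) simp
  show "symmetric_mod UNIV {0} (\<lambda>vs. f (B.wbr us vs))" if c
    by (rule symmetric_mod_compose, rule B.wbr_symmetric_right[OF that]) simp
qed

text \<open>A reproducing formula: after truncation the letters of \<open>xs\<close> expand in the
  basis with coefficients \<open>D j\<close>, and these coefficients assemble into the pairing of
  \<open>map D u\<close> with \<open>xs\<close>. For long words both sides are zero, no short word
  having the same length.\<close>

lemma reproduce:
  assumes m: "multilinear_mod scale (*) UNIV {0} m" and sym: "c \<Longrightarrow> symmetric_mod UNIV {0} m"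
    and m_trunc: "\<And>xs. m (map (trunc n) xs) = m xs" and long: "\<And>xs. length xs \<ge> n \<Longrightarrow> m xs = 0"
  shows "(\<Sum>u\<in>short_words (J n) n. weight c (length u) * pair c (map D u) xs * m (map E u)) = m xs"
proof (cases "length xs < n")
  case True
  define k where "k = length xs"
  have "(\<Sum>u\<in>words (J n) k. (\<Sum>\<sigma>\<in>perms c k. \<Prod>i<k. D (u ! \<sigma> i) (map (trunc n) xs ! i)) * m (map E u))
      - of_nat (card (perms c k)) * m (map (trunc n) xs) \<in> {0}"
    by (rule multilinear_mod.symmetrized_expand[OF m J _ _ _ sym, where \<zeta> = "\<lambda>z j. D j z"])
       (auto simp: k_def trunc[symmetric] trunc_idem)
  moreover have "(\<Sum>\<sigma>\<in>perms c k. \<Prod>i<k. D (u ! \<sigma> i) (map (trunc n) xs ! i)) = pair c (map D u) xs"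
    if "u \<in> words (J n) k" for u
  proof -
    have "\<sigma> i < length u \<and> u ! \<sigma> i \<in> J n" if "\<sigma> \<in> perms c k" "i < k" for \<sigma> i
      using permutes_in_image[OF perms_permutes[OF that(1)], of i] that \<open>u \<in> words (J n) k\<close>
      by (auto simp: words_def subset_iff)
    then show ?thesis
      using that by (auto simp: pair_flip words_def k_def D_trunc intro!: sum.cong prod.cong)
  qed
  ultimately have "(\<Sum>u\<in>words (J n) k. pair c (map D u) xs * m (map E u))
      = of_nat (card (perms c k)) * m xs"
    by (simp add: m_trunc del: card_perms)
  then have "weight c k * (\<Sum>u\<in>words (J n) k. pair c (map D u) xs * m (map E u)) = m xs"
    by (simp add: weight_def del: card_perms)
  also have "weight c k * (\<Sum>u\<in>words (J n) k. pair c (map D u) xs * m (map E u))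
      = (\<Sum>u\<in>words (J n) k. weight c (length u) * pair c (map D u) xs * m (map E u))"
    unfolding sum_distrib_left by (intro sum.cong) (auto simp: words_def)
  also have "\<dots> = (\<Sum>u\<in>short_words (J n) n. weight c (length u) * pair c (map D u) xs * m (map E u))"
    using True J by (intro sum_short_words_length[symmetric]) (auto simp: pair_def k_def)
  finally show ?thesis .
next
  case False
  then have "pair c (map D u) xs = 0" if "u \<in> short_words (J n) n" for u
    using that by (auto simp: pair_def short_words_def)
  with False long show ?thesis by simp
qed

definition dual_coproduct where
  "dual_coproduct n f = (\<Sum>u\<in>short_words (J n) n. \<Sum>v\<in>short_words (J n) n.
     single (D.word (map D u), D.word (map D v))
       (weight c (length u) * weight c (length v) * f (B.wbr (map E u) (map E v))))"

lemma keys_dual_coproduct: "keys (dual_coproduct n f) \<subseteq> carrier (D.PA \<times>\<times> D.PA)"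
  unfolding dual_coproduct_def D.T_carrier
  by (intro keys_subset_sum keys_subset_single) (simp add: D.word_carrier map_D_W)

text \<open>The reproducing formula is applied to the right word with the left one fixed, and then
  to the left word.\<close>

lemma word_functional_dual_coproduct:
  assumes f: "f \<in> W" and n: "bounded_by f n"
  shows "word_functional xs ys (dual_coproduct n f) = f (B.wbr xs ys)"
proof -
  have tr0: "f (B.wbr us vs) = f (B.wbr (map (trunc n) us) (map (trunc n) vs))" for us vs
    using n unfolding bounded_by_def by blast
  \<comment> \<open>\<open>bounded_by\<close> truncates both words simultaneously; idempotence of
    \<open>trunc\<close> gives truncation in one word alone, as \<open>reproduce\<close>
    requires.\<close>
  have tr: "f (B.wbr us (map (trunc n) vs)) = f (B.wbr us vs)"
    "f (B.wbr (map (trunc n) us) vs) = f (B.wbr us vs)" for us vs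
    using tr0[of us "map (trunc n) vs"] tr0[of "map (trunc n) us" vs] tr0[of us vs]
    by (simp_all add: comp_def trunc_idem)
  have "word_functional xs ys (dual_coproduct n f) =
    (\<Sum>u\<in>short_words (J n) n. weight c (length u) * pair c (map D u) xs *
      (\<Sum>v\<in>short_words (J n) n. weight c (length v) * pair c (map D v) ys * f (B.wbr (map E u) (map E v))))"
    unfolding dual_coproduct_def sum_distrib_left
    by (simp add: word_functional_def K_pext_sum class_pair_words map_D_W mult_ac)
  also have "\<dots> = (\<Sum>u\<in>short_words (J n) n. weight c (length u) * pair c (map D u) xs * f (B.wbr (map E u) ys))"
    using n by (intro sum.cong refl arg_cong2[where f = "(*)"] reproduce wbr_multilinear f tr)
      (auto simp: bounded_by_def)
  also have "\<dots> = f (B.wbr xs ys)"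
    using n by (intro reproduce wbr_multilinear f tr) (auto simp: bounded_by_def)
  finally show ?thesis .
qed

section \<open>Existence and uniqueness of the coproduct dual to a bracket\<close>

definition dual_condition where
  "dual_condition \<Delta> \<longleftrightarrow> \<Delta> \<in> alg_hom D.PA (tensor_product D.PA D.PA) \<and> \<Delta> \<in> extensional (carrier D.PA) \<and>
    (\<forall>f\<in>W. \<forall>X\<in>carrier U.PA. \<forall>Y\<in>carrier U.PA.
      tensor_functional (\<lambda>F. class_pair c F X) (\<lambda>F. class_pair c F Y) (\<Delta> (D.word [f])) = f (B.bracket X Y))"

lemma tensor_functional_cl:
  assumes "X \<in> carrier U.PA" "Y \<in> carrier U.PA"
  shows "tensor_functional (\<lambda>F. class_pair c F X) (\<lambda>F. class_pair c F Y) (D.T.cl p)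
    = pext (*) (\<lambda>(F, G). class_pair c F X * class_pair c G Y) p"
  using assms by (intro D.tensor_functional_cl class_pair_linear_left)

lemma word_functional_eq:
  "tensor_functional (\<lambda>F. class_pair c F (U.word xs)) (\<lambda>F. class_pair c F (U.word ys)) (D.T.cl p)
    = word_functional xs ys p"
  by (simp add: tensor_functional_cl U.word_carrier word_functional_def)

lemma dual_condition_unique:
  assumes "dual_condition \<Delta>" "dual_condition \<Delta>'"
  shows "\<Delta> = \<Delta>'"
proof (rule extensionalityI)
  show "\<Delta> \<in> extensional (carrier D.PA)" "\<Delta>' \<in> extensional (carrier D.PA)"
    using assms by (auto simp: dual_condition_def)
  have hom: "\<Delta> \<in> alg_hom D.PA D.T.PA" "\<Delta>' \<in> alg_hom D.PA D.T.PA"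
    using assms by (auto simp: dual_condition_def D.tensor_product_eq)
  have gen: "\<Delta> (D.word [f]) = \<Delta>' (D.word [f])" if f: "f \<in> W" for f
  proof -
    have "D.word [f] \<in> carrier D.PA" using f by (intro D.word_carrier) simp
    then have "\<Delta> (D.word [f]) \<in> carrier D.T.PA" "\<Delta>' (D.word [f]) \<in> carrier D.T.PA"
      using hom by (auto simp: alg_hom_def ring_hom_def)
    then obtain p q where p: "keys p \<subseteq> carrier (D.PA \<times>\<times> D.PA)" "\<Delta> (D.word [f]) = D.T.cl p"
      and q: "keys q \<subseteq> carrier (D.PA \<times>\<times> D.PA)" "\<Delta>' (D.word [f]) = D.T.cl q"
      by (elim D.T.presented_cases) blast
    have "word_functional xs ys p = word_functional xs ys q" for xs ys
      using assms f U.word_carrier[of xs] U.word_carrier[of ys]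
      unfolding dual_condition_def word_functional_eq[symmetric] p(2)[symmetric] q(2)[symmetric] by simp
    then have "word_functional xs ys (p - q) = 0" for xs ys
      by (simp add: word_functional_def K_pext_diff)
    then have "p - q \<in> D.T.I" by (intro nondegenerate keys_subset_diff p q)
    then show ?thesis by (simp add: p q D.T.cl_eq_iff)
  qed
  have words: "\<Delta> (D.word fs) = \<Delta>' (D.word fs)" if "fs \<in> lists W" for fs
    using that
  proof (induction fs)
    case Nil
    then show ?case using hom by (simp add: D.word_Nil[symmetric] alg_hom_def ring_hom_def)
  next
    case (Cons f fs)
    then have "D.word [f] \<otimes>\<^bsub>D.PA\<^esub> D.word fs = D.word (f # fs)"
      by (subst D.word_append) auto
    with Cons show ?case
      using hom gen D.word_carrier[of "[f]"] D.word_carrier[of fs]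
      by (auto simp: alg_hom_def ring_hom_def simp flip: \<open>D.word [f] \<otimes>\<^bsub>D.PA\<^esub> D.word fs = D.word (f # fs)\<close>)
  qed
  show "\<Delta> X = \<Delta>' X" if "X \<in> carrier D.PA" for X
    by (rule D.alg_hom_eqI[OF hom _ that]) (simp add: words)
qed

text \<open>Both sides are bilinear in \<open>X\<close> and \<open>Y\<close>, so agreement on words
  spreads over the whole algebra, first in \<open>X\<close> and then in \<open>Y\<close>.\<close>

lemma functional_extend:
  assumes p: "keys p \<subseteq> carrier (D.PA \<times>\<times> D.PA)" and f: "f \<in> W"
    and words: "\<And>xs ys. word_functional xs ys p = f (B.wbr xs ys)"
    and X: "X \<in> carrier U.PA" and Y: "Y \<in> carrier U.PA"
  shows "pext (*) (\<lambda>(F, G). class_pair c F X * class_pair c G Y) p = f (B.bracket X Y)"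
proof -
  let ?t = "\<lambda>X Y. pext (*) (\<lambda>(F, G). class_pair c F X * class_pair c G Y) p"
  have pc: "F \<in> carrier D.PA" "G \<in> carrier D.PA" if "(F, G) \<in> keys p" for F G
    using p that by (auto simp: D.T_carrier)
  note lin = class_pair_linear_right[unfolded linear_on_def]
  have f0: "f 0 = 0" using W_add[OF f, of 0 0] by simp
  have add_l: "?t (X \<oplus>\<^bsub>U.PA\<^esub> X') Y = ?t X Y + ?t X' Y" if "X \<in> carrier U.PA" "X' \<in> carrier U.PA" for X X' Y
    unfolding K_pext_fun_add[symmetric] using that lin pc
    by (intro K_pext_cong) (auto simp: distrib_right)
  have add_r: "?t X (Y \<oplus>\<^bsub>U.PA\<^esub> Y') = ?t X Y + ?t X Y'" if "Y \<in> carrier U.PA" "Y' \<in> carrier U.PA" for X Y Y'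
    unfolding K_pext_fun_add[symmetric] using that lin pc
    by (intro K_pext_cong) (auto simp: distrib_left)
  have sm_l: "?t (a \<odot>\<^bsub>U.PA\<^esub> X) Y = a * ?t X Y" if "X \<in> carrier U.PA" for a X Y
    unfolding K_pext_fun_scale[symmetric] using that lin pc
    by (intro K_pext_cong) (auto simp: mult_ac)
  have sm_r: "?t X (a \<odot>\<^bsub>U.PA\<^esub> Y) = a * ?t X Y" if "Y \<in> carrier U.PA" for a X Y
    unfolding K_pext_fun_scale[symmetric] using that lin pc
    by (intro K_pext_cong) (auto simp: mult_ac)
  have one: "\<one>\<^bsub>U.PA\<^esub> \<in> carrier U.PA" by simp
  have *: "?t X (U.word ys) = f (B.bracket X (U.word ys))" for ys
    using X
  proof (induction X rule: U.presented_induct)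
    case zero
    have ys: "U.word ys \<in> carrier U.PA" by (rule U.word_carrier) simp
    show ?case
      unfolding U.zero_smult sm_l[OF one] B.bracket_smult_left[OF one ys] by (simp add: f0)
  next
    case (single xs)
    then show ?case using words[of xs ys] by (simp add: word_functional_def B.wbr_def)
  next
    case (add X X')
    then show ?case using U.word_carrier[of ys] by (simp add: add_l B.bracket_add_left W_add[OF f])
  next
    case (smult a X)
    then show ?case using U.word_carrier[of ys] by (simp add: sm_l B.bracket_smult_left W_scale[OF f])
  qed
  show ?thesis
    using Y
  proof (induction Y rule: U.presented_induct)
    case zero
    show ?case
      unfolding U.zero_smult sm_r[OF one] B.bracket_smult_right[OF X one] by (simp add: f0)
  next
    case (single xs)
    then show ?case using * by simp
  next
    case (add Y Y')
    then show ?case using X by (simp add: add_r B.bracket_add_right W_add[OF f])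
  next
    case (smult a Y)
    then show ?case using X by (simp add: sm_r B.bracket_smult_right W_scale[OF f])
  qed
qed

text \<open>The morphism is obtained by multiplying representatives of the values on letters. The
  second clause makes its value on a letter independent of the cut-off, so that later computations
  may choose \<open>n\<close> as they need.\<close>

lemma dual_condition_exists:
  "\<exists>\<Delta>. dual_condition \<Delta> \<and>
    (\<forall>f\<in>W. \<forall>n. bounded_by f n \<longrightarrow> \<Delta> (D.word [f]) = D.T.cl (dual_coproduct n f))"
proof -
  let ?N = "D.PA \<times>\<times> D.PA"
  note carrier_DirProd [simp del] one_DirProd [simp del] mult_DirProd [simp del]
  \<comment> \<open>Some admissible cut-off is fixed for each form; for forms in \<open>W\<close>
    one exists by \<open>bounded\<close>.\<close>
  define d where "d f = dual_coproduct (SOME n. bounded_by f n) f" for f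
  have d: "word_functional xs ys (d f) = f (B.wbr xs ys)" if f: "f \<in> W" for f xs ys
  proof -
    have "\<exists>n. bounded_by f n" using bounded[OF f] unfolding bounded_by_def by blast
    then have "bounded_by f (SOME n. bounded_by f n)" by (rule someI_ex)
    then show ?thesis unfolding d_def by (rule word_functional_dual_coproduct[OF f])
  qed
  have dk: "keys (d f) \<subseteq> carrier ?N" for f
    unfolding d_def by (rule keys_dual_coproduct)
  define \<phi> where "\<phi> fs = foldr (\<lambda>f p. pmul ?N (d f) p) fs (single \<one>\<^bsub>?N\<^esub> 1)" for fs
  have \<phi>k: "keys (\<phi> fs) \<subseteq> carrier ?N" for fs
  proof (induction fs)
    case Nil
    have "keys (single \<one>\<^bsub>?N\<^esub> (1 :: 'k)) \<subseteq> carrier ?N"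
      by (rule keys_subset_single, rule D.T.M.one_closed)
    then show ?case by (simp only: \<phi>_def foldr.simps id_apply)
  next
    case (Cons f fs)
    then show ?case using keys_pmul[OF D.T.M dk] by (simp add: \<phi>_def)
  qed
  have assoc: "pmul ?N (pmul ?N p q) r = pmul ?N p (pmul ?N q r)"
    if "keys p \<subseteq> carrier ?N" "keys q \<subseteq> carrier ?N" "keys r \<subseteq> carrier ?N" for p q r :: "_ \<Rightarrow>\<^sub>0 'k"
    using D.T.MA.m_assoc[of p q r] that by (simp add: monoid_algebra_simps)
  have unit: "pmul ?N (single \<one>\<^bsub>?N\<^esub> 1) p = p" "pmul ?N p (single \<one>\<^bsub>?N\<^esub> 1) = p"
    if "keys p \<subseteq> carrier ?N" for p :: "_ \<Rightarrow>\<^sub>0 'k"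
    using D.T.MA.l_one[of p] D.T.MA.r_one[of p] that by (simp_all add: monoid_algebra_simps)
  have \<phi>Nil: "\<phi> [] = single \<one>\<^bsub>?N\<^esub> 1" and \<phi>Cons: "\<phi> (f # fs) = pmul ?N (d f) (\<phi> fs)" for f fs
    by (simp_all add: \<phi>_def)
  have \<phi>mult: "\<phi> (us @ vs) = pmul ?N (\<phi> us) (\<phi> vs)" for us vs
    by (induction us) (simp_all add: \<phi>Nil \<phi>Cons unit \<phi>k assoc dk)
  have \<phi>1: "\<phi> [f] = d f" for f
    by (simp add: \<phi>Nil \<phi>Cons unit dk)
  have rel: "pext pscale \<phi> r \<in> D.T.I" if r: "r \<in> word_relations c dual_scale W" for r
  proof -
    consider f g where "f \<in> W" "g \<in> W" "r = single [f + g] 1 - single [f] 1 - single [g] 1"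
      | a f where "f \<in> W" "r = single [dual_scale a f] 1 - single [f] a"
      | f g where c "f \<in> W" "g \<in> W" "r = single [f, g] 1 - single [g, f] 1"
      using r
      by (auto simp: word_relations_def linearity_relations_def commutation_relations_def split: if_splits)
    then show ?thesis
    proof cases
      case 1
      \<comment> \<open>The cut-offs behind the three terms may differ, so the sums cannot be
        compared termwise; nondegeneracy compares them through their pairings, where additivity is
        that of evaluation of forms.\<close>
      have "d (f + g) - d f - d g \<in> D.T.I"
        using 1 D.subspace_add[OF D.W, of f g]
        by (intro nondegenerate keys_subset_diff dk)
           (simp add: word_functional_def K_pext_diff d[unfolded word_functional_def])
      then show ?thesis by (simp add: 1 P.pext_diff \<phi>1)
    next
      case 2
      have "d (dual_scale a f) - pscale a (d f) \<in> D.T.I"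
        using 2 D.subspace_scale[OF D.W, of f a]
        by (intro nondegenerate keys_subset_diff keys_subset_pscale dk)
           (simp add: word_functional_def K_pext_diff K_pext_pscale d[unfolded word_functional_def] dual_scale_def)
      then show ?thesis by (simp add: 2 P.pext_diff \<phi>1)
    next
      case 3
      \<comment> \<open>In the symmetric case the monoid of pairs is commutative, so the commutation
        relations hold exactly, before passing to the quotient.\<close>
      have "pmul ?N p q = pmul ?N q p" if "keys p \<subseteq> carrier ?N" "keys q \<subseteq> carrier ?N" for p q :: "_ \<Rightarrow>\<^sub>0 'k"
        using that(1)
      proof (induction p rule: poly_mapping_induct)
        case (single u a)
        from that(2) show ?case
        proof (induction q rule: poly_mapping_induct)
          case (single v b)
          have "u \<otimes>\<^bsub>?N\<^esub> v = v \<otimes>\<^bsub>?N\<^esub> u"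
            using \<open>u \<in> carrier ?N\<close> \<open>v \<in> carrier ?N\<close> D.PA_commutative[OF \<open>c\<close>]
            by (auto simp: D.T_carrier D.T_mult)
          then show ?case by (simp add: mult.commute)
        qed (simp_all add: pmul_add_left pmul_add_right)
      qed (simp_all add: pmul_add_left pmul_add_right)
      then have "\<phi> [f, g] = \<phi> [g, f]"
        using dk by (simp add: \<phi>Cons[of f] \<phi>Cons[of g] \<phi>Nil unit dk)
      then have "pext pscale \<phi> r = 0" by (simp add: 3(4) P.pext_diff)
      then show ?thesis using D.T.I_zero by simp
    qed
  qed
  obtain \<Delta> where \<Delta>: "\<Delta> \<in> alg_hom D.PA D.T.PA" "\<Delta> \<in> extensional (carrier D.PA)"
    "\<And>p. keys p \<subseteq> lists W \<Longrightarrow> \<Delta> (D.cl p) = D.T.cl (pext pscale \<phi> p)"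
    using D.hom_lift[OF D.T.presentation_axioms, of \<phi>] \<phi>k \<phi>mult \<phi>Nil rel
    by (auto simp del: carrier_DirProd)
  have \<Delta>1: "\<Delta> (D.word [f]) = D.T.cl (d f)" if "f \<in> W" for f
    using that by (simp add: \<Delta>(3) \<phi>1)
  show ?thesis
  proof (intro exI conjI ballI allI impI)
    show "dual_condition \<Delta>"
      unfolding dual_condition_def D.tensor_product_eq
    proof (intro conjI ballI \<Delta>)
      fix f X Y assume f: "f \<in> W" and XY: "X \<in> carrier U.PA" "Y \<in> carrier U.PA"
      show "tensor_functional (\<lambda>F. class_pair c F X) (\<lambda>F. class_pair c F Y) (\<Delta> (D.word [f]))
          = f (B.bracket X Y)"
        unfolding \<Delta>1[OF f] tensor_functional_cl[OF XY] by (rule functional_extend[OF dk f d[OF f] XY])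
    qed
    show "\<Delta> (D.word [f]) = D.T.cl (dual_coproduct n f)" if f: "f \<in> W" "bounded_by f n" for f n
    proof -
      have "d f - dual_coproduct n f \<in> D.T.I"
        using f by (intro nondegenerate keys_subset_diff dk keys_dual_coproduct)
          (simp add: word_functional_def K_pext_diff d[unfolded word_functional_def]
            word_functional_dual_coproduct[unfolded word_functional_def])
      then show ?thesis using f by (simp add: \<Delta>1 D.T.cl_eq_iff)
    qed
  qed
qed

definition cop where "cop = (THE \<Delta>. dual_condition \<Delta>)"

lemma cop:
  "dual_condition cop"
  "f \<in> W \<Longrightarrow> bounded_by f n \<Longrightarrow> cop (D.word [f]) = D.T.cl (dual_coproduct n f)"
proof -
  obtain \<Delta> where \<Delta>: "dual_condition \<Delta>"
    "\<And>f n. f \<in> W \<Longrightarrow> bounded_by f n \<Longrightarrow> \<Delta> (D.word [f]) = D.T.cl (dual_coproduct n f)"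
    using dual_condition_exists by blast
  have "cop = \<Delta>"
    unfolding cop_def by (rule the_equality[where P = dual_condition, OF \<Delta>(1)]) (rule dual_condition_unique[OF _ \<Delta>(1)])
  with \<Delta> show "dual_condition cop"
    "f \<in> W \<Longrightarrow> bounded_by f n \<Longrightarrow> cop (D.word [f]) = D.T.cl (dual_coproduct n f)"
    by auto
qed

section \<open>Convolution of characters\<close>

lemma character_word:
  assumes "\<alpha> \<in> characters D.PA" "fs \<in> lists W"
  shows "\<alpha> (D.word fs) = (\<Prod>i<length fs. \<alpha> (D.word [fs ! i]))"
  using assms(2)
proof (induction fs)
  case Nil
  then show ?case
    using assms(1) by (simp add: characters_def alg_hom_def ring_hom_def ground_field_def flip: D.word_Nil)
next
  case (Cons f fs)
  have eq: "D.word (f # fs) = D.word [f] \<otimes>\<^bsub>D.PA\<^esub> D.word fs"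
    using Cons by (subst D.word_append) auto
  have "\<alpha> (D.word (f # fs)) = \<alpha> (D.word [f]) * \<alpha> (D.word fs)"
    unfolding eq using assms(1) Cons D.word_carrier[of "[f]"] D.word_carrier[of fs]
    by (auto simp: characters_def alg_hom_def ring_hom_def ground_field_def)
  with Cons show ?case by (simp add: prod.lessThan_Suc_shift del: prod.lessThan_Suc)
qed

text \<open>A character is multiplicative on words, so the sum is the multilinear expansion of
  \<open>m\<close> at a constant word, whose letter is the vector with coordinates
  \<open>\<alpha> (D.word [D j])\<close>.\<close>

lemma sum_character_words:
  assumes \<alpha>: "\<alpha> \<in> characters D.PA" and m: "multilinear_mod scale (*) UNIV {0} m"
  shows "(\<Sum>u\<in>words (J n) k. \<alpha> (D.word (map D u)) * m (map E u))
    = m (replicate k (\<Sum>j\<in>J n. scale (\<alpha> (D.word [D j])) (E j)))"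
proof -
  have "(\<Sum>u\<in>words (J n) k. (\<Prod>i<k. \<alpha> (D.word [D (u ! i)])) * m (map E u))
      = m (replicate k (\<Sum>j\<in>J n. scale (\<alpha> (D.word [D j])) (E j)))"
    using multilinear_mod.expand[OF m J, of n E "replicate k (\<Sum>j\<in>J n. scale (\<alpha> (D.word [D j])) (E j))" "[]"
      "\<lambda>z j. \<alpha> (D.word [D j])"] by auto
  moreover have "\<alpha> (D.word (map D u)) = (\<Prod>i<k. \<alpha> (D.word [D (u ! i)]))" if "u \<in> words (J n) k" for u
    using that by (subst character_word[OF \<alpha>]) (auto simp: words_def intro!: D)
  ultimately show ?thesis by simp
qed

text \<open>The two constant letters are the parts of degree below \<open>n\<close> of the points
  that will correspond to the characters. The result is \<open>f\<close> applied to the bracket of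
  two exponentials, with \<open>weight\<close> in the place of the inverse factorials.\<close>

lemma convolution:
  assumes \<alpha>: "\<alpha> \<in> characters D.PA" and \<beta>: "\<beta> \<in> characters D.PA" and f: "f \<in> W" and n: "bounded_by f n"
  shows "tensor_functional \<alpha> \<beta> (cop (D.word [f])) = (\<Sum>k<n. \<Sum>l<n. weight c k * weight c l *
    f (B.wbr (replicate k (\<Sum>j\<in>J n. scale (\<alpha> (D.word [D j])) (E j)))
             (replicate l (\<Sum>j\<in>J n. scale (\<beta> (D.word [D j])) (E j)))))"
proof -
  let ?X = "\<Sum>j\<in>J n. scale (\<alpha> (D.word [D j])) (E j)" and ?Y = "\<Sum>j\<in>J n. scale (\<beta> (D.word [D j])) (E j)"
  have "tensor_functional \<alpha> \<beta> (cop (D.word [f])) = pext (*) (\<lambda>(a, b). \<alpha> a * \<beta> b) (dual_coproduct n f)"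
    unfolding cop(2)[OF f n] using \<alpha> \<beta>
    by (intro D.tensor_functional_cl D.character_linear)
  also have "\<dots> = (\<Sum>u\<in>short_words (J n) n. \<Sum>v\<in>short_words (J n) n. weight c (length u) * weight c (length v) *
      (\<alpha> (D.word (map D u)) * (\<beta> (D.word (map D v)) * f (B.wbr (map E u) (map E v)))))"
    by (simp add: dual_coproduct_def K_pext_sum mult_ac)
  also have "\<dots> = (\<Sum>k<n. \<Sum>u\<in>words (J n) k. \<Sum>l<n. \<Sum>v\<in>words (J n) l. weight c k * weight c l *
      (\<alpha> (D.word (map D u)) * (\<beta> (D.word (map D v)) * f (B.wbr (map E u) (map E v)))))"
    by (simp add: sum_short_words[OF J]) (intro sum.cong refl, auto simp: words_def)
  also have "\<dots> = (\<Sum>k<n. \<Sum>u\<in>words (J n) k. \<Sum>l<n. weight c k * weight c l *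
      (\<alpha> (D.word (map D u)) * f (B.wbr (map E u) (replicate l ?Y))))"
    unfolding sum_distrib_left[symmetric] sum_character_words[OF \<beta> wbr_multilinear(2)[OF f]] ..
  also have "\<dots> = (\<Sum>k<n. \<Sum>l<n. weight c k * weight c l *
      (\<Sum>u\<in>words (J n) k. \<alpha> (D.word (map D u)) * f (B.wbr (map E u) (replicate l ?Y))))"
    unfolding sum_distrib_left by (intro sum.cong refl sum.swap)
  also have "\<dots> = (\<Sum>k<n. \<Sum>l<n. weight c k * weight c l * f (B.wbr (replicate k ?X) (replicate l ?Y)))"
    unfolding sum_character_words[OF \<alpha> wbr_multilinear(1)[OF f]] ..
  finally show ?thesis .
qed

end

section \<open>Graded spaces and the characters of the dual algebras\<close>

locale graded = vector_space scale
  for scale :: "'k::field_char_0 \<Rightarrow> 'v::ab_group_add \<Rightarrow> 'v" +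
  fixes V :: "nat \<Rightarrow> 'v set"
  assumes graded: "graded_space scale V" and fin_dim: "finite_dimensional_components scale V"
begin

definition decomposition :: "'v \<Rightarrow> (nat \<Rightarrow> 'v) \<Rightarrow> bool" where
  "decomposition v f \<longleftrightarrow> (\<forall>n. f n \<in> V n) \<and> finite {n. f n \<noteq> 0} \<and> v = (\<Sum>n | f n \<noteq> 0. f n)"

definition comp :: "nat \<Rightarrow> 'v \<Rightarrow> 'v" where
  "comp n v = (THE f. decomposition v f) n"

lemma V: "subspace (V n)"
  using graded by (auto simp: graded_space_def)

lemma decomposition_ex1: "\<exists>!f. decomposition v f"
  using graded by (auto simp: graded_space_def decomposition_def)

lemma decomposition_comp: "decomposition v (\<lambda>n. comp n v)"
  using theI'[OF decomposition_ex1[of v]] by (simp add: comp_def)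

lemma comp_in [simp]: "comp n v \<in> V n"
  using decomposition_comp[of v] by (auto simp: decomposition_def)

lemma finite_comp: "finite {n. comp n v \<noteq> 0}"
  using decomposition_comp[of v] by (auto simp: decomposition_def)

lemma sum_comp: "finite A \<Longrightarrow> {n. comp n v \<noteq> 0} \<subseteq> A \<Longrightarrow> (\<Sum>n\<in>A. comp n v) = v"
proof -
  assume "finite A" "{n. comp n v \<noteq> 0} \<subseteq> A"
  then have "(\<Sum>n\<in>A. comp n v) = (\<Sum>n | comp n v \<noteq> 0. comp n v)"
    by (intro sum.mono_neutral_right) auto
  also have "\<dots> = v" using decomposition_comp[of v] by (simp add: decomposition_def)
  finally show ?thesis .
qed

lemma comp_unique:
  assumes "\<And>n. f n \<in> V n" "finite A" "\<And>n. n \<notin> A \<Longrightarrow> f n = 0"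
  shows "comp n (\<Sum>n\<in>A. f n) = f n"
proof -
  have "(\<Sum>n\<in>A. f n) = (\<Sum>n | f n \<noteq> 0. f n)"
    using assms by (intro sum.mono_neutral_right) auto
  moreover have "finite {n. f n \<noteq> 0}"
    using assms by (intro finite_subset[OF _ assms(2)]) auto
  ultimately have "decomposition (\<Sum>n\<in>A. f n) f"
    using assms by (simp add: decomposition_def)
  then show ?thesis
    using decomposition_ex1 decomposition_comp by (metis)
qed

lemma comp_add: "comp n (x + y) = comp n x + comp n y"
proof -
  let ?A = "{n. comp n x \<noteq> 0} \<union> {n. comp n y \<noteq> 0}"
  have "x + y = (\<Sum>n\<in>?A. comp n x + comp n y)"
    using finite_comp by (simp add: sum.distrib sum_comp)
  also have "comp n \<dots> = comp n x + comp n y"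
    using finite_comp by (intro comp_unique) (auto intro: subspace_add[OF V])
  finally show ?thesis .
qed

lemma comp_scale: "comp n (scale a x) = scale a (comp n x)"
proof -
  let ?A = "{n. comp n x \<noteq> 0}"
  have "scale a x = (\<Sum>n\<in>?A. scale a (comp n x))"
    using finite_comp by (simp add: sum_comp flip: scale_sum_right)
  also have "comp n \<dots> = scale a (comp n x)"
    using finite_comp by (intro comp_unique) (auto intro: subspace_scale[OF V])
  finally show ?thesis .
qed

lemma comp_zero [simp]: "comp n 0 = 0"
  using comp_scale[of n 0 0] by simp

lemma comp_sum: "comp n (sum f A) = (\<Sum>i\<in>A. comp n (f i))"
  by (induction A rule: infinite_finite_induct) (auto simp: comp_add)

lemma comp_homogeneous: "v \<in> V m \<Longrightarrow> comp n v = (if n = m then v else 0)"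
  using comp_unique[of "\<lambda>n. if n = m then v else 0" "{m}" n] subspace_0[OF V] by auto

definition trunc :: "nat \<Rightarrow> 'v \<Rightarrow> 'v" where
  "trunc n v = (\<Sum>i<n. comp i v)"

lemma trunc_add: "trunc n (x + y) = trunc n x + trunc n y"
  by (simp add: trunc_def comp_add sum.distrib)

lemma trunc_scale: "trunc n (scale a x) = scale a (trunc n x)"
  by (simp add: trunc_def comp_scale scale_sum_right)

lemma trunc_diff: "trunc n (x - y) = trunc n x - trunc n y"
  using trunc_add[of n "x - y" y] by simp

lemma trunc_sum: "trunc n (sum f A) = (\<Sum>i\<in>A. trunc n (f i))"
  by (simp add: trunc_def comp_sum) (rule sum.swap)

lemma comp_sum_components:
  assumes "\<And>i. i < n \<Longrightarrow> x i \<in> V i"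
  shows "comp m (\<Sum>i<n. x i) = (if m < n then x m else 0)"
proof -
  have "comp m (\<Sum>i<n. x i) = comp m (\<Sum>i<n. if i < n then x i else 0)"
    by simp
  also have "\<dots> = (if m < n then x m else 0)"
    using assms subspace_0[OF V] by (intro comp_unique) auto
  finally show ?thesis .
qed

lemma comp_trunc: "comp i (trunc n v) = (if i < n then comp i v else 0)"
  unfolding trunc_def by (rule comp_sum_components) simp

lemma trunc_idem [simp]: "trunc n (trunc n v) = trunc n v"
  by (simp add: trunc_def[of n "trunc n v"] comp_trunc) (simp add: trunc_def)

lemma trunc_homogeneous: "v \<in> V m \<Longrightarrow> trunc n v = (if m < n then v else 0)"
  by (simp add: trunc_def comp_homogeneous)

lemma trunc_eventually: "\<exists>n0. \<forall>n\<ge>n0. trunc n v = v"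
proof -
  obtain n0 where "{n. comp n v \<noteq> 0} \<subseteq> {..<n0}"
    using finite_comp[of v] unfolding finite_nat_set_iff_bounded by blast
  then have "trunc n v = v" if "n \<ge> n0" for n
    unfolding trunc_def using that by (intro sum_comp) auto
  then show ?thesis by blast
qed

lemma trunc_eqD: "trunc n v = trunc n w \<Longrightarrow> i < n \<Longrightarrow> comp i v = comp i w"
  by (metis comp_trunc)

definition basis :: "nat \<Rightarrow> 'v set" where
  "basis i = (SOME B. finite B \<and> independent B \<and> span B = V i)"

lemma basis: "finite (basis i)" "independent (basis i)" "span (basis i) = V i"
proof -
  obtain C where C: "finite C" "V i = span C"
    using fin_dim unfolding finite_dimensional_components_def by blast
  obtain B where B: "B \<subseteq> C" "independent B" "C \<subseteq> span B"
    by (rule maximal_independent_subset)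
  have "span B = V i"
    using B C span_mono[OF B(1)] span_minimal[OF B(3) subspace_span] by blast
  then have "finite B \<and> independent B \<and> span B = V i"
    using B C finite_subset by blast
  then have "finite (basis i) \<and> independent (basis i) \<and> span (basis i) = V i"
    unfolding basis_def by (rule someI)
  then show "finite (basis i)" "independent (basis i)" "span (basis i) = V i"
    by auto
qed

definition J :: "nat \<Rightarrow> (nat \<times> 'v) set" where
  "J n = (SIGMA i:{..<n}. basis i)"

text \<open>The coordinate at the basis vector \<open>snd j\<close> of degree \<open>fst j\<close>.
  Passing through \<open>comp\<close> makes it a form on all of V that vanishes in the other
  degrees, hence an element of the graded dual.\<close>

definition D :: "nat \<times> 'v \<Rightarrow> 'v \<Rightarrow> 'k" where
  "D j = (\<lambda>v. representation (basis (fst j)) (comp (fst j) v) (snd j))"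

lemma sum_J: "(\<Sum>j\<in>J n. f j) = (\<Sum>i<n. \<Sum>b\<in>basis i. f (i, b))"
  unfolding J_def by (subst sum.Sigma) (auto simp: basis split_def)

lemma finite_J: "finite (J n)"
  unfolding J_def using basis by auto

lemma comp_expand: "(\<Sum>b\<in>basis i. scale (D (i, b) v) b) = comp i v"
  unfolding D_def using basis by (simp add: sum_representation_eq)

lemma trunc_expand: "trunc n v = (\<Sum>j\<in>J n. scale (D j v) (snd j))"
  by (simp add: sum_J comp_expand trunc_def)

abbreviation W :: "('v \<Rightarrow> 'k) set" where "W \<equiv> graded_dual scale V"

lemma vector_space_dual: "vector_space (dual_scale :: 'k \<Rightarrow> ('v \<Rightarrow> 'k) \<Rightarrow> _)"
  by unfold_locales (auto simp: dual_scale_def algebra_simps fun_eq_iff)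

lemma linearI:
  "(\<And>x y. f (x + y) = f x + f y) \<Longrightarrow> (\<And>a x. f (scale a x) = a * f x) \<Longrightarrow> Vector_Spaces.linear scale (*) f"
  by (intro Vector_Spaces.linear.intro module_hom.intro module_hom_axioms.intro
      vector_space_axioms vector_space_mult module_axioms vector_space_mult[folded module_iff_vector_space])

lemma W_iff: "f \<in> W \<longleftrightarrow> (\<forall>x y. f (x + y) = f x + f y) \<and> (\<forall>a x. f (scale a x) = a * f x) \<and>
    (\<exists>n0. \<forall>n\<ge>n0. \<forall>x\<in>V n. f x = 0)"
proof -
  have "finite {n. \<exists>x\<in>V n. f x \<noteq> 0} \<longleftrightarrow> (\<exists>n0. \<forall>n\<ge>n0. \<forall>x\<in>V n. f x = 0)"
    unfolding finite_nat_set_iff_bounded by (auto simp: subset_iff) (meson not_less)+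
  moreover have "Vector_Spaces.linear scale (*) f \<longleftrightarrow>
      (\<forall>x y. f (x + y) = f x + f y) \<and> (\<forall>a x. f (scale a x) = a * f x)"
    using linearI[of f] module_hom.add module_hom.scale module_hom_iff_linear[of scale "(*)" f] by blast
  ultimately show ?thesis
    by (auto simp: graded_dual_def)
qed

lemma W_sum: "f \<in> W \<Longrightarrow> f (sum g A) = (\<Sum>i\<in>A. f (g i))"
proof (induction A rule: infinite_finite_induct)
  case (infinite A)
  then have "f (0 + 0) = f 0 + f 0" unfolding W_iff by blast
  with infinite show ?case by simp
next
  case empty
  then have "f (0 + 0) = f 0 + f 0" unfolding W_iff by blast
  then show ?case by simp
qed (simp add: W_iff)

lemma W_zero: "f \<in> W \<Longrightarrow> f 0 = 0"
  using W_sum[of f _ "{}"] by simp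

lemma subspace_W: "module.subspace (dual_scale :: 'k \<Rightarrow> ('v \<Rightarrow> 'k) \<Rightarrow> _) W"
proof -
  interpret dual: vector_space "dual_scale :: 'k \<Rightarrow> ('v \<Rightarrow> 'k) \<Rightarrow> _" by (rule vector_space_dual)
  show ?thesis
  proof (rule dual.subspaceI)
    show "0 \<in> W" by (simp add: W_iff)
    show "f + g \<in> W" if fg: "f \<in> W" "g \<in> W" for f g
    proof -
      obtain n1 n2 where "\<forall>n\<ge>n1. \<forall>x\<in>V n. f x = 0" "\<forall>n\<ge>n2. \<forall>x\<in>V n. g x = 0"
        using fg unfolding W_iff by blast
      then have "\<forall>n\<ge>max n1 n2. \<forall>x\<in>V n. (f + g) x = 0" by auto
      then have "\<exists>n0. \<forall>n\<ge>n0. \<forall>x\<in>V n. (f + g) x = 0" by blast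
      with fg show ?thesis unfolding W_iff by (simp add: algebra_simps)
    qed
    show "dual_scale a f \<in> W" if "f \<in> W" for a f
      using that unfolding W_iff dual_scale_def by (simp add: algebra_simps) blast
  qed
qed

lemma D_W: "D j \<in> W"
proof -
  have "D j (x + y) = D j x + D j y" for x y
    using basis by (simp add: D_def comp_add representation_add)
  moreover have "D j (scale a x) = a * D j x" for a x
    using basis by (simp add: D_def comp_scale representation_scale)
  moreover have "D j x = 0" if "n \<ge> Suc (fst j)" "x \<in> V n" for n x
    using that by (simp add: D_def comp_homogeneous[OF that(2)] representation_zero)
  ultimately show ?thesis unfolding W_iff by blast
qed

text \<open>A vector equals its own truncation at some level, which may be taken above
  \<open>n\<close>; the degrees from \<open>n\<close> on contribute nothing to
  \<open>f\<close>.\<close>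

lemma W_trunc:
  assumes f: "f \<in> W" and n: "\<And>m x. m \<ge> n \<Longrightarrow> x \<in> V m \<Longrightarrow> f x = 0"
  shows "f (trunc n v) = f v"
proof -
  obtain n0 where "\<forall>n\<ge>n0. trunc n v = v" using trunc_eventually by blast
  then have "v = trunc (max n n0) v" by simp
  then have "f v = (\<Sum>i<max n n0. f (comp i v))"
    using W_sum[OF f] by (metis trunc_def)
  also have "\<dots> = (\<Sum>i<n. f (comp i v))"
    by (intro sum.mono_neutral_right) (auto intro: n)
  also have "\<dots> = f (trunc n v)"
    by (simp add: trunc_def W_sum[OF f])
  finally show ?thesis ..
qed

lemma dual_expand:
  assumes f: "f \<in> W" and n: "\<And>m x. m \<ge> n \<Longrightarrow> x \<in> V m \<Longrightarrow> f x = 0"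
  shows "f = (\<Sum>j\<in>J n. dual_scale (f (snd j)) (D j))"
proof
  fix v
  have ap: "(\<Sum>j\<in>A. g j) v = (\<Sum>j\<in>A. g j v)" for A and g :: "nat \<times> 'v \<Rightarrow> 'v \<Rightarrow> 'k"
    by (induction A rule: infinite_finite_induct) auto
  have "f v = f (trunc n v)" by (rule W_trunc[OF assms, symmetric])
  also have "\<dots> = (\<Sum>j\<in>J n. f (snd j) * D j v)"
    using f by (simp add: trunc_expand W_sum[OF f] W_iff mult.commute)
  also have "\<dots> = (\<Sum>j\<in>J n. dual_scale (f (snd j)) (D j)) v"
    by (simp add: ap dual_scale_def)
  finally show "f v = \<dots>" .
qed

lemma dual_words: "dual_words scale W J snd D trunc"
proof -
  have "f \<in> W \<Longrightarrow> \<exists>n0. \<forall>n\<ge>n0. f = (\<Sum>j\<in>J n. dual_scale (f (snd j)) (D j))" for f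
  proof -
    assume f: "f \<in> W"
    then obtain n0 where n0: "\<And>n x. n \<ge> n0 \<Longrightarrow> x \<in> V n \<Longrightarrow> f x = 0" unfolding W_iff by blast
    have "f = (\<Sum>j\<in>J n. dual_scale (f (snd j)) (D j))" if "n \<ge> n0" for n
      by (intro dual_expand f n0[OF order_trans[OF that]])
    then show ?thesis by blast
  qed
  moreover have "D j (trunc n v) = D j v" if "j \<in> J n" for j n v
    using that by (simp add: D_def comp_trunc J_def split_beta mem_Sigma_iff[of "fst j" "snd j", simplified])
  moreover have "Vector_Spaces.linear scale (*) f" if "f \<in> W" for f
    using that by (simp add: graded_dual_def)
  ultimately show ?thesis
    by (intro dual_words.intro word_algebra.intro word_algebra_axioms.intro dual_words_axioms.intro)
       (auto simp: vector_space_axioms vector_space_dual subspace_W finite_J D_W trunc_expand[symmetric])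
qed

end

text \<open>
  \<open>b\<^sub>\<infinity>\<close> brackets for \<open>c = True\<close>, \<open>B\<^sub>\<infinity>\<close> brackets for \<open>c = False\<close>.
\<close>

locale graded_bracket = graded scale V + B: word_bracket scale UNIV c scale br
  for scale :: "'k::field_char_0 \<Rightarrow> 'v::ab_group_add \<Rightarrow> 'v" and V :: "nat \<Rightarrow> 'v set"
    and c :: bool and br :: "('k, 'v) bracket" +
  assumes homogeneous: "us \<in> homogeneous_words V m \<Longrightarrow> vs \<in> homogeneous_words V n \<Longrightarrow>
      B.wbr us vs \<in> V (m + n)"
    and zero_bounded: "\<exists>M. \<forall>m n us vs. us \<in> homogeneous_words V m \<longrightarrow> vs \<in> homogeneous_words V n \<longrightarrow>
      m + n < N \<longrightarrow> length us + length vs \<ge> M \<longrightarrow> B.wbr us vs = 0"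
begin

text \<open>Each letter is replaced by one of its homogeneous components. Such words are
  homogeneous, so degree arguments apply to them.\<close>

definition pieces :: "'v list \<Rightarrow> 'v list \<Rightarrow> bool" where
  "pieces = list_all2 (\<lambda>v u. \<exists>i. v = comp i u)"

text \<open>Each letter is the sum of its components, so a multilinear map that vanishes on all
  choices of components vanishes; \<open>pre\<close> collects the components already chosen.\<close>

lemma vanish_by_pieces:
  assumes m: "multilinear_mod scale t UNIV {0} m" and "\<And>vs. pieces vs us \<Longrightarrow> m (pre @ vs) = 0"
  shows "m (pre @ us) = 0"
  using assms(2)
proof (induction us arbitrary: pre)
  case Nil
  then show ?case by (auto simp: pieces_def)
next
  case (Cons u us)
  let ?A = "{i. comp i u \<noteq> 0}"
  interpret m: multilinear_mod scale t UNIV "{0}" m by fact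
  have "m ((pre @ [comp i u]) @ us) = 0" for i
  proof (rule Cons.IH)
    fix vs assume "pieces vs us"
    then have "pieces (comp i u # vs) (u # us)" by (auto simp: pieces_def)
    then show "m ((pre @ [comp i u]) @ vs) = 0" using Cons.prems by simp
  qed
  then have "(\<Sum>i\<in>?A. m (pre @ comp i u # us)) = 0" by simp
  moreover have "m (pre @ (\<Sum>i\<in>?A. comp i u) # us) = (\<Sum>i\<in>?A. m (pre @ comp i u # us))"
    using m.sum_slot[of pre us ?A "\<lambda>i. comp i u"] by simp
  ultimately show ?case
    using sum_comp[OF finite_comp subset_refl, of u] by simp
qed

lemma pieces_homogeneous: "pieces vs us \<Longrightarrow> \<exists>n. vs \<in> homogeneous_words V n"
proof (induction us arbitrary: vs)
  case Nil
  then show ?case by (auto simp: pieces_def homogeneous_words_def)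
next
  case (Cons u us)
  then obtain i vs' where vs: "vs = comp i u # vs'" "pieces vs' us"
    by (auto simp: pieces_def list_all2_Cons2)
  then obtain n ps where "list_all2 (\<lambda>x p. x \<in> V p) vs' ps" "sum_list ps = n"
    using Cons.IH by (force simp: homogeneous_words_def)
  then have "list_all2 (\<lambda>x p. x \<in> V p) vs (i # ps)" by (simp add: vs)
  then show ?case unfolding homogeneous_words_def by blast
qed

lemma homogeneous_words_append:
  "us \<in> homogeneous_words V m \<Longrightarrow> vs \<in> homogeneous_words V n \<Longrightarrow> us @ vs \<in> homogeneous_words V (m + n)"
proof -
  assume "us \<in> homogeneous_words V m" "vs \<in> homogeneous_words V n"
  then obtain ps qs where "list_all2 (\<lambda>x p. x \<in> V p) us ps" "sum_list ps = m"
    "list_all2 (\<lambda>x p. x \<in> V p) vs qs" "sum_list qs = n"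
    by (auto simp: homogeneous_words_def)
  then have "list_all2 (\<lambda>x p. x \<in> V p) (us @ vs) (ps @ qs)" "sum_list (ps @ qs) = m + n"
    by (auto intro: list_all2_appendI)
  then show ?thesis unfolding homogeneous_words_def by blast
qed

lemma homogeneous_words_single: "x \<in> V i \<Longrightarrow> [x] \<in> homogeneous_words V i"
  unfolding homogeneous_words_def by (auto intro: exI[of _ "[i]"])

section \<open>Brackets truncated by degree\<close>

lemma trunc_high:
  assumes "us \<in> homogeneous_words V m" "vs \<in> homogeneous_words V n" "m + n \<ge> N"
  shows "trunc N (B.wbr us vs) = 0"
  using homogeneous[OF assms(1,2)] assms(3) by (simp add: trunc_homogeneous)

lemma trunc_wbr_multilinear:
  "multilinear_mod scale scale UNIV {0} (\<lambda>us. trunc N (B.wbr us vs))"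
  "multilinear_mod scale scale UNIV {0} (\<lambda>vs. trunc N (B.wbr us vs))"
  by (rule multilinear_mod_compose[OF B.wbr_multilinear_left vector_space_axioms],
      simp_all add: trunc_add trunc_scale)
     (rule multilinear_mod_compose[OF B.wbr_multilinear_right vector_space_axioms],
      simp_all add: trunc_add trunc_scale)

lemma vanish_by_pieces2:
  assumes "\<And>us' vs'. pieces us' us \<Longrightarrow> pieces vs' vs \<Longrightarrow> trunc N (B.wbr us' vs') = 0"
  shows "trunc N (B.wbr us vs) = 0"
proof -
  have "trunc N (B.wbr us' vs) = 0" if "pieces us' us" for us'
    using vanish_by_pieces[OF trunc_wbr_multilinear(2)[of N us'], of vs "[]"] assms that by simp
  then show ?thesis
    using vanish_by_pieces[OF trunc_wbr_multilinear(1)[of N vs], of us "[]"] by simp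
qed

text \<open>Homogeneous words are treated by total degree: below \<open>N\<close> the bracket of
  long words is zero by boundedness, and from \<open>N\<close> on \<open>trunc N\<close> removes it.
  Arbitrary words reduce to these by taking components.\<close>

lemma nilpotent: "\<exists>M. \<forall>us vs. length us + length vs \<ge> M \<longrightarrow> trunc N (B.wbr us vs) = 0"
proof -
  obtain M where M: "\<And>m n us vs. us \<in> homogeneous_words V m \<Longrightarrow> vs \<in> homogeneous_words V n \<Longrightarrow>
      m + n < N \<Longrightarrow> length us + length vs \<ge> M \<Longrightarrow> B.wbr us vs = 0"
    using zero_bounded by blast
  have "trunc N (B.wbr us vs) = 0" if "length us + length vs \<ge> M" for us vs
  proof (rule vanish_by_pieces2)
    fix us' vs' assume p: "pieces us' us" "pieces vs' vs"
    then obtain m n where mn: "us' \<in> homogeneous_words V m" "vs' \<in> homogeneous_words V n"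
      using pieces_homogeneous by meson
    have len: "length us' = length us" "length vs' = length vs"
      using p by (auto simp: pieces_def dest: list_all2_lengthD)
    show "trunc N (B.wbr us' vs') = 0"
    proof (cases "m + n < N")
      case True
      then show ?thesis using M[OF mn] that len by (simp add: trunc_def)
    next
      case False
      then show ?thesis using trunc_high[OF mn] by simp
    qed
  qed
  then show ?thesis by blast
qed

lemma homogeneous_words_insert:
  assumes "pieces ws (pre @ x # post)" "trunc N x = 0"
  shows "\<exists>m\<ge>N. ws \<in> homogeneous_words V m"
proof -
  obtain a i b where ws: "ws = a @ comp i x # b" "pieces a pre" "pieces b post"
    using assms(1) by (auto simp: pieces_def list_all2_append2 list_all2_Cons2)
  obtain p q where pq: "a \<in> homogeneous_words V p" "b \<in> homogeneous_words V q"
    using ws pieces_homogeneous by meson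
  \<comment> \<open>A component of degree below \<open>N\<close> is zero and zero lies in every
    \<open>V n\<close>, so the piece may be counted in degree at least \<open>N\<close> in any
    case.\<close>
  have "comp i x \<in> V (max i N)"
  proof (cases "i < N")
    case True
    then have "comp i x = 0" using trunc_eqD[of N x 0 i] assms(2) by (simp add: trunc_def)
    then show ?thesis using subspace_0[OF V] by simp
  qed (simp add: max_def)
  then have "a @ [comp i x] @ b \<in> homogeneous_words V (p + (max i N + q))"
    by (intro homogeneous_words_append pq homogeneous_words_single)
  then show ?thesis using ws by (intro exI[of _ "p + (max i N + q)"]) simp
qed

text \<open>The difference of the two letters lives in degrees at least \<open>N\<close>. Degrees
  are nonnegative and add up, so every bracket containing it also lies in degrees at least
  \<open>N\<close> and is truncated away.\<close>

lemma trunc_slot: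
  assumes "trunc N x = trunc N y"
  shows "trunc N (B.wbr (us @ x # us') vs) = trunc N (B.wbr (us @ y # us') vs)"
    and "trunc N (B.wbr vs (us @ x # us')) = trunc N (B.wbr vs (us @ y # us'))"
proof -
  have xy: "trunc N (x - y) = 0" using assms by (simp add: trunc_diff)
  have "trunc N (B.wbr (us @ (x - y) # us') vs) = 0"
  proof (rule vanish_by_pieces2)
    fix ws vs' assume p: "pieces ws (us @ (x - y) # us')" "pieces vs' vs"
    then obtain m n where "ws \<in> homogeneous_words V m" "vs' \<in> homogeneous_words V n" "m \<ge> N"
      using pieces_homogeneous homogeneous_words_insert[OF p(1) xy] by meson
    then show "trunc N (B.wbr ws vs') = 0" by (intro trunc_high) auto
  qed
  moreover have "trunc N (B.wbr vs (us @ (x - y) # us')) = 0"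
  proof (rule vanish_by_pieces2)
    fix ws vs' assume p: "pieces ws (us @ (x - y) # us')" "pieces vs' vs"
    then obtain m n where "ws \<in> homogeneous_words V m" "vs' \<in> homogeneous_words V n" "m \<ge> N"
      using pieces_homogeneous homogeneous_words_insert[OF p(1) xy] by meson
    then show "trunc N (B.wbr vs' ws) = 0" by (intro trunc_high) auto
  qed
  moreover have "m (us @ (x - y) # us') = m (us @ x # us') - m (us @ y # us')"
    if "multilinear_mod scale scale UNIV {0} m" for m
    using multilinear_mod.add[OF that, of us us' "x - y" y] by (simp add: algebra_simps)
  ultimately show "trunc N (B.wbr (us @ x # us') vs) = trunc N (B.wbr (us @ y # us') vs)"
    "trunc N (B.wbr vs (us @ x # us')) = trunc N (B.wbr vs (us @ y # us'))"
    using trunc_wbr_multilinear by (metis eq_iff_diff_eq_0)+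
qed

lemma trunc_wbr_cong_left:
  assumes "map (trunc N) us = map (trunc N) us'"
  shows "trunc N (B.wbr (pre @ us) vs) = trunc N (B.wbr (pre @ us') vs)"
  using assms
proof (induction us arbitrary: pre us')
  case (Cons u us)
  then obtain u' us'' where *: "us' = u' # us''" "trunc N u = trunc N u'" "map (trunc N) us = map (trunc N) us''"
    by (auto simp: Cons_eq_map_conv)
  show ?case
    using Cons.IH[OF *(3), of "pre @ [u]"] trunc_slot(1)[OF *(2), of pre us'' vs] by (simp add: *(1))
qed simp

lemma trunc_wbr_cong_right:
  assumes "map (trunc N) us = map (trunc N) us'"
  shows "trunc N (B.wbr vs (pre @ us)) = trunc N (B.wbr vs (pre @ us'))"
  using assms
proof (induction us arbitrary: pre us')
  case (Cons u us)
  then obtain u' us'' where *: "us' = u' # us''" "trunc N u = trunc N u'" "map (trunc N) us = map (trunc N) us''"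
    by (auto simp: Cons_eq_map_conv)
  show ?case
    using Cons.IH[OF *(3), of "pre @ [u]"] trunc_slot(2)[OF *(2), of vs pre us''] by (simp add: *(1))
qed simp

lemma trunc_wbr_cong:
  assumes "map (trunc N) us = map (trunc N) us'" "map (trunc N) vs = map (trunc N) vs'"
  shows "trunc N (B.wbr us vs) = trunc N (B.wbr us' vs')"
  using trunc_wbr_cong_left[OF assms(1), of "[]" vs] trunc_wbr_cong_right[OF assms(2), of us' "[]"] by simp

lemma dual_bracket: "dual_bracket scale W c J snd D trunc br"
proof (intro dual_bracket.intro dual_words B.word_bracket_axioms dual_bracket_axioms.intro)
  fix f assume f: "f \<in> W"
  then obtain n0 where n0: "\<And>n x. n \<ge> n0 \<Longrightarrow> x \<in> V n \<Longrightarrow> f x = 0"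
    unfolding W_iff by blast
  obtain M where M: "\<And>us vs. length us + length vs \<ge> M \<Longrightarrow> trunc n0 (B.wbr us vs) = 0"
    using nilpotent by blast
  \<comment> \<open>From \<open>n0\<close> on, truncating the value of the bracket does not change
    \<open>f\<close>; from \<open>M\<close> on, one word of length \<open>n\<close> already makes
    the total length large enough for nilpotence.\<close>
  have "f (B.wbr us vs) = f (B.wbr (map (trunc n) us) (map (trunc n) vs)) \<and>
      (length us \<ge> n \<or> length vs \<ge> n \<longrightarrow> f (B.wbr us vs) = 0)" if n: "n \<ge> max n0 M" for n us vs
  proof -
    have tn: "f (trunc n v) = f v" for v
      using n by (intro W_trunc[OF f] n0[OF order_trans[of n0 n]]) auto
    have "trunc n (B.wbr us vs) = trunc n (B.wbr (map (trunc n) us) (map (trunc n) vs))"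
      by (rule trunc_wbr_cong) auto
    then have "f (B.wbr us vs) = f (B.wbr (map (trunc n) us) (map (trunc n) vs))"
      by (metis tn)
    moreover have "f (B.wbr us vs) = 0" if "length us \<ge> n \<or> length vs \<ge> n"
    proof -
      have "trunc n0 (B.wbr us vs) = 0" using that n by (intro M) auto
      then show ?thesis using W_trunc[of f n0 "B.wbr us vs", OF f n0] W_zero[OF f] by simp
    qed
    ultimately show ?thesis by blast
  qed
  then show "\<exists>n0. \<forall>n\<ge>n0. \<forall>us vs. f (B.wbr us vs) = f (B.wbr (map (trunc n) us) (map (trunc n) vs)) \<and>
      (length us \<ge> n \<or> length vs \<ge> n \<longrightarrow> f (B.wbr us vs) = 0)"
    by blast
qed

sublocale D: dual_bracket scale W c J snd D trunc br
  by (rule dual_bracket)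

subsection \<open>Characters\<close>

text \<open>Evaluation of a form at a point of the completion. For \<open>f\<close> in the graded
  dual only finitely many degrees contribute.\<close>

definition ev :: "(nat \<Rightarrow> 'v) \<Rightarrow> ('v \<Rightarrow> 'k) \<Rightarrow> 'k" where
  "ev x f = (\<Sum>i | f (x i) \<noteq> 0. f (x i))"

definition to_character :: "(nat \<Rightarrow> 'v) \<Rightarrow> ('k, 'v \<Rightarrow> 'k) word_class \<Rightarrow> 'k" where
  "to_character x = restrict (quotient_lift (\<lambda>fs. prod_list (map (ev x) fs))) (carrier D.D.PA)"

lemma ev_eq:
  assumes "x \<in> completion V" "\<And>m y. m \<ge> n \<Longrightarrow> y \<in> V m \<Longrightarrow> f y = 0"
  shows "ev x f = (\<Sum>i<n. f (x i))"
  unfolding ev_def using assms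
  by (intro sum.mono_neutral_left) (auto simp: completion_def not_le[symmetric])

lemma W_bound: "f \<in> W \<Longrightarrow> \<exists>n. \<forall>m\<ge>n. \<forall>y\<in>V m. f y = 0"
  unfolding W_iff by blast

lemma ev_add:
  assumes x: "x \<in> completion V" and "f \<in> W" "g \<in> W"
  shows "ev x (f + g) = ev x f + ev x g"
proof -
  obtain n1 where n1: "\<And>m y. m \<ge> n1 \<Longrightarrow> y \<in> V m \<Longrightarrow> f y = 0" using W_bound[OF assms(2)] by blast
  obtain n2 where n2: "\<And>m y. m \<ge> n2 \<Longrightarrow> y \<in> V m \<Longrightarrow> g y = 0" using W_bound[OF assms(3)] by blast
  let ?n = "max n1 n2"
  have "f y = 0" "g y = 0" "(f + g) y = 0" if "m \<ge> ?n" "y \<in> V m" for m y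
    using n1[of m y] n2[of m y] that by auto
  then have "ev x f = (\<Sum>i<?n. f (x i))" "ev x g = (\<Sum>i<?n. g (x i))" "ev x (f + g) = (\<Sum>i<?n. (f + g) (x i))"
    by (blast intro: ev_eq[OF x])+
  then show ?thesis by (simp add: sum.distrib)
qed

lemma ev_scale:
  assumes x: "x \<in> completion V" and "f \<in> W"
  shows "ev x (dual_scale a f) = a * ev x f"
proof -
  obtain n where n: "\<And>m y. m \<ge> n \<Longrightarrow> y \<in> V m \<Longrightarrow> f y = 0" using W_bound[OF assms(2)] by blast
  have "dual_scale a f y = 0" if "m \<ge> n" "y \<in> V m" for m y
    using n[OF that] by (simp add: dual_scale_def)
  with n have "ev x f = (\<Sum>i<n. f (x i))" "ev x (dual_scale a f) = (\<Sum>i<n. dual_scale a f (x i))"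
    by (blast intro: ev_eq[OF x])+
  then show ?thesis by (simp add: dual_scale_def sum_distrib_left)
qed

lemma ev_D:
  assumes x: "x \<in> completion V"
  shows "ev x (D (i, b)) = D (i, b) (x i)"
proof -
  have comp_x: "comp i (x k) = (if i = k then x k else 0)" for k
    using x by (intro comp_homogeneous) (simp add: completion_def)
  have "comp i y = 0" if "m \<ge> Suc i" "y \<in> V m" for m y
    using that by (simp add: comp_homogeneous[OF that(2)])
  then have "ev x (D (i, b)) = (\<Sum>k<Suc i. D (i, b) (x k))"
    by (intro ev_eq[OF x]) (simp add: D_def representation_zero)
  also have "\<dots> = (\<Sum>k\<in>{i}. D (i, b) (x k))"
    using x by (intro sum.mono_neutral_right)
      (auto simp: D_def comp_x representation_zero)
  finally show ?thesis by simp
qed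

lemma ev_D_expand:
  assumes x: "x \<in> completion V"
  shows "(\<Sum>b\<in>basis i. scale (ev x (D (i, b))) b) = x i"
proof -
  have "x i \<in> V i" using x by (simp add: completion_def)
  then show ?thesis by (simp add: ev_D[OF x] comp_expand comp_homogeneous)
qed

lemma to_character:
  assumes x: "x \<in> completion V"
  shows "to_character x \<in> characters D.D.PA"
    and "fs \<in> lists W \<Longrightarrow> to_character x (D.D.word fs) = prod_list (map (ev x) fs)"
proof -
  let ?\<phi> = "\<lambda>fs. prod_list (map (ev x) fs)"
  have *: "pext (*) ?\<phi> r = 0" if "r \<in> word_relations c dual_scale W" for r
    using that
    by (auto simp: word_relations_def linearity_relations_def commutation_relations_def K_pext_diff
        ev_add[OF x] ev_scale[OF x] mult.commute split: if_splits)
  show "to_character x \<in> characters D.D.PA"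
    unfolding to_character_def by (rule D.D.character_lift) (simp_all add: *)
  show "to_character x (D.D.word fs) = ?\<phi> fs" if "fs \<in> lists W"
    unfolding to_character_def using that
    by (subst D.D.character_lift(2)) (simp_all add: *)
qed

lemma to_character_generator: "x \<in> completion V \<Longrightarrow> f \<in> W \<Longrightarrow> to_character x (D.D.word [f]) = ev x f"
  by (simp add: to_character)

lemma character_generator_eqI:
  assumes "\<alpha> \<in> characters D.D.PA" "\<beta> \<in> characters D.D.PA"
    and "\<And>f. f \<in> W \<Longrightarrow> \<alpha> (D.D.word [f]) = \<beta> (D.D.word [f])"
  shows "\<alpha> = \<beta>"
proof (rule D.D.character_eqI[OF assms(1,2)])
  fix fs assume fs: "fs \<in> carrier (free_monoid W)"
  then have fs: "fs \<in> lists W" by simp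
  have "fs ! i \<in> W" if "i < length fs" for i
    using fs nth_mem[OF that] by auto
  then show "\<alpha> (D.D.word fs) = \<beta> (D.D.word fs)"
    unfolding D.character_word[OF assms(1) fs] D.character_word[OF assms(2) fs]
    by (intro prod.cong refl assms(3)) simp
qed

lemma inj_to_character: "inj_on to_character (completion V)"
proof (rule inj_onI)
  fix x y assume x: "x \<in> completion V" and y: "y \<in> completion V" and eq: "to_character x = to_character y"
  have "ev x f = ev y f" if "f \<in> W" for f
    unfolding to_character_generator[OF x that, symmetric] to_character_generator[OF y that, symmetric] eq ..
  then have "ev x (D j) = ev y (D j)" for j using D_W by simp
  then show "x = y"
    by (intro ext, subst ev_D_expand[OF x, symmetric], subst ev_D_expand[OF y, symmetric]) simp
qed

lemma surj_to_character:
  assumes \<alpha>: "\<alpha> \<in> characters D.D.PA"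
  shows "\<alpha> \<in> to_character ` completion V"
proof
  define a where "a f = \<alpha> (D.D.word [f])" for f
  have wc: "D.D.word [f] \<in> carrier D.D.PA" if "f \<in> W" for f
    using that by (intro D.D.word_carrier) simp
  have a_add: "a (f + g) = a f + a g" if "f \<in> W" "g \<in> W" for f g
    using D.D.character_linear[OF \<alpha>] wc that D.D.word_add[of "[]" "[]" f g]
    by (simp add: a_def linear_on_def)
  have a_scale: "a (dual_scale s f) = s * a f" if "f \<in> W" for f s
    using D.D.character_linear[OF \<alpha>] wc that D.D.word_scale[of "[]" "[]" f s]
    by (simp add: a_def linear_on_def)
  have W0: "0 \<in> W" using D.D.subspace_0[OF subspace_W] .
  have a_sum: "a (sum g A) = (\<Sum>i\<in>A. a (g i))" if "\<And>i. i \<in> A \<Longrightarrow> g i \<in> W" for g :: "nat \<times> 'v \<Rightarrow> _" and A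
    using that
  proof (induction A rule: infinite_finite_induct)
    case (insert i A)
    then have gW: "g i \<in> W" "sum g A \<in> W" by (auto intro: D.D.subspace_sum[OF subspace_W])
    have IH: "a (sum g A) = (\<Sum>i\<in>A. a (g i))" using insert by simp
    show ?case unfolding sum.insert[OF insert.hyps] a_add[OF gW] IH ..
  qed (use a_scale[OF W0, of 0] in \<open>simp_all add: dual_scale_def zero_fun_def\<close>)
  \<comment> \<open>The point is assembled from the values of the character on the coordinate forms
    of each degree, a finite sum because each basis is finite.\<close>
  define x where "x i = (\<Sum>b\<in>basis i. scale (a (D (i, b))) b)" for i
  have "x i \<in> span (basis i)" for i
    unfolding x_def by (intro span_sum span_scale span_base)
  then have "x i \<in> V i" for i using basis(3) by simp
  then show x: "x \<in> completion V" by (simp add: completion_def)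
  show "\<alpha> = to_character x"
  proof (rule character_generator_eqI[OF \<alpha> to_character(1)[OF x]])
    fix f assume f: "f \<in> W"
    then obtain n where n: "\<And>m y. m \<ge> n \<Longrightarrow> y \<in> V m \<Longrightarrow> f y = 0" using W_bound[OF f] by blast
    have "ev x f = (\<Sum>i<n. f (x i))" by (rule ev_eq[OF x n])
    also have "\<dots> = (\<Sum>j\<in>J n. f (snd j) * a (D j))"
      using f by (simp add: x_def sum_J W_sum[OF f] W_iff mult.commute)
    also have "\<dots> = a (\<Sum>j\<in>J n. dual_scale (f (snd j)) (D j))"
      by (subst a_sum) (simp_all add: a_scale D_W D.D.subspace_scale[OF subspace_W])
    also have "\<dots> = a f"
      using dual_expand[OF f n] by simp
    finally show "\<alpha> (D.D.word [f]) = to_character x (D.D.word [f])"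
      using f by (simp add: to_character_generator[OF x] a_def)
  qed
qed

text \<open>The degree \<open>i\<close> part of \<open>z\<close> agrees with that of the truncated
  double exponential series for all large \<open>n\<close>. It is a relation because the same
  \<open>z\<close> has to be matched with two series: a symmetric bracket with factorial weights,
  and a tensor bracket with weight 1.\<close>

definition product_rel :: "(nat \<Rightarrow> 'v) \<Rightarrow> (nat \<Rightarrow> 'v) \<Rightarrow> (nat \<Rightarrow> 'v) \<Rightarrow> bool" where
  "product_rel x y z \<longleftrightarrow> (\<forall>i. \<exists>n0. \<forall>n\<ge>n0. z i = comp i (\<Sum>k<n. \<Sum>l<n. scale (weight c k * weight c l)
     (B.wbr (replicate k (\<Sum>i<n. x i)) (replicate l (\<Sum>i<n. y i)))))"

lemma to_character_product:
  assumes x: "x \<in> completion V" and y: "y \<in> completion V" and z: "z \<in> completion V"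
    and xyz: "product_rel x y z"
  shows "to_character z = (\<lambda>a\<in>carrier D.D.PA. tensor_functional (to_character x) (to_character y) (D.cop a))"
proof (rule character_generator_eqI[OF to_character(1)[OF z]])
  have "D.cop \<in> alg_hom D.D.PA D.D.T.PA"
    using D.cop(1) by (simp add: D.dual_condition_def D.D.tensor_product_eq)
  then show "(\<lambda>a\<in>carrier D.D.PA. tensor_functional (to_character x) (to_character y) (D.cop a)) \<in> characters D.D.PA"
    by (intro D.D.convolution_character to_character x y)
  fix f assume f: "f \<in> W"
  then obtain m where m: "\<And>k y. k \<ge> m \<Longrightarrow> y \<in> V k \<Longrightarrow> f y = 0" using W_bound[OF f] by blast
  define P where "P n = (\<Sum>k<n. \<Sum>l<n. scale (weight c k * weight c l)
     (B.wbr (replicate k (\<Sum>i<n. x i)) (replicate l (\<Sum>i<n. y i))))" for n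
  \<comment> \<open>The threshold in \<open>product_rel\<close> depends on the degree; as
    \<open>f\<close> sees only the degrees below \<open>m\<close>, a common one suffices.\<close>
  have "\<exists>n0. \<forall>i<m. \<forall>n\<ge>n0. z i = comp i (P n)" for m
  proof (induction m)
    case (Suc m)
    then obtain n1 where n1: "\<forall>i<m. \<forall>n\<ge>n1. z i = comp i (P n)" by blast
    obtain n2 where n2: "\<forall>n\<ge>n2. z m = comp m (P n)"
      using xyz unfolding product_rel_def P_def by blast
    have "\<forall>i<Suc m. \<forall>n\<ge>max n1 n2. z i = comp i (P n)"
      using n1 n2 by (auto simp: less_Suc_eq)
    then show ?case by blast
  qed auto
  then obtain n1 where n1: "\<forall>i<m. \<forall>n\<ge>n1. z i = comp i (P n)" by blast
  obtain n2 where n2: "\<forall>n\<ge>n2. D.bounded_by f n"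
    using D.bounded[OF f] unfolding D.bounded_by_def by blast
  define n where "n = max n1 n2"
  have b: "D.bounded_by f n" using n2 by (simp add: n_def)
  have e: "(\<Sum>j\<in>J n. scale (to_character u (D.D.word [D j])) (snd j)) = (\<Sum>i<n. u i)"
    if "u \<in> completion V" for u
    using that by (simp add: to_character_generator D_W sum_J ev_D_expand)
  have "tensor_functional (to_character x) (to_character y) (D.cop (D.D.word [f])) =
     (\<Sum>k<n. \<Sum>l<n. weight c k * weight c l * f (B.wbr (replicate k (\<Sum>i<n. x i)) (replicate l (\<Sum>i<n. y i))))"
    by (subst D.convolution[OF to_character(1)[OF x] to_character(1)[OF y] f b]) (simp add: e x y)
  also have "\<dots> = f (P n)"
    using f by (simp add: P_def W_sum[OF f]) (simp add: W_iff)
  also have "\<dots> = (\<Sum>i<m. f (comp i (P n)))"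
    using W_trunc[of f m "P n", OF f m] by (simp add: trunc_def W_sum[OF f])
  also have "\<dots> = (\<Sum>i<m. f (z i))"
  proof (intro sum.cong refl)
    fix i assume "i \<in> {..<m}"
    then have "z i = comp i (P n)" using n1 unfolding n_def by (meson lessThan_iff max.cobounded1)
    then show "f (comp i (P n)) = f (z i)" by simp
  qed
  also have "\<dots> = ev z f" by (rule ev_eq[OF z m, symmetric])
  finally show "to_character z (D.D.word [f]) =
      (\<lambda>a\<in>carrier D.D.PA. tensor_functional (to_character x) (to_character y) (D.cop a)) (D.D.word [f])"
    using f by (simp add: to_character_generator[OF z] D.D.word_carrier)
qed

lemma to_character_zero: "to_character (\<lambda>n. 0) = restrict word_counit (carrier D.D.PA)"
proof -
  have z: "(\<lambda>n. 0) \<in> completion V" using subspace_0[OF V] by (simp add: completion_def)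
  let ?\<phi> = "\<lambda>fs. if fs = [] then 1 else 0 :: 'k"
  have *: "pext (*) ?\<phi> r = 0" if "r \<in> word_relations c dual_scale W" for r
    using that
    by (auto simp: word_relations_def linearity_relations_def commutation_relations_def K_pext_diff split: if_splits)
  note lift = D.D.character_lift[of ?\<phi>, folded word_counit_def]
  show ?thesis
  proof (rule character_generator_eqI[OF to_character(1)[OF z]])
    show "restrict word_counit (carrier D.D.PA) \<in> characters D.D.PA"
      by (rule lift) (auto simp: *)
    fix f assume f: "f \<in> W"
    have "restrict word_counit (carrier D.D.PA) (D.D.word [f]) = 0"
      using f by (subst lift(2)) (auto simp: *)
    moreover have "ev (\<lambda>n. 0) f = 0"
      using W_zero[OF f] by (simp add: ev_def)
    ultimately show "to_character (\<lambda>n. 0) (D.D.word [f]) = restrict word_counit (carrier D.D.PA) (D.D.word [f])"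
      by (simp add: to_character_generator[OF z f])
  qed
qed

text \<open>Transport of structure along \<open>to_character\<close>. The monoid \<open>L\<close> is
  a parameter, since in the tensor case its product comes from the induced symmetric bracket and not
  from the bracket of the locale.\<close>

theorem character_monoid_iso:
  fixes L :: "(nat \<Rightarrow> 'v) monoid"
  assumes L: "Group.monoid L" "carrier L = completion V" "\<one>\<^bsub>L\<^esub> = (\<lambda>n. 0)"
    and rel: "\<And>x y. x \<in> completion V \<Longrightarrow> y \<in> completion V \<Longrightarrow> product_rel x y (x \<otimes>\<^bsub>L\<^esub> y)"
  shows "Group.monoid (character_monoid D.D.PA D.cop word_counit)"
    and "L \<cong> character_monoid D.D.PA D.cop word_counit"
proof -
  let ?C = "character_monoid D.D.PA D.cop word_counit"
  interpret L: Group.monoid L by (rule L(1))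
  have bij: "bij_betw to_character (completion V) (carrier ?C)"
    using inj_to_character surj_to_character to_character(1)
    by (auto simp: bij_betw_def character_monoid_def)
  have mul: "to_character x \<otimes>\<^bsub>?C\<^esub> to_character y = to_character (x \<otimes>\<^bsub>L\<^esub> y)"
    if "x \<in> completion V" "y \<in> completion V" for x y
    using to_character_product[OF that _ rel[OF that]] L.m_closed[of x y] that L(2) by (simp add: character_monoid_def)
  have one: "\<one>\<^bsub>?C\<^esub> = to_character (\<lambda>n. 0)"
    by (simp add: character_monoid_def to_character_zero)
  have c: "\<And>\<alpha>. \<alpha> \<in> carrier ?C \<Longrightarrow> \<exists>x\<in>completion V. \<alpha> = to_character x"
    using bij by (auto simp: bij_betw_def)
  have cc: "\<And>x. x \<in> completion V \<Longrightarrow> to_character x \<in> carrier ?C"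
    using bij by (auto simp: bij_betw_def)
  show "Group.monoid ?C"
  proof (rule Group.monoidI)
    show "\<one>\<^bsub>?C\<^esub> \<in> carrier ?C" using L.one_closed by (simp add: one cc L)
  next
    fix \<alpha> \<beta> assume "\<alpha> \<in> carrier ?C" "\<beta> \<in> carrier ?C"
    then show "\<alpha> \<otimes>\<^bsub>?C\<^esub> \<beta> \<in> carrier ?C"
      using c L.m_closed L(2) by (metis mul cc)
  next
    fix \<alpha> \<beta> \<gamma> assume "\<alpha> \<in> carrier ?C" "\<beta> \<in> carrier ?C" "\<gamma> \<in> carrier ?C"
    then obtain x y z where "x \<in> completion V" "y \<in> completion V" "z \<in> completion V"
      "\<alpha> = to_character x" "\<beta> = to_character y" "\<gamma> = to_character z"
      using c by metis
    then show "\<alpha> \<otimes>\<^bsub>?C\<^esub> \<beta> \<otimes>\<^bsub>?C\<^esub> \<gamma> = \<alpha> \<otimes>\<^bsub>?C\<^esub> (\<beta> \<otimes>\<^bsub>?C\<^esub> \<gamma>)"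
      using L.m_assoc[of x y z] L.m_closed[of x y] L.m_closed[of y z] L(2) by (simp add: mul)
  next
    fix \<alpha> assume "\<alpha> \<in> carrier ?C"
    then obtain x where "x \<in> completion V" "\<alpha> = to_character x" using c by blast
    then show "\<one>\<^bsub>?C\<^esub> \<otimes>\<^bsub>?C\<^esub> \<alpha> = \<alpha>" "\<alpha> \<otimes>\<^bsub>?C\<^esub> \<one>\<^bsub>?C\<^esub> = \<alpha>"
      using L.l_one[of x] L.r_one[of x] L.one_closed L(2,3) by (simp_all add: mul one)
  qed
  have "to_character \<in> iso L ?C"
    using bij mul cc L(2) by (auto simp: iso_def hom_def)
  then show "L \<cong> ?C" by (auto simp: is_iso_def)
qed

end

section \<open>Sums over partitions\<close>

text \<open>Double counting: a partition with a marked block is a nonempty subset \<open>I\<close>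
  together with a partition of its complement into one block fewer.\<close>

lemma partitions_remove_block:
  assumes A: "finite A"
  shows "(\<Sum>P | partition_on A P \<and> card P = Suc k. \<Sum>I\<in>P. f I (P - {I}))
    = (\<Sum>I\<in>Pow A - {{}}. \<Sum>P | partition_on (A - I) P \<and> card P = k. f I P)"
proof -
  have fin: "finite {P. partition_on B P \<and> card P = k}" if "finite B" for B :: "'a set" and k
    using finitely_many_partition_on[OF that] by (rule rev_finite_subset) auto
  have finP: "finite P" if "partition_on A P" for P
    using A that finite_elements by blast
  let ?L = "SIGMA P:{P. partition_on A P \<and> card P = Suc k}. P"
  let ?R = "SIGMA I:Pow A - {{}}. {P. partition_on (A - I) P \<and> card P = k}"
  have ins: "partition_on A (insert I P) \<and> I \<notin> P \<and> insert I P - {I} = P"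
    if "I \<in> Pow A - {{}}" "partition_on (A - I) P" for I P
  proof -
    have "I \<notin> P" using that partition_onD1[OF that(2)] by auto
    moreover have "disjnt I (\<Union>P)"
      using partition_onD1[OF that(2)] by (auto simp: disjnt_def)
    then have "partition_on A (insert I P)"
      using that by (simp add: partition_on_insert)
    ultimately show ?thesis by auto
  qed
  have "(\<Sum>(P, I)\<in>?L. f I (P - {I})) = (\<Sum>(I, P)\<in>?R. f I P)"
  proof (rule sum.reindex_bij_witness[where i = "\<lambda>(I, P). (insert I P, I)" and j = "\<lambda>(P, I). (I, P - {I})"])
    fix x assume "x \<in> ?L"
    then obtain P I where x: "x = (P, I)" "partition_on A P" "card P = Suc k" "I \<in> P" by auto
    have I: "I \<subseteq> A" "I \<noteq> {}"
      using x partition_onD1[OF x(2)] partition_onD3[OF x(2)] by auto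
    have "disjnt (\<Union>(P - {I})) I"
      using partition_onD2[OF x(2)] x(4) by (fastforce simp: disjoint_def disjnt_def)
    then have "\<Union>(P - {I}) = A - I"
      using partition_onD1[OF x(2)] x(4) by (auto simp: disjnt_def)
    then have "partition_on (A - I) (P - {I})"
      using partition_onD2[OF x(2)] partition_onD3[OF x(2)]
      by (auto simp: partition_on_def disjoint_def)
    then show "(case x of (P, I) \<Rightarrow> (I, P - {I})) \<in> ?R"
      using x I finP[OF x(2)] by auto
    show "(case case x of (P, I) \<Rightarrow> (I, P - {I}) of (I, P) \<Rightarrow> (insert I P, I)) = x"
      using x by auto
    show "(case case x of (P, I) \<Rightarrow> (I, P - {I}) of (I, P) \<Rightarrow> f I P) = (case x of (P, I) \<Rightarrow> f I (P - {I}))"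
      using x by auto
  next
    fix y assume "y \<in> ?R"
    then obtain I P where y: "y = (I, P)" "I \<in> Pow A - {{}}" "partition_on (A - I) P" "card P = k" by auto
    then show "(case case y of (I, P) \<Rightarrow> (insert I P, I) of (P, I) \<Rightarrow> (I, P - {I})) = y"
      using ins[OF y(2,3)] by auto
    have "finite P" using finite_elements[OF _ y(3)] A by auto
    then show "(case y of (I, P) \<Rightarrow> (insert I P, I)) \<in> ?L"
      using ins[OF y(2,3)] y by auto
  qed
  then show ?thesis
    using A fin finP by (subst (1 2) sum.Sigma) auto
qed

lemma sum_Pow_card:
  assumes "finite B" "vector_space s"
  shows "(\<Sum>I\<in>Pow B. f (card I)) = (\<Sum>i\<le>card B. s (of_nat (card B choose i)) (f i))"
proof -
  interpret vector_space s by fact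
  have "(\<Sum>I\<in>Pow B. f (card I)) = (\<Sum>i\<le>card B. \<Sum>I\<in>{I\<in>Pow B. card I = i}. f (card I))"
    using assms(1) by (intro sum.group[symmetric]) (auto intro: card_mono)
  also have "\<dots> = (\<Sum>i\<le>card B. s (of_nat (card B choose i)) (f i))"
  proof (intro sum.cong refl)
    fix i
    have "(\<Sum>I\<in>{I\<in>Pow B. card I = i}. f (card I)) = (\<Sum>I\<in>{I\<in>Pow B. card I = i}. f i)"
      by simp
    also have "\<dots> = s (of_nat (card {I\<in>Pow B. card I = i})) (f i)"
      by (rule sum_constant_scale)
    finally show "(\<Sum>I\<in>{I\<in>Pow B. card I = i}. f (card I)) = s (of_nat (card B choose i)) (f i)"
      using n_subsets[OF assms(1), of i] by simp
  qed
  finally show ?thesis .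
qed

text \<open>A subset is a pair of a subset of \<open>A \<inter> C\<close> and a subset of
  \<open>A - C\<close>, and each size occurs a binomial number of times.\<close>

lemma sum_Pow_card2:
  assumes "finite A" "vector_space s"
  shows "(\<Sum>I\<in>Pow A. f (card (I \<inter> C)) (card (I - C))) =
    (\<Sum>i\<le>card (A \<inter> C). \<Sum>j\<le>card (A - C).
      s (of_nat (card (A \<inter> C) choose i) * of_nat (card (A - C) choose j)) (f i j))"
proof -
  interpret vector_space s by fact
  have "(\<Sum>I\<in>Pow A. f (card (I \<inter> C)) (card (I - C)))
      = (\<Sum>(I, K)\<in>Pow (A \<inter> C) \<times> Pow (A - C). f (card I) (card K))"
    by (rule sum.reindex_bij_witness[where i = "\<lambda>(I, K). I \<union> K" and j = "\<lambda>I. (I \<inter> C, I - C)"])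
       (auto intro!: arg_cong2[where f = f] arg_cong[where f = card])
  also have "\<dots> = (\<Sum>I\<in>Pow (A \<inter> C). \<Sum>K\<in>Pow (A - C). f (card I) (card K))"
    by (rule sum.cartesian_product[symmetric])
  also have "\<dots> = (\<Sum>I\<in>Pow (A \<inter> C). \<Sum>j\<le>card (A - C). s (of_nat (card (A - C) choose j)) (f (card I) j))"
    using assms by (intro sum.cong refl sum_Pow_card) auto
  also have "\<dots> = (\<Sum>i\<le>card (A \<inter> C). s (of_nat (card (A \<inter> C) choose i))
      (\<Sum>j\<le>card (A - C). s (of_nat (card (A - C) choose j)) (f i j)))"
    using assms by (intro sum_Pow_card) auto
  finally show ?thesis by (simp add: scale_sum_right)
qed

lemma sum_antidiagonal:
  fixes N :: nat
  shows "(\<Sum>a<N. \<Sum>i\<le>a. f i (a - i)) = (\<Sum>i<N. \<Sum>a<N - i. f i a :: 'a::comm_monoid_add)"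
proof -
  have "(\<Sum>a<N. \<Sum>i\<le>a. f i (a - i)) = (\<Sum>(i, a)\<in>{(i, j). i + j < N}. f i a)"
    by (rule sum.triangle_reindex[symmetric])
  also have "{(i, j). i + j < N} = (SIGMA i:{..<N}. {..<N - i})"
    by auto
  finally show ?thesis by (simp add: sum.Sigma)
qed

text \<open>
  Multilinear functions on words that are symmetric are regarded as functions of multisets;
  \<open>g i j\<close> is the value of a block with \<open>i\<close> elements in \<open>C\<close> and \<open>j\<close> elements outside.
\<close>

locale symmetric_multilinear = vector_space scale
  for scale :: "'k::field_char_0 \<Rightarrow> 'v::ab_group_add \<Rightarrow> 'v" +
  fixes G :: "'v multiset \<Rightarrow> 'v" and g :: "nat \<Rightarrow> nat \<Rightarrow> 'v"
  assumes G_add: "G (add_mset (x + y) M) = G (add_mset x M) + G (add_mset y M)"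
    and G_scale: "G (add_mset (scale a x) M) = scale a (G (add_mset x M))"
    and g_00: "g 0 0 = 0"
begin

lemma G_zero: "G (add_mset 0 M) = 0"
  using G_scale[of 0 0 M] by simp

lemma G_sum: "G (add_mset (sum f A) M) = (\<Sum>i\<in>A. G (add_mset (f i) M))"
  by (induction A rule: infinite_finite_induct) (auto simp: G_zero G_add)

text \<open>
  \<open>block_sum k M a b\<close> is \<open>1/(a! b!)\<close> times the sum of \<open>G\<close> over all partitions with \<open>k\<close> blocks of a
  set with \<open>a\<close> elements in \<open>C\<close> and \<open>b\<close> elements outside. The recursion singles out one of the
  \<open>k\<close> blocks.
\<close>

primrec block_sum :: "nat \<Rightarrow> 'v multiset \<Rightarrow> nat \<Rightarrow> nat \<Rightarrow> 'v" where
  "block_sum 0 M a b = (if a = 0 \<and> b = 0 then G M else 0)"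
| "block_sum (Suc k) M a b = scale (1 / of_nat (Suc k)) (\<Sum>i\<le>a. \<Sum>j\<le>b.
     scale (1 / (fact i * fact j)) (block_sum k (add_mset (g i j) M) (a - i) (b - j)))"

text \<open>A zero in \<open>M\<close> survives every step of the recursion, and \<open>G\<close>
  vanishes on it at the end. This removes blocks whose value is zero.\<close>

lemma block_sum_zero: "block_sum k (add_mset 0 M) a b = 0"
proof (induction k arbitrary: M a b)
  case (Suc k)
  then have "block_sum k (add_mset x (add_mset 0 M)) a b = 0" for x M a b
    by (metis add_mset_commute)
  then show ?case by simp
qed (simp add: G_zero)

text \<open>Induction on \<open>k\<close>, marking one block: removing it puts its value into
  \<open>M\<close> and leaves a partition of the complement, so \<open>M\<close> has to be
  arbitrary.\<close>

lemma sum_partitions_card: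
  assumes "finite A"
  shows "(\<Sum>P | partition_on A P \<and> card P = k.
      G (image_mset (\<lambda>I. g (card (I \<inter> C)) (card (I - C))) (mset_set P) + M))
    = scale (fact (card (A \<inter> C)) * fact (card (A - C))) (block_sum k M (card (A \<inter> C)) (card (A - C)))"
  using assms
proof (induction k arbitrary: A M)
  case 0
  have "{P. partition_on A P \<and> card P = 0} = (if A = {} then {{}} else {})"
    using 0 finite_elements[OF 0] by (auto simp: partition_on_def)
  moreover have "card (A \<inter> C) = 0 \<and> card (A - C) = 0 \<longleftrightarrow> A = {}"
    using 0 by auto
  ultimately show ?case by auto
next
  case (Suc k)
  let ?g = "\<lambda>I. g (card (I \<inter> C)) (card (I - C))"
  let ?f = "\<lambda>I P. G (add_mset (?g I) (image_mset ?g (mset_set P)) + M)"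
  let ?a = "card (A \<inter> C)" and ?b = "card (A - C)"
  let ?h = "\<lambda>i j. scale (fact (?a - i) * fact (?b - j)) (block_sum k (add_mset (g i j) M) (?a - i) (?b - j))"
  \<comment> \<open>Each partition is counted once for each of its \<open>Suc k\<close> possible
    marked blocks.\<close>
  have "scale (of_nat (Suc k)) (\<Sum>P | partition_on A P \<and> card P = Suc k. G (image_mset ?g (mset_set P) + M))
      = (\<Sum>P | partition_on A P \<and> card P = Suc k. \<Sum>I\<in>P. ?f I (P - {I}))"
    unfolding scale_sum_right
  proof (intro sum.cong refl)
    fix P assume P: "P \<in> {P. partition_on A P \<and> card P = Suc k}"
    then have fin: "finite P" using finite_elements[OF Suc.prems] by auto
    have "?f I (P - {I}) = G (image_mset ?g (mset_set P) + M)" if "I \<in> P" for I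
      using mset_set.remove[OF fin that] by simp
    then have "(\<Sum>I\<in>P. ?f I (P - {I})) = (\<Sum>I\<in>P. G (image_mset ?g (mset_set P) + M))"
      by (intro sum.cong refl)
    also have "\<dots> = scale (of_nat (card P)) (G (image_mset ?g (mset_set P) + M))"
      by (rule sum_constant_scale)
    finally show "scale (of_nat (Suc k)) (G (image_mset ?g (mset_set P) + M)) = (\<Sum>I\<in>P. ?f I (P - {I}))"
      using P by simp
  qed
  also have "\<dots> = (\<Sum>I\<in>Pow A - {{}}. \<Sum>P | partition_on (A - I) P \<and> card P = k. ?f I P)"
    by (rule partitions_remove_block[OF Suc.prems])
  also have "\<dots> = (\<Sum>I\<in>Pow A - {{}}. ?h (card (I \<inter> C)) (card (I - C)))"
  proof (intro sum.cong refl)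
    fix I assume "I \<in> Pow A - {{}}"
    then have I: "I \<subseteq> A" "finite I" using Suc.prems finite_subset by auto
    have c: "card ((A - I) \<inter> C) = ?a - card (I \<inter> C)" "card ((A - I) - C) = ?b - card (I - C)"
      using I Suc.prems by (subst card_Diff_subset[symmetric]; auto intro!: arg_cong[where f = card])+
    have "(\<Sum>P | partition_on (A - I) P \<and> card P = k. ?f I P)
        = (\<Sum>P | partition_on (A - I) P \<and> card P = k. G (image_mset ?g (mset_set P) + add_mset (?g I) M))"
      by simp
    also have "\<dots> = ?h (card (I \<inter> C)) (card (I - C))"
      using Suc.IH[of "A - I" "add_mset (?g I) M"] Suc.prems by (simp only: c finite_Diff)
    finally show "(\<Sum>P | partition_on (A - I) P \<and> card P = k. ?f I P) = ?h (card (I \<inter> C)) (card (I - C))" .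
  qed
  \<comment> \<open>The empty set may be included because its value \<open>g 0 0\<close> is
    zero.\<close>
  also have "\<dots> = (\<Sum>I\<in>Pow A. ?h (card (I \<inter> C)) (card (I - C)))"
    using Suc.prems by (intro sum.mono_neutral_left) (auto simp: g_00 block_sum_zero)
  also have "\<dots> = (\<Sum>i\<le>?a. \<Sum>j\<le>?b. scale (of_nat (?a choose i) * of_nat (?b choose j)) (?h i j))"
    by (rule sum_Pow_card2[OF Suc.prems vector_space_axioms])
  \<comment> \<open>Here a!/i! is the product of (a - i)! and the binomial coefficient, and likewise
    for b and j.\<close>
  also have "\<dots> = (\<Sum>i\<le>?a. \<Sum>j\<le>?b. scale (fact ?a * fact ?b) (scale (1 / (fact i * fact j))
      (block_sum k (add_mset (g i j) M) (?a - i) (?b - j))))"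
    by (intro sum.cong refl) (simp add: binomial_fact field_simps)
  also have "\<dots> = scale (of_nat (Suc k)) (scale (fact ?a * fact ?b) (block_sum (Suc k) M ?a ?b))"
    by (simp add: scale_sum_right field_simps del: of_nat_Suc)
  finally show ?case
    by (rule scale_left_imp_eq[rotated]) (simp del: of_nat_Suc)
qed

text \<open>When \<open>g i j\<close> is the truncated bracket of i copies of x and j copies of y,
  this is the bracket of the two exponentials with both series cut at \<open>L\<close>.\<close>

definition total :: "nat \<Rightarrow> 'v" where
  "total L = (\<Sum>i<L. \<Sum>j<L. scale (1 / (fact i * fact j)) (g i j))"

text \<open>A Cauchy product: summed over all sizes, the recursion for \<open>block_sum\<close>
  splits off one factor \<open>total L\<close> at each step. A block with \<open>L\<close> elements
  of one kind contributes zero, so ranges beyond \<open>k * L\<close> capture everything.\<close>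

lemma sum_block_sum:
  assumes g: "\<And>i j. i \<ge> L \<or> j \<ge> L \<Longrightarrow> g i j = 0" and "N1 > k * L" "N2 > k * L"
  shows "(\<Sum>a<N1. \<Sum>b<N2. block_sum k M a b) = scale (1 / fact k) (G (replicate_mset k (total L) + M))"
  using assms(2,3)
proof (induction k arbitrary: M N1 N2)
  case 0
  have "(\<Sum>a<N1. \<Sum>b<N2. block_sum 0 M a b) = (\<Sum>a<N1. if a = 0 then \<Sum>b<N2. if b = 0 then G M else 0 else 0)"
    by (intro sum.cong refl) auto
  also have "\<dots> = G M" using 0 by (simp add: sum.delta)
  finally show ?case by simp
next
  case (Suc k)
  let ?B = "\<lambda>i j a b. scale (1 / (fact i * fact j)) (block_sum k (add_mset (g i j) M) a b)"
  have L: "L \<le> N1" "L \<le> N2" using Suc.prems by auto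
  have "scale (of_nat (Suc k)) (\<Sum>a<N1. \<Sum>b<N2. block_sum (Suc k) M a b)
      = (\<Sum>a<N1. \<Sum>b<N2. \<Sum>i\<le>a. \<Sum>j\<le>b. ?B i j (a - i) (b - j))"
    by (simp add: scale_sum_right field_simps del: of_nat_Suc)
  also have "\<dots> = (\<Sum>a<N1. \<Sum>i\<le>a. \<Sum>b<N2. \<Sum>j\<le>b. ?B i j (a - i) (b - j))"
    by (intro sum.cong refl sum.swap)
  also have "\<dots> = (\<Sum>i<N1. \<Sum>a<N1 - i. \<Sum>b<N2. \<Sum>j\<le>b. ?B i j a (b - j))"
    by (rule sum_antidiagonal)
  also have "\<dots> = (\<Sum>i<N1. \<Sum>a<N1 - i. \<Sum>j<N2. \<Sum>b<N2 - j. ?B i j a b)"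
    by (intro sum.cong refl sum_antidiagonal)
  also have "\<dots> = (\<Sum>i<N1. \<Sum>j<N2. \<Sum>a<N1 - i. \<Sum>b<N2 - j. ?B i j a b)"
    by (intro sum.cong refl sum.swap)
  also have "\<dots> = (\<Sum>i<L. \<Sum>j<N2. \<Sum>a<N1 - i. \<Sum>b<N2 - j. ?B i j a b)"
    using L by (intro sum.mono_neutral_right) (auto simp: g block_sum_zero)
  also have "\<dots> = (\<Sum>i<L. \<Sum>j<L. \<Sum>a<N1 - i. \<Sum>b<N2 - j. ?B i j a b)"
    using L by (intro sum.cong refl sum.mono_neutral_right) (auto simp: g block_sum_zero)
  \<comment> \<open>Since i and j are below \<open>L\<close>, the remaining ranges
    \<open>N1 - i\<close> and \<open>N2 - j\<close> still exceed \<open>k * L\<close>, and the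
    induction hypothesis applies.\<close>
  also have "\<dots> = (\<Sum>i<L. \<Sum>j<L. scale (1 / (fact i * fact j))
      (scale (1 / fact k) (G (replicate_mset k (total L) + add_mset (g i j) M))))"
    unfolding scale_sum_right[symmetric]
    using Suc.prems by (intro sum.cong refl arg_cong[where f = "scale _"] Suc.IH) auto
  also have "\<dots> = scale (1 / fact k) (\<Sum>i<L. \<Sum>j<L. G (add_mset (scale (1 / (fact i * fact j)) (g i j)) (replicate_mset k (total L) + M)))"
    by (simp add: scale_sum_right G_scale mult.commute)
  also have "\<dots> = scale (1 / fact k) (G (replicate_mset (Suc k) (total L) + M))"
    unfolding G_sum[symmetric] total_def[symmetric] by simp
  also have "\<dots> = scale (of_nat (Suc k)) (scale (1 / fact (Suc k)) (G (replicate_mset (Suc k) (total L) + M)))"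
    by (simp add: field_simps del: of_nat_Suc)
  finally show ?case
    by (rule scale_left_imp_eq[rotated]) (simp del: of_nat_Suc)
qed

text \<open>The identity \<open>e\<^sup>x * e\<^sup>y = e\<^bsup>x \<lozenge> y\<^esup>\<close>, tested against \<open>G\<close>.\<close>

lemma exponential_formula:
  assumes g: "\<And>i j. i \<ge> L \<or> j \<ge> L \<Longrightarrow> g i j = 0"
    and G: "\<And>M. size M \<ge> K \<Longrightarrow> G M = 0" and N: "N > K * L"
  shows "(\<Sum>k<K. scale (1 / fact k) (G (replicate_mset k (total L)))) =
    (\<Sum>a<N. \<Sum>b<N. scale (1 / (fact a * fact b)) (\<Sum>P | partition_on {..<a + b} P.
      G (image_mset (\<lambda>I. g (card (I \<inter> {..<a})) (card (I - {..<a}))) (mset_set P))))"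
proof -
  let ?p = "\<lambda>a b P. G (image_mset (\<lambda>I. g (card (I \<inter> {..<a})) (card (I - {..<a}))) (mset_set P))"
  have parts: "scale (1 / (fact a * fact b)) (\<Sum>P | partition_on {..<a + b} P. ?p a b P)
      = (\<Sum>k<K. block_sum k {#} a b)" for a b
  proof -
    let ?A = "{..<a + b}"
    have c: "card (?A \<inter> {..<a}) = a" "card (?A - {..<a}) = b"
    proof -
      have "?A \<inter> {..<a} = {..<a}" "?A - {..<a} = {a..<a + b}" by auto
      then show "card (?A \<inter> {..<a}) = a" "card (?A - {..<a}) = b" by simp_all
    qed
    have fin: "finite {P. partition_on ?A P}" by (rule finitely_many_partition_on) simp
    \<comment> \<open>A partition with at least \<open>K\<close> blocks gives a multiset of size at
      least \<open>K\<close>, on which \<open>G\<close> vanishes.\<close>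
    have "(\<Sum>P | partition_on ?A P. ?p a b P) = (\<Sum>P | partition_on ?A P \<and> card P < K. ?p a b P)"
    proof (rule sum.mono_neutral_right[OF fin])
      show "\<forall>P\<in>{P. partition_on ?A P} - {P. partition_on ?A P \<and> card P < K}. ?p a b P = 0"
        by (intro ballI G) (simp add: not_less)
    qed auto
    also have "\<dots> = (\<Sum>k<K. \<Sum>P\<in>{P\<in>{P. partition_on ?A P \<and> card P < K}. card P = k}. ?p a b P)"
      using fin by (intro sum.group[symmetric]) auto
    also have "\<dots> = (\<Sum>k<K. \<Sum>P | partition_on ?A P \<and> card P = k. ?p a b P)"
      by (intro sum.cong refl) auto
    also have "\<dots> = (\<Sum>k<K. scale (fact a * fact b) (block_sum k {#} a b))"
      using sum_partitions_card[where A = ?A and C = "{..<a}" and M = "{#}"] by (simp add: c)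
    finally show ?thesis by (simp add: scale_sum_right)
  qed
  have "(\<Sum>a<N. \<Sum>b<N. scale (1 / (fact a * fact b)) (\<Sum>P | partition_on {..<a + b} P. ?p a b P))
      = (\<Sum>a<N. \<Sum>b<N. \<Sum>k<K. block_sum k {#} a b)"
    by (simp only: parts)
  also have "\<dots> = (\<Sum>a<N. \<Sum>k<K. \<Sum>b<N. block_sum k {#} a b)"
    by (intro sum.cong refl sum.swap)
  also have "\<dots> = (\<Sum>k<K. \<Sum>a<N. \<Sum>b<N. block_sum k {#} a b)"
    by (rule sum.swap)
  also have "\<dots> = (\<Sum>k<K. scale (1 / fact k) (G (replicate_mset k (total L))))"
  proof (intro sum.cong refl)
    fix k assume "k \<in> {..<K}"
    then have "k * L \<le> K * L" by (intro mult_right_mono) auto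
    then have "k * L < N" using N by linarith
    then show "(\<Sum>a<N. \<Sum>b<N. block_sum k {#} a b) = scale (1 / fact k) (G (replicate_mset k (total L)))"
      using sum_block_sum[of L k N N "{#}", OF g] by simp
  qed
  finally show ?thesis ..
qed

end

section \<open>The monoid structure on the completion\<close>

lemma symmetric_algebra_eq: "symmetric_algebra s W = presented_algebra (free_monoid W) (word_relations True s W)"
  by (simp add: symmetric_algebra_def word_relations_def)

lemma tensor_algebra_eq: "tensor_algebra s W = presented_algebra (free_monoid W) (word_relations False s W)"
  by (simp add: tensor_algebra_def word_relations_def)

lemma symmetric_class_eq: "symmetric_class s W = presented_class (free_monoid W) (word_relations True s W)"
  by (simp add: symmetric_class_def word_relations_def fun_eq_iff)

lemma tensor_class_eq: "tensor_class s W = presented_class (free_monoid W) (word_relations False s W)"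
  by (simp add: tensor_class_def word_relations_def fun_eq_iff)

lemma symmetric_pairing_eq: "symmetric_pairing = class_pair True"
  by (simp add: fun_eq_iff symmetric_pairing_def class_pair_def pair_def[abs_def] perms_def cong: if_cong)

lemma tensor_pairing_eq: "tensor_pairing = class_pair False"
  by (simp add: fun_eq_iff tensor_pairing_def class_pair_def pair_def[abs_def] perms_def cong: if_cong)

lemma pair_singleton: "pair c [f] [x] = f x"
proof -
  have "{..<Suc 0} = {0}" by auto
  then have "perms c (Suc 0) = {id}" by (auto simp: perms_def permutes_sing)
  then show ?thesis by (simp add: pair_def)
qed

lemma mset_nths_replicate: "mset (nths (replicate a x) I) = replicate_mset (card (I \<inter> {..<a})) x"
proof -
  have "length (nths (replicate a x) I) = card (I \<inter> {..<a})"
    unfolding length_nths by (rule arg_cong[where f = card]) auto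
  moreover have "set (nths (replicate a x) I) \<subseteq> {x}"
    using set_nths_subset[of "replicate a x" I] by auto
  then have "nths (replicate a x) I = replicate (length (nths (replicate a x) I)) x"
    by (intro replicate_eqI) auto
  ultimately show ?thesis by (metis mset_replicate)
qed

lemma card_shift:
  fixes I :: "nat set"
  assumes "I \<subseteq> {..<a + b}"
  shows "card ({j. a + j \<in> I} \<inter> {..<b}) = card (I - {..<a})"
proof (rule bij_betw_same_card[where f = "(+) a"])
  have "I - {..<a} \<subseteq> (+) a ` ({j. a + j \<in> I} \<inter> {..<b})"
  proof
    fix i assume "i \<in> I - {..<a}"
    then show "i \<in> (+) a ` ({j. a + j \<in> I} \<inter> {..<b})"
      using assms by (intro image_eqI[of _ _ "i - a"]) auto
  qed
  then show "bij_betw ((+) a) ({j. a + j \<in> I} \<inter> {..<b}) (I - {..<a})"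
    by (auto simp: bij_betw_def)
qed

locale b_infinity = graded_bracket scale V True br
  for scale :: "'k::field_char_0 \<Rightarrow> 'v::ab_group_add \<Rightarrow> 'v" and V :: "nat \<Rightarrow> 'v set" and br :: "('k, 'v) bracket" +
  assumes unit: "B.wbr [] [x] = x" "B.wbr [x] [] = x"
    and unit0: "length us \<noteq> 1 \<Longrightarrow> B.wbr [] us = 0" "length us \<noteq> 1 \<Longrightarrow> B.wbr us [] = 0"
    and assoc: "(\<Sum>P | partition_on {..<length ys + length zs} P.
         sbracket scale br (symmetric_word scale UNIV xs) (sbracket_blocks scale br ys zs P)) =
      (\<Sum>P | partition_on {..<length xs + length ys} P.
         sbracket scale br (sbracket_blocks scale br xs ys P) (symmetric_word scale UNIV zs))"
begin

lemma sbracket_eq: "sbracket scale br = B.bracket"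
  by (simp add: fun_eq_iff sbracket_def B.bracket_def symmetric_algebra_eq)

lemma symmetric_word_eq: "symmetric_word scale UNIV xs = B.word xs"
  by (simp add: symmetric_word_def symmetric_class_eq)

text \<open>A commutative word is determined by its multiset of letters, so the choice of orderings
  does not affect the value; multisets are the form in which sums over partitions are
  handled.\<close>

definition bm :: "'v multiset \<Rightarrow> 'v multiset \<Rightarrow> 'v" where
  "bm M N = B.wbr (SOME xs. mset xs = M) (SOME ys. mset ys = N)"

lemma bm_mset: "bm (mset xs) (mset ys) = B.wbr xs ys"
proof -
  have "mset (SOME xs'. mset xs' = mset xs) = mset xs" "mset (SOME ys'. mset ys' = mset ys) = mset ys"
    by (rule someI[of "\<lambda>xs'. mset xs' = _"], rule refl)+
  then show ?thesis unfolding bm_def by (intro B.wbr_mset) auto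
qed

lemma bm_replicate: "bm (replicate_mset k x) (replicate_mset l y) = B.wbr (replicate k x) (replicate l y)"
  using bm_mset[of "replicate k x" "replicate l y"] by simp

text \<open>A product over an unordered set has no preferred ordering of its factors, hence only the
  multiset of the letters of the resulting word is asserted.\<close>

lemma finprod_word:
  assumes "finite P"
  shows "(\<Otimes>\<^bsub>B.PA\<^esub>I\<in>P. B.word [F I]) \<in> B.word ` {xs. mset xs = image_mset F (mset_set P)}"
proof -
  interpret comm_monoid B.PA
    by (rule B.PA.monoid_comm_monoidI) (rule B.PA_commutative, simp_all)
  show ?thesis
    using assms
  proof (induction P rule: finite_induct)
    case empty
    then show ?case by (simp add: B.word_Nil)
  next
    case (insert I P)
    then obtain xs where xs: "(\<Otimes>\<^bsub>B.PA\<^esub>I\<in>P. B.word [F I]) = B.word xs" "mset xs = image_mset F (mset_set P)"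
      by auto
    have "(\<Otimes>\<^bsub>B.PA\<^esub>I\<in>insert I P. B.word [F I]) = B.word [F I] \<otimes>\<^bsub>B.PA\<^esub> B.word xs"
      using insert xs by (subst finprod_insert) (auto intro: B.word_carrier)
    also have "\<dots> = B.word (F I # xs)"
      by (simp add: B.word_append)
    finally show ?case
      using insert xs by (intro image_eqI[of _ _ "F I # xs"]) auto
  qed
qed

definition part :: "'v list \<Rightarrow> 'v list \<Rightarrow> nat set \<Rightarrow> 'v" where
  "part xs ys I = B.wbr (nths xs I) (nths ys {j. length xs + j \<in> I})"

lemma sbracket_part_eq: "sbracket_part scale br xs ys I = part xs ys I"
  by (simp add: sbracket_part_def part_def B.wbr_def sbracket_eq symmetric_word_eq)

lemma blocks:
  assumes "finite P"
  obtains us where "sbracket_blocks scale br xs ys P = B.word us" "mset us = image_mset (part xs ys) (mset_set P)"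
  using finprod_word[OF assms, of "part xs ys"]
  by (auto simp: sbracket_blocks_def symmetric_word_eq sbracket_part_eq symmetric_algebra_eq)

lemma bm_assoc:
  "(\<Sum>P | partition_on {..<length ys + length zs} P. bm (mset xs) (image_mset (part ys zs) (mset_set P))) =
   (\<Sum>P | partition_on {..<length xs + length ys} P. bm (image_mset (part xs ys) (mset_set P)) (mset zs))"
proof -
  have fin: "finite P" if "partition_on {..<n} P" for n :: nat and P
    using finite_elements[OF _ that] by simp
  have "bm (mset xs) (image_mset (part ys zs) (mset_set P))
      = sbracket scale br (symmetric_word scale UNIV xs) (sbracket_blocks scale br ys zs P)" if "finite P" for P
    using that by (rule blocks[where xs = ys and ys = zs])
      (simp add: sbracket_eq symmetric_word_eq flip: B.wbr_def bm_mset)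
  moreover have "bm (image_mset (part xs ys) (mset_set P)) (mset zs)
      = sbracket scale br (sbracket_blocks scale br xs ys P) (symmetric_word scale UNIV zs)" if "finite P" for P
    using that by (rule blocks[where xs = xs and ys = ys])
      (simp add: sbracket_eq symmetric_word_eq flip: B.wbr_def bm_mset)
  ultimately show ?thesis
    using assoc[where xs = xs and ys = ys and zs = zs] fin by simp
qed

text \<open>In constant words a block matters only through the numbers of positions it takes from
  each word, which is why partitions can be summed by block sizes.\<close>

lemma part_replicate:
  assumes "I \<subseteq> {..<a + b}"
  shows "part (replicate a x) (replicate b y) I =
    bm (replicate_mset (card (I \<inter> {..<a})) x) (replicate_mset (card (I - {..<a})) y)"
  using card_shift[OF assms] bm_mset[of "nths (replicate a x) I" "nths (replicate b y) {j. a + j \<in> I}"]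
  by (simp add: part_def mset_nths_replicate)

lemma bm_add:
  "bm (add_mset (x + y) M) N = bm (add_mset x M) N + bm (add_mset y M) N"
  "bm N (add_mset (x + y) M) = bm N (add_mset x M) + bm N (add_mset y M)"
  "bm (add_mset (scale a x) M) N = scale a (bm (add_mset x M) N)"
  "bm N (add_mset (scale a x) M) = scale a (bm N (add_mset x M))"
proof -
  obtain ms ns where mn: "M = mset ms" "N = mset ns" using ex_mset by metis
  have *: "bm (add_mset z M) N = B.wbr ([] @ z # ms) ns" "bm N (add_mset z M) = B.wbr ns ([] @ z # ms)" for z
    using bm_mset[of "z # ms" ns] bm_mset[of ns "z # ms"] by (simp_all add: mn)
  show "bm (add_mset (x + y) M) N = bm (add_mset x M) N + bm (add_mset y M) N"
    unfolding * using multilinear_mod.add[OF B.wbr_multilinear_left, of ns "[]" ms x y] by simp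
  show "bm N (add_mset (x + y) M) = bm N (add_mset x M) + bm N (add_mset y M)"
    unfolding * using multilinear_mod.add[OF B.wbr_multilinear_right, of ns "[]" ms x y] by simp
  show "bm (add_mset (scale a x) M) N = scale a (bm (add_mset x M) N)"
    unfolding * using multilinear_mod.scale[OF B.wbr_multilinear_left, of ns "[]" ms x a] by simp
  show "bm N (add_mset (scale a x) M) = scale a (bm N (add_mset x M))"
    unfolding * using multilinear_mod.scale[OF B.wbr_multilinear_right, of ns "[]" ms x a] by simp
qed

lemma trunc_bm_trunc:
  "trunc n (bm (image_mset (trunc n) M) N) = trunc n (bm M N)"
  "trunc n (bm N (image_mset (trunc n) M)) = trunc n (bm N M)"
proof -
  obtain ms ns where mn: "M = mset ms" "N = mset ns" using ex_mset by metis
  have "trunc n (bm (mset (map (trunc n) ms)) (mset ns)) = trunc n (bm (mset ms) (mset ns))"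
    unfolding bm_mset by (rule trunc_wbr_cong) auto
  then show "trunc n (bm (image_mset (trunc n) M) N) = trunc n (bm M N)" by (simp add: mn)
  have "trunc n (bm (mset ns) (mset (map (trunc n) ms))) = trunc n (bm (mset ns) (mset ms))"
    unfolding bm_mset by (rule trunc_wbr_cong) auto
  then show "trunc n (bm N (image_mset (trunc n) M)) = trunc n (bm N M)" by (simp add: mn)
qed

text \<open>The block value \<open>g i j\<close> to which the sums over partitions are
  applied.\<close>

definition tbm :: "nat \<Rightarrow> 'v \<Rightarrow> 'v \<Rightarrow> nat \<Rightarrow> nat \<Rightarrow> 'v" where
  "tbm n x y i j = trunc n (bm (replicate_mset i x) (replicate_mset j y))"

text \<open>The lozenge product modulo degrees \<open>n\<close> and above, with both exponential
  series cut at \<open>L\<close>; see \<open>truncated_lozenge\<close>.\<close>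

definition tproduct :: "nat \<Rightarrow> nat \<Rightarrow> 'v \<Rightarrow> 'v \<Rightarrow> 'v" where
  "tproduct n L x y = (\<Sum>i<L. \<Sum>j<L. scale (1 / (fact i * fact j)) (tbm n x y i j))"

lemma symmetric_multilinear_left:
  "symmetric_multilinear scale (\<lambda>M. trunc n (bm M N)) (tbm n x y)"
  using unit0(1)[of "[]"] bm_mset[of "[]" "[]"]
  by unfold_locales (simp_all add: bm_add trunc_add trunc_scale tbm_def trunc_def[of n 0])

lemma symmetric_multilinear_right:
  "symmetric_multilinear scale (\<lambda>M. trunc n (bm N M)) (tbm n x y)"
  using unit0(1)[of "[]"] bm_mset[of "[]" "[]"]
  by unfold_locales (simp_all add: bm_add trunc_add trunc_scale tbm_def trunc_def[of n 0])

text \<open>The common value of the two sides of the \<open>b\<^sub>\<infinity>\<close> identity on \<open>x\<^sup>a\<close>, \<open>y\<^sup>b\<close> and \<open>z\<^sup>c\<close>.\<close>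

definition triple :: "nat \<Rightarrow> 'v \<Rightarrow> 'v \<Rightarrow> 'v \<Rightarrow> nat \<Rightarrow> nat \<Rightarrow> nat \<Rightarrow> 'v" where
  "triple n x y z a b c = (\<Sum>P | partition_on {..<a + b} P. trunc n (bm (image_mset
      (\<lambda>I. tbm n x y (card (I \<inter> {..<a})) (card (I - {..<a}))) (mset_set P)) (replicate_mset c z)))"

lemma image_tbm:
  assumes "partition_on {..<a + b} P"
  shows "image_mset (\<lambda>I. tbm n x y (card (I \<inter> {..<a})) (card (I - {..<a}))) (mset_set P)
    = image_mset (trunc n) (image_mset (part (replicate a x) (replicate b y)) (mset_set P))"
proof -
  have "finite P" using finite_elements[OF _ assms] by simp
  moreover have "I \<subseteq> {..<a + b}" if "I \<in> P" for I using partition_onD1[OF assms] that by auto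
  ultimately show ?thesis
    by (auto simp: image_mset.compositionality comp_def tbm_def part_replicate intro!: image_mset_cong)
qed

text \<open>Truncating the blocks does not change the truncated outer bracket, so the truncated
  blocks can be exchanged for the exact ones, to which the identity of the bracket applies, and back
  again.\<close>

lemma triple_alt:
  "triple n x y z a b c = (\<Sum>P | partition_on {..<b + c} P. trunc n (bm (replicate_mset a x) (image_mset
      (\<lambda>I. tbm n y z (card (I \<inter> {..<b})) (card (I - {..<b}))) (mset_set P))))"
proof -
  have "triple n x y z a b c = (\<Sum>P | partition_on {..<a + b} P. trunc n (bm (image_mset
      (part (replicate a x) (replicate b y)) (mset_set P)) (replicate_mset c z)))"
    unfolding triple_def by (intro sum.cong refl) (simp only: mem_Collect_eq image_tbm trunc_bm_trunc)
  also have "\<dots> = trunc n (\<Sum>P | partition_on {..<b + c} P. bm (replicate_mset a x)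
      (image_mset (part (replicate b y) (replicate c z)) (mset_set P)))"
    using bm_assoc[where xs = "replicate a x" and ys = "replicate b y" and zs = "replicate c z"] by (simp add: trunc_sum)
  also have "\<dots> = (\<Sum>P | partition_on {..<b + c} P. trunc n (bm (replicate_mset a x) (image_mset
      (\<lambda>I. tbm n y z (card (I \<inter> {..<b})) (card (I - {..<b}))) (mset_set P))))"
    unfolding trunc_sum by (intro sum.cong refl) (simp only: mem_Collect_eq image_tbm trunc_bm_trunc)
  finally show ?thesis .
qed

lemma tproduct_assoc:
  assumes L: "\<And>us vs. length us + length vs \<ge> L \<Longrightarrow> trunc n (B.wbr us vs) = 0"
  shows "tproduct n L (tproduct n L x y) z = tproduct n L x (tproduct n L y z)"
proof -
  \<comment> \<open>Fewer than \<open>L\<close> blocks survive in the outer bracket, each with fewer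
    than \<open>L\<close> elements of either kind; the exponential formula asks for a range
    exceeding the product of the two bounds.\<close>
  define N where "N = Suc (L * L)"
  have LN: "L \<le> N" unfolding N_def by (rule le_SucI, rule le_square)
  have N: "N > L * L" by (simp add: N_def)
  have Lm: "trunc n (bm M M') = 0" if "size M + size M' \<ge> L" for M M'
  proof -
    obtain ms ns where "M = mset ms" "M' = mset ns" using ex_mset by metis
    then show ?thesis using that by (simp add: bm_mset L)
  qed
  have tz: "tbm n u v i j = 0" if "i \<ge> L \<or> j \<ge> L" for u v i j
    unfolding tbm_def by (rule Lm) (use that in auto)
  \<comment> \<open>The first expression for \<open>triple\<close> shows that it vanishes for many
    copies of \<open>z\<close>, the second one for many copies of \<open>x\<close>. This allows the
    outer ranges \<open>L\<close> and \<open>N\<close> to be exchanged.\<close>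
  have triple0: "triple n x y z a b c = 0" if "c \<ge> L \<or> a \<ge> L" for a b c
    using that
  proof
    assume "c \<ge> L"
    then show ?thesis unfolding triple_def by (intro sum.neutral ballI Lm) simp
  next
    assume "a \<ge> L"
    then show ?thesis unfolding triple_alt by (intro sum.neutral ballI Lm) simp
  qed
  let ?S = "\<lambda>a b c. scale (1 / (fact a * fact b * fact c)) (triple n x y z a b c)"
  have "tproduct n L (tproduct n L x y) z = (\<Sum>c<L. scale (1 / fact c) (\<Sum>k<L. scale (1 / fact k)
      (trunc n (bm (replicate_mset k (tproduct n L x y)) (replicate_mset c z)))))"
    unfolding tproduct_def[of n L "tproduct n L x y"]
    by (subst sum.swap) (simp add: scale_sum_right tbm_def mult.commute)
  also have "\<dots> = (\<Sum>c<L. scale (1 / fact c) (\<Sum>a<N. \<Sum>b<N. scale (1 / (fact a * fact b)) (triple n x y z a b c)))"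
  proof (rule sum.cong[OF refl], rule arg_cong[where f = "scale _"])
    fix c
    interpret G: symmetric_multilinear scale "\<lambda>M. trunc n (bm M (replicate_mset c z))" "tbm n x y"
      by (rule symmetric_multilinear_left)
    show "(\<Sum>k<L. scale (1 / fact k) (trunc n (bm (replicate_mset k (tproduct n L x y)) (replicate_mset c z))))
        = (\<Sum>a<N. \<Sum>b<N. scale (1 / (fact a * fact b)) (triple n x y z a b c))"
      unfolding triple_def tproduct_def[of n L x y] G.total_def[symmetric]
      by (rule G.exponential_formula) (use tz Lm N in auto)
  qed
  also have "\<dots> = (\<Sum>c<L. \<Sum>a<N. \<Sum>b<N. ?S a b c)"
    by (simp add: scale_sum_right mult_ac)
  also have "\<dots> = (\<Sum>c<N. \<Sum>a<N. \<Sum>b<N. ?S a b c)"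
    using LN by (intro sum.mono_neutral_left) (auto simp: triple0)
  also have "\<dots> = (\<Sum>a<N. \<Sum>c<N. \<Sum>b<N. ?S a b c)"
    by (rule sum.swap)
  also have "\<dots> = (\<Sum>a<N. \<Sum>b<N. \<Sum>c<N. ?S a b c)"
    by (intro sum.cong refl sum.swap)
  also have "\<dots> = (\<Sum>a<L. \<Sum>b<N. \<Sum>c<N. ?S a b c)"
    using LN by (intro sum.mono_neutral_right) (auto simp: triple0)
  also have "\<dots> = (\<Sum>a<L. scale (1 / fact a) (\<Sum>b<N. \<Sum>c<N. scale (1 / (fact b * fact c)) (triple n x y z a b c)))"
    by (simp add: scale_sum_right mult_ac)
  also have "\<dots> = (\<Sum>a<L. scale (1 / fact a) (\<Sum>k<L. scale (1 / fact k)
      (trunc n (bm (replicate_mset a x) (replicate_mset k (tproduct n L y z))))))"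
  proof (rule sum.cong[OF refl], rule arg_cong[where f = "scale _"])
    fix a
    interpret G: symmetric_multilinear scale "\<lambda>M. trunc n (bm (replicate_mset a x) M)" "tbm n y z"
      by (rule symmetric_multilinear_right)
    show "(\<Sum>b<N. \<Sum>c<N. scale (1 / (fact b * fact c)) (triple n x y z a b c))
        = (\<Sum>k<L. scale (1 / fact k) (trunc n (bm (replicate_mset a x) (replicate_mset k (tproduct n L y z)))))"
      unfolding triple_alt tproduct_def[of n L y z] G.total_def[symmetric]
      by (rule G.exponential_formula[symmetric]) (use tz Lm N in auto)
  qed
  also have "\<dots> = tproduct n L x (tproduct n L y z)"
    unfolding tproduct_def[of n L x "tproduct n L y z"] by (simp add: scale_sum_right tbm_def)
  finally show ?thesis .
qed

lemma homogeneous_word_map: "x \<in> completion V \<Longrightarrow> map x ps \<in> homogeneous_words V (sum_list ps)"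
  unfolding homogeneous_words_def completion_def
  by (auto intro!: exI[of _ ps] list_all2_all_nthI)

text \<open>The truncated points are expanded by multilinearity; the component of degree
  \<open>i\<close> keeps exactly the pairs of degree lists with total \<open>i\<close>.\<close>

lemma sbracket_powers_eq:
  assumes x: "x \<in> completion V" and y: "y \<in> completion V" and n: "i < n"
  shows "sbracket_powers scale br x k y l i = comp i (B.wbr (replicate k (\<Sum>j<n. x j)) (replicate l (\<Sum>j<n. y j)))"
proof -
  let ?X = "\<Sum>j<n. x j" and ?Y = "\<Sum>j<n. y j"
  have expand: "m (replicate k (\<Sum>j<n. x j)) = (\<Sum>u\<in>words {..<n} k. m (map x u))"
    if "multilinear_mod scale scale UNIV {0} m" for m x k
    using multilinear_mod.expand[OF that, of "{..<n}" x "replicate k (\<Sum>j<n. x j)" "[]" "\<lambda>_ _. 1"] by simp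
  have "B.wbr (replicate k ?X) (replicate l ?Y) = (\<Sum>ps\<in>words {..<n} k. \<Sum>qs\<in>words {..<n} l. B.wbr (map x ps) (map y qs))"
    by (subst expand[OF B.wbr_multilinear_left], simp, intro sum.cong refl expand B.wbr_multilinear_right) simp
  then have "comp i (B.wbr (replicate k ?X) (replicate l ?Y))
      = (\<Sum>(ps, qs)\<in>words {..<n} k \<times> words {..<n} l. comp i (B.wbr (map x ps) (map y qs)))"
    by (simp add: comp_sum flip: sum.cartesian_product)
  also have "\<dots> = (\<Sum>(ps, qs) | length ps = k \<and> length qs = l \<and> sum_list ps + sum_list qs = i. B.wbr (map x ps) (map y qs))"
  proof (rule sum.mono_neutral_cong_right)
    show "{(ps, qs). length ps = k \<and> length qs = l \<and> sum_list ps + sum_list qs = i} \<subseteq> words {..<n} k \<times> words {..<n} l"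
    proof
      fix r assume "r \<in> {(ps, qs). length ps = k \<and> length qs = l \<and> sum_list ps + sum_list qs = i}"
      then obtain ps qs where r: "r = (ps, qs)" "length ps = k" "length qs = l" "sum_list ps + sum_list qs = i"
        by auto
      \<comment> \<open>Every degree in the lists is at most their total \<open>i\<close>, which
        lies below \<open>n\<close>, so the truncated sums contain all relevant letters.\<close>
      then have "p < n" if "p \<in> set ps \<union> set qs" for p
        using that n member_le_sum_list[of p ps] member_le_sum_list[of p qs] by auto
      then show "r \<in> words {..<n} k \<times> words {..<n} l"
        using r by (auto simp: words_def)
    qed
  next
    have hom: "comp i (B.wbr (map x ps) (map y qs)) = (if i = sum_list ps + sum_list qs then B.wbr (map x ps) (map y qs) else 0)" for ps qs
      by (intro comp_homogeneous homogeneous homogeneous_word_map x y)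
    show "\<forall>p\<in>words {..<n} k \<times> words {..<n} l - {(ps, qs). length ps = k \<and> length qs = l \<and> sum_list ps + sum_list qs = i}.
        (case p of (ps, qs) \<Rightarrow> comp i (B.wbr (map x ps) (map y qs))) = 0"
      by (auto simp: hom words_def split: if_splits)
    show "(case p of (ps, qs) \<Rightarrow> comp i (B.wbr (map x ps) (map y qs))) = (case p of (ps, qs) \<Rightarrow> B.wbr (map x ps) (map y qs))"
      if "p \<in> {(ps, qs). length ps = k \<and> length qs = l \<and> sum_list ps + sum_list qs = i}" for p
      using that by (auto simp: hom)
  qed simp
  finally show ?thesis
    by (simp add: sbracket_powers_def sbracket_eq symmetric_word_eq B.wbr_def)
qed

text \<open>The bound \<open>L\<close> confines the support of \<open>Sum_any\<close> to a finite
  square; on an infinite support \<open>Sum_any\<close> would take its default value 0.\<close>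

lemma lozenge_eq:
  assumes x: "x \<in> completion V" and y: "y \<in> completion V" and n: "i < n"
    and L: "\<And>us vs. length us + length vs \<ge> L \<Longrightarrow> comp i (B.wbr us vs) = 0"
  shows "lozenge scale br x y i = comp i (\<Sum>k<L. \<Sum>l<L. scale (1 / (fact k * fact l))
    (B.wbr (replicate k (\<Sum>j<n. x j)) (replicate l (\<Sum>j<n. y j))))"
proof -
  let ?F = "\<lambda>k l. scale (1 / (fact k * fact l)) (sbracket_powers scale br x k y l i)"
  have "sbracket_powers scale br x k y l i = 0" if "k \<ge> L \<or> l \<ge> L" for k l
    unfolding sbracket_powers_eq[OF x y n] by (rule L) (use that in auto)
  then have "lozenge scale br x y i = (\<Sum>(k, l)\<in>{..<L} \<times> {..<L}. ?F k l)"
    unfolding lozenge_def by (intro Sum_any.expand_superset) (auto simp: not_le[symmetric])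
  then show ?thesis
    by (simp add: comp_sum comp_scale sbracket_powers_eq[OF x y n] flip: sum.cartesian_product)
qed

lemma comp_nilpotent: "\<exists>L. \<forall>us vs. length us + length vs \<ge> L \<longrightarrow> comp i (B.wbr us vs) = 0"
proof -
  obtain L where L: "\<forall>us vs. length us + length vs \<ge> L \<longrightarrow> trunc (Suc i) (B.wbr us vs) = 0"
    using nilpotent by blast
  have "comp i (B.wbr us vs) = 0" if "length us + length vs \<ge> L" for us vs
    using L that trunc_eqD[of "Suc i" "B.wbr us vs" 0 i] by (simp add: trunc_def[of _ 0])
  then show ?thesis by blast
qed

lemma lozenge_completion:
  assumes "x \<in> completion V" "y \<in> completion V"
  shows "lozenge scale br x y \<in> completion V"
proof -
  have "lozenge scale br x y i \<in> V i" for i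
  proof -
    obtain L where "\<And>us vs. length us + length vs \<ge> L \<Longrightarrow> comp i (B.wbr us vs) = 0"
      using comp_nilpotent by blast
    from lozenge_eq[OF assms lessI this] show ?thesis by simp
  qed
  then show ?thesis by (simp add: completion_def)
qed

lemma lozenge_eventually:
  assumes "x \<in> completion V" "y \<in> completion V"
  shows "\<exists>n0. \<forall>n\<ge>n0. lozenge scale br x y i = comp i (\<Sum>k<n. \<Sum>l<n. scale (1 / (fact k * fact l))
    (B.wbr (replicate k (\<Sum>j<n. x j)) (replicate l (\<Sum>j<n. y j))))"
proof -
  obtain L where L: "\<And>us vs. length us + length vs \<ge> L \<Longrightarrow> comp i (B.wbr us vs) = 0"
    using comp_nilpotent by blast
  have "lozenge scale br x y i = comp i (\<Sum>k<n. \<Sum>l<n. scale (1 / (fact k * fact l))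
    (B.wbr (replicate k (\<Sum>j<n. x j)) (replicate l (\<Sum>j<n. y j))))" if "n \<ge> max L (Suc i)" for n
    using that by (intro lozenge_eq[OF assms] L) auto
  then show ?thesis by blast
qed

text \<open>One bound \<open>L\<close> serves for all degrees below \<open>n\<close>, so their
  components assemble into a single truncated product.\<close>

lemma truncated_lozenge:
  assumes x: "x \<in> completion V" and y: "y \<in> completion V"
    and L: "\<And>us vs. length us + length vs \<ge> L \<Longrightarrow> trunc n (B.wbr us vs) = 0"
  shows "(\<Sum>i<n. lozenge scale br x y i) = tproduct n L (\<Sum>i<n. x i) (\<Sum>i<n. y i)"
proof -
  let ?S = "\<Sum>k<L. \<Sum>l<L. scale (1 / (fact k * fact l)) (B.wbr (replicate k (\<Sum>j<n. x j)) (replicate l (\<Sum>j<n. y j)))"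
  have "lozenge scale br x y i = comp i ?S" if "i < n" for i
  proof (rule lozenge_eq[OF x y that])
    fix us vs :: "'v list" assume "length us + length vs \<ge> L"
    then show "comp i (B.wbr us vs) = 0"
      using L trunc_eqD[of n "B.wbr us vs" 0 i] that by (simp add: trunc_def[of _ 0])
  qed
  then have "(\<Sum>i<n. lozenge scale br x y i) = trunc n ?S"
    by (simp add: trunc_def)
  then show ?thesis
    by (simp add: tproduct_def trunc_sum trunc_scale tbm_def bm_replicate)
qed

text \<open>Degree \<open>i\<close> is read off from the truncation at \<open>Suc i\<close>, where
  all four products become \<open>tproduct\<close>s with one common bound \<open>L\<close>.\<close>

lemma lozenge_assoc:
  assumes x: "x \<in> completion V" and y: "y \<in> completion V" and z: "z \<in> completion V"
  shows "lozenge scale br (lozenge scale br x y) z = lozenge scale br x (lozenge scale br y z)"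
proof
  fix i
  obtain L where L: "\<And>us vs. length us + length vs \<ge> L \<Longrightarrow> trunc (Suc i) (B.wbr us vs) = 0"
    using nilpotent by blast
  note xy = lozenge_completion[OF x y] and yz = lozenge_completion[OF y z]
  note t = truncated_lozenge[OF _ _ L]
  have "(\<Sum>i<Suc i. lozenge scale br (lozenge scale br x y) z i) = (\<Sum>i<Suc i. lozenge scale br x (lozenge scale br y z) i)"
    by (simp only: t[OF xy z] t[OF x yz] t[OF x y] t[OF y z] tproduct_assoc[OF L])
  then have "comp i (\<Sum>i<Suc i. lozenge scale br (lozenge scale br x y) z i)
      = comp i (\<Sum>i<Suc i. lozenge scale br x (lozenge scale br y z) i)"
    by (rule arg_cong)
  moreover have "comp i (\<Sum>i<Suc i. u i) = u i" if "u \<in> completion V" for u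
    using that comp_sum_components[of "Suc i" u i] by (simp add: completion_def)
  ultimately show "lozenge scale br (lozenge scale br x y) z i = lozenge scale br x (lozenge scale br y z) i"
    using lozenge_completion[OF xy z] lozenge_completion[OF x yz] by simp
qed

lemma wbr_replicate_zero:
  "k > 0 \<Longrightarrow> B.wbr (replicate k 0) vs = 0" "k > 0 \<Longrightarrow> B.wbr vs (replicate k 0) = 0"
  using multilinear_mod.zero[OF B.wbr_multilinear_left, of vs "[]" "replicate (k - 1) 0"]
    multilinear_mod.zero[OF B.wbr_multilinear_right, of vs "[]" "replicate (k - 1) 0"]
  by (cases k; simp)+

lemma lozenge_unit:
  assumes x: "x \<in> completion V"
  shows "lozenge scale br (\<lambda>n. 0) x = x" "lozenge scale br x (\<lambda>n. 0) = x"
proof -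
  have z: "(\<lambda>n. 0) \<in> completion V" using subspace_0[OF V] by (simp add: completion_def)
  have "lozenge scale br (\<lambda>n. 0) x i = x i \<and> lozenge scale br x (\<lambda>n. 0) i = x i" for i
  proof -
    obtain n1 where n1: "\<forall>n\<ge>n1. lozenge scale br (\<lambda>n. 0) x i = comp i (\<Sum>k<n. \<Sum>l<n. scale (1 / (fact k * fact l))
        (B.wbr (replicate k (\<Sum>j<n. 0)) (replicate l (\<Sum>j<n. x j))))"
      using lozenge_eventually[OF z x] by blast
    obtain n2 where n2: "\<forall>n\<ge>n2. lozenge scale br x (\<lambda>n. 0) i = comp i (\<Sum>k<n. \<Sum>l<n. scale (1 / (fact k * fact l))
        (B.wbr (replicate k (\<Sum>j<n. x j)) (replicate l (\<Sum>j<n. 0))))"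
      using lozenge_eventually[OF x z] by blast
    \<comment> \<open>The summand \<open>i + 2\<close> gives both \<open>i < n\<close> and
      \<open>1 < n\<close>: the component of degree \<open>i\<close> is retained, and the term with
      one letter, the only nonzero one, lies in the range.\<close>
    define n where "n = Max {n1, n2, i + 2}"
    have n: "n \<ge> n1" "n \<ge> n2" "i < n" "1 < n" by (auto simp: n_def)
    let ?X = "\<Sum>j<n. x j"
    have "B.wbr (replicate k 0) (replicate l ?X) = (if k = 0 \<and> l = 1 then ?X else 0)" for k l
      using wbr_replicate_zero(1)[of k] unit(1) unit0(1)[of "replicate l ?X"] by (cases "k = 0"; auto)
    then have "(\<Sum>k<n. \<Sum>l<n. scale (1 / (fact k * fact l)) (B.wbr (replicate k 0) (replicate l ?X)))
        = (\<Sum>k<n. \<Sum>l<n. if k = 0 \<and> l = 1 then ?X else 0)"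
      by (intro sum.cong[OF refl]) simp
    also have "\<dots> = (\<Sum>k<n. if k = 0 then ?X else 0)"
      using n(4) by (intro sum.cong[OF refl]) simp
    also have "\<dots> = ?X" using n by simp
    finally have 1: "lozenge scale br (\<lambda>n. 0) x i = comp i ?X" using n1 n(1) by simp
    have "B.wbr (replicate k ?X) (replicate l 0) = (if l = 0 \<and> k = 1 then ?X else 0)" for k l
      using wbr_replicate_zero(2)[of l] unit(2) unit0(2)[of "replicate k ?X"] by (cases "l = 0"; auto)
    then have "(\<Sum>k<n. \<Sum>l<n. scale (1 / (fact k * fact l)) (B.wbr (replicate k ?X) (replicate l 0)))
        = (\<Sum>k<n. \<Sum>l<n. if l = 0 \<and> k = 1 then ?X else 0)"
      by (intro sum.cong[OF refl]) simp
    also have "\<dots> = (\<Sum>k<n. if k = 1 then ?X else 0)"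
      using n(4) by (intro sum.cong[OF refl]) simp
    also have "\<dots> = ?X" using n by simp
    finally have 2: "lozenge scale br x (\<lambda>n. 0) i = comp i ?X" using n2 n(2) by simp
    have "comp i ?X = x i"
      using x n(3) comp_sum_components[of n x i] by (simp add: completion_def)
    with 1 2 show ?thesis by simp
  qed
  then show "lozenge scale br (\<lambda>n. 0) x = x" "lozenge scale br x (\<lambda>n. 0) = x" by auto
qed

lemma lozenge_monoid: "Group.monoid (lozenge_monoid scale V br)"
proof -
  have "(\<lambda>n. 0) \<in> completion V" using subspace_0[OF V] by (simp add: completion_def)
  then show ?thesis
    by (intro Group.monoidI) (simp_all add: lozenge_monoid_def lozenge_completion lozenge_assoc lozenge_unit)
qed

lemma lozenge_product_rel:
  assumes "x \<in> completion V" "y \<in> completion V"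
  shows "product_rel x y (lozenge scale br x y)"
  using lozenge_eventually[OF assms] unfolding product_rel_def by (simp add: weight_def)

text \<open>The two defining conditions differ only on the right-hand side, where the pairing of two
  single letters is evaluation of the form.\<close>

lemma symmetric_coproduct_eq: "symmetric_coproduct scale V br = D.cop"
proof -
  have p: "class_pair True (D.D.word [f]) (B.word [x]) = f x" if "f \<in> W" for f x
    using that by (subst D.class_pair_words) (simp_all add: pair_singleton)
  show ?thesis
    unfolding symmetric_coproduct_def D.cop_def D.dual_condition_def
    by (rule arg_cong[where f = The])
       (auto simp: fun_eq_iff symmetric_algebra_eq symmetric_word_def symmetric_class_eq symmetric_pairing_eq
         sbracket_eq p pair_singleton)
qed

lemma symmetric_character_monoid_eq:
  "symmetric_character_monoid scale V br = character_monoid D.D.PA D.cop word_counit"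
  by (simp add: symmetric_character_monoid_def symmetric_coproduct_eq symmetric_algebra_eq)

end

section \<open>Instances of the common bracket assumptions\<close>

lemma sum_list_length_le: "length ps \<le> count_list ps 0 + sum_list (ps :: nat list)"
  by (induction ps) auto

text \<open>Letters of degree 0 are split off; each remaining one has degree at least 1, so there
  are at most \<open>m\<close> of them. The splitting reorders the word, which a symmetric bracket
  does not see.\<close>

lemma homogeneous_word_length:
  "us \<in> homogeneous_words V m \<Longrightarrow> \<exists>us0 us1. mset us = mset (us0 @ us1) \<and> set us0 \<subseteq> V 0 \<and>
    us1 \<in> homogeneous_words V m \<and> length us1 \<le> m"
proof -
  assume "us \<in> homogeneous_words V m"
  then obtain ps where "list_all2 (\<lambda>x p. x \<in> V p) us ps" "sum_list ps = m"
    by (auto simp: homogeneous_words_def)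
  then show ?thesis
  proof (induction us ps arbitrary: m rule: list_all2_induct)
    case Nil
    then show ?case by (auto simp: homogeneous_words_def intro!: exI[of _ "[]"])
  next
    case (Cons u us p ps)
    obtain us0 us1 where IH: "mset us = mset (us0 @ us1)" "set us0 \<subseteq> V 0"
      "us1 \<in> homogeneous_words V (sum_list ps)" "length us1 \<le> sum_list ps"
      using Cons.IH[OF refl] by blast
    show ?case
    proof (cases "p = 0")
      case True
      then show ?thesis
        using IH Cons by (intro exI[of _ "u # us0"] exI[of _ us1]) auto
    next
      case False
      obtain qs where "list_all2 (\<lambda>x p. x \<in> V p) us1 qs" "sum_list qs = sum_list ps"
        using IH(3) by (auto simp: homogeneous_words_def)
      then have "list_all2 (\<lambda>x p. x \<in> V p) (u # us1) (p # qs)" "sum_list (p # qs) = m"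
        using Cons by auto
      then have "u # us1 \<in> homogeneous_words V m"
        unfolding homogeneous_words_def by blast
      then show ?thesis
        using IH False Cons.prems by (intro exI[of _ us0] exI[of _ "u # us1"]) auto
    qed
  qed
qed

text \<open>The given bounds depend on the two degrees; their sum over a finite square dominates
  each of them.\<close>

lemma uniform_bound:
  fixes B :: "nat \<Rightarrow> nat \<Rightarrow> nat"
  obtains M where "\<And>m n. m < N \<Longrightarrow> n < N \<Longrightarrow> B m n \<le> M"
proof
  fix m n assume "m < N" "n < N"
  then have "B m n \<le> (\<Sum>n<N. B m n)" by (intro member_le_sum) auto
  also have "\<dots> \<le> (\<Sum>m<N. \<Sum>n<N. B m n)" using \<open>m < N\<close> by (intro member_le_sum) auto
  finally show "B m n \<le> (\<Sum>m<N. \<Sum>n<N. B m n)" .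
qed

lemma word_bracketI:
  assumes "vector_space scale" "linear_on (tensor_product (presented_algebra (free_monoid UNIV) (word_relations c scale UNIV))
    (presented_algebra (free_monoid UNIV) (word_relations c scale UNIV))) scale br"
  shows "word_bracket scale UNIV c scale br"
proof -
  interpret vector_space scale by fact
  show ?thesis
    using assms by (intro word_bracket.intro word_algebra.intro word_algebra_axioms.intro word_bracket_axioms.intro) auto
qed

lemma b_infinityI:
  assumes "zero_bounded_b_infinity_algebra scale V br"
  shows "b_infinity scale V br"
proof -
  note z = assms[unfolded zero_bounded_b_infinity_algebra_def b_infinity_algebra_def]
  have vs: "vector_space scale" using z by blast
  interpret B: word_bracket scale UNIV True scale br
    using z by (intro word_bracketI vs) (simp add: symmetric_algebra_eq)
  have br: "sbracket scale br = B.bracket"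
    by (simp add: fun_eq_iff sbracket_def B.bracket_def symmetric_algebra_eq)
  have word: "symmetric_word scale UNIV xs = B.word xs" for xs
    by (simp add: symmetric_word_def symmetric_class_eq)
  have span: "B.word xs \<in> symmetric_span scale M" if "xs \<in> M" for xs M
    unfolding symmetric_span_def symmetric_class_eq using that
    by (intro image_eqI[of _ _ "single xs 1"]) auto
  have one: "\<one>\<^bsub>symmetric_algebra scale UNIV\<^esub> = B.word []"
    by (simp add: symmetric_algebra_eq B.word_Nil)
  have zb: "\<exists>M. \<forall>m n us vs. us \<in> homogeneous_words V m \<longrightarrow> vs \<in> homogeneous_words V n \<longrightarrow>
      m + n < N \<longrightarrow> length us + length vs \<ge> M \<longrightarrow> B.wbr us vs = 0" for N
  proof -
    have "\<forall>m n. \<exists>B::nat. \<forall>k l. k + l \<ge> B \<longrightarrow>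
       (\<forall>X0\<in>symmetric_span scale (power_words (V 0) k).
        \<forall>X\<in>symmetric_span scale (homogeneous_words V m).
        \<forall>Y0\<in>symmetric_span scale (power_words (V 0) l).
        \<forall>Y\<in>symmetric_span scale (homogeneous_words V n).
          sbracket scale br (X0 \<otimes>\<^bsub>symmetric_algebra scale UNIV\<^esub> X) (Y0 \<otimes>\<^bsub>symmetric_algebra scale UNIV\<^esub> Y) = 0)"
      using z by blast
    then obtain Bd :: "nat \<Rightarrow> nat \<Rightarrow> nat" where Bd: "\<And>m n k l X0 X Y0 Y. k + l \<ge> Bd m n \<Longrightarrow>
       X0\<in>symmetric_span scale (power_words (V 0) k) \<Longrightarrow> X\<in>symmetric_span scale (homogeneous_words V m) \<Longrightarrow>
       Y0\<in>symmetric_span scale (power_words (V 0) l) \<Longrightarrow> Y\<in>symmetric_span scale (homogeneous_words V n) \<Longrightarrow>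
          sbracket scale br (X0 \<otimes>\<^bsub>symmetric_algebra scale UNIV\<^esub> X) (Y0 \<otimes>\<^bsub>symmetric_algebra scale UNIV\<^esub> Y) = 0"
      by metis
    obtain M where M: "\<And>m n. m < N \<Longrightarrow> n < N \<Longrightarrow> Bd m n \<le> M"
      using uniform_bound[of N Bd] by blast
    \<comment> \<open>Fewer than \<open>N\<close> letters have positive degree, so at least
      \<open>M\<close> letters have degree 0, which meets the bound for the degrees \<open>m\<close>
      and \<open>n\<close>.\<close>
    have "B.wbr us vs = 0" if us: "us \<in> homogeneous_words V m" and vs: "vs \<in> homogeneous_words V n"
      and mn: "m + n < N" and len: "length us + length vs \<ge> M + N" for m n us vs
    proof -
      obtain us0 us1 where u: "mset us = mset (us0 @ us1)" "set us0 \<subseteq> V 0"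
        "us1 \<in> homogeneous_words V m" "length us1 \<le> m"
        using homogeneous_word_length[OF us] by blast
      obtain vs0 vs1 where v: "mset vs = mset (vs0 @ vs1)" "set vs0 \<subseteq> V 0"
        "vs1 \<in> homogeneous_words V n" "length vs1 \<le> n"
        using homogeneous_word_length[OF vs] by blast
      have "length us = length us0 + length us1" "length vs = length vs0 + length vs1"
        using u(1) v(1) by (metis length_append size_mset)+
      then have "length us0 + length vs0 \<ge> Bd m n"
        using M[of m n] mn len u v by linarith
      then have "sbracket scale br (B.word us0 \<otimes>\<^bsub>symmetric_algebra scale UNIV\<^esub> B.word us1)
          (B.word vs0 \<otimes>\<^bsub>symmetric_algebra scale UNIV\<^esub> B.word vs1) = 0"
        by (rule Bd) (use u v in \<open>auto intro!: span simp: power_words_def\<close>)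
      then have "B.wbr (us0 @ us1) (vs0 @ vs1) = 0"
        by (simp add: br B.wbr_def symmetric_algebra_eq B.word_append)
      then show ?thesis
        using B.wbr_mset[of us "us0 @ us1" vs "vs0 @ vs1"] u v by simp
    qed
    then show ?thesis by blast
  qed
  show ?thesis
  proof (intro b_infinity.intro graded_bracket.intro graded.intro vs graded_axioms.intro
      graded_bracket_axioms.intro b_infinity_axioms.intro B.word_bracket_axioms zb)
    show "graded_space scale V" "finite_dimensional_components scale V" using z by blast+
    show "B.wbr us vs \<in> V (m + n)" if "us \<in> homogeneous_words V m" "vs \<in> homogeneous_words V n" for us vs m n
      using z span[OF that(1)] span[OF that(2)] unfolding br B.wbr_def by blast
    show "B.wbr [] [x] = x" "B.wbr [x] [] = x" for x
      using z unfolding br word one B.wbr_def by blast+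
    show "B.wbr [] us = 0" "B.wbr us [] = 0" if "length us \<noteq> 1" for us
    proof -
      have "B.word us \<in> symmetric_span scale (power_words UNIV (length us))"
        by (rule span) (simp add: power_words_def)
      then show "B.wbr [] us = 0" "B.wbr us [] = 0"
        using z that unfolding br word one B.wbr_def by blast+
    qed
  qed (use z in blast)
qed

lemma tensor_coproduct_eq:
  assumes "graded_bracket scale V False ang"
  shows "tensor_coproduct scale V ang = dual_bracket.cop scale (graded_dual scale V) False ang"
proof -
  interpret A: graded_bracket scale V False ang by fact
  show ?thesis
    unfolding tensor_coproduct_def A.D.cop_def A.D.dual_condition_def
    by (rule arg_cong[where f = The])
       (auto simp: fun_eq_iff tensor_algebra_eq tensor_word_def tensor_class_eq tensor_pairing_eq
         tbracket_def A.B.bracket_def)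
qed

lemma graded_bracketI_tensor:
  assumes "zero_bounded_B_infinity_algebra scale V ang"
  shows "graded_bracket scale V False (ang :: ('k::field_char_0, 'v::ab_group_add) bracket)"
proof -
  note z = assms[unfolded zero_bounded_B_infinity_algebra_def B_infinity_algebra_def]
  have vs: "vector_space scale" using z by blast
  interpret B: word_bracket scale UNIV False scale ang
    using z by (intro word_bracketI vs) (simp add: tensor_algebra_eq)
  have br: "tbracket scale ang = B.bracket"
    by (simp add: fun_eq_iff tbracket_def B.bracket_def tensor_algebra_eq)
  have word: "tensor_word scale UNIV xs = B.word xs" for xs
    by (simp add: tensor_word_def tensor_class_eq)
  have span: "B.word xs \<in> tensor_span scale M" if "xs \<in> M" for xs M
    unfolding tensor_span_def tensor_class_eq using that
    by (intro image_eqI[of _ _ "single xs 1"]) auto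
  have zb: "\<exists>M. \<forall>m n us vs. us \<in> homogeneous_words V m \<longrightarrow> vs \<in> homogeneous_words V n \<longrightarrow>
      m + n < N \<longrightarrow> length us + length vs \<ge> M \<longrightarrow> B.wbr us vs = 0" for N
  proof -
    have "\<forall>m n. \<exists>B::nat. \<forall>ps qs.
       sum_list ps = m \<and> sum_list qs = n \<and> count_list ps 0 + count_list qs 0 > B \<longrightarrow>
       (\<forall>xs ys. list_all2 (\<lambda>x p. x \<in> V p) xs ps \<and> list_all2 (\<lambda>y q. y \<in> V q) ys qs \<longrightarrow>
          tbracket scale ang (tensor_word scale UNIV xs) (tensor_word scale UNIV ys) = 0)"
      using z by blast
    then obtain Bd :: "nat \<Rightarrow> nat \<Rightarrow> nat" where Bd: "\<And>ps qs xs ys.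
       count_list ps 0 + count_list qs 0 > Bd (sum_list ps) (sum_list qs) \<Longrightarrow>
       list_all2 (\<lambda>x p. x \<in> V p) xs ps \<Longrightarrow> list_all2 (\<lambda>y q. y \<in> V q) ys qs \<Longrightarrow> B.wbr xs ys = 0"
      unfolding br word B.wbr_def[symmetric] by metis
    obtain M where M: "\<And>m n. m < N \<Longrightarrow> n < N \<Longrightarrow> Bd m n \<le> M"
      using uniform_bound[of N Bd] by blast
    \<comment> \<open>The bound for tensor brackets is a strict inequality: more than
      \<open>M\<close> letters have degree 0, the others being fewer than \<open>N\<close>.\<close>
    have "B.wbr us vs = 0" if us: "us \<in> homogeneous_words V m" and vs: "vs \<in> homogeneous_words V n"
      and mn: "m + n < N" and len: "length us + length vs \<ge> Suc (M + N)" for m n us vs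
    proof -
      obtain ps qs where *: "list_all2 (\<lambda>x p. x \<in> V p) us ps" "sum_list ps = m"
        "list_all2 (\<lambda>x p. x \<in> V p) vs qs" "sum_list qs = n"
        using us vs by (auto simp: homogeneous_words_def)
      have "length us = length ps" "length vs = length qs"
        using * by (auto dest: list_all2_lengthD)
      then have "count_list ps 0 + count_list qs 0 > Bd (sum_list ps) (sum_list qs)"
        using M[of m n] mn len * sum_list_length_le[of ps] sum_list_length_le[of qs] by simp
      then show ?thesis using * by (intro Bd)
    qed
    then show ?thesis by blast
  qed
  show ?thesis
  proof (intro graded_bracket.intro graded.intro vs graded_axioms.intro
      graded_bracket_axioms.intro B.word_bracket_axioms zb)
    show "graded_space scale V" "finite_dimensional_components scale V" using z by blast+
    show "B.wbr us vs \<in> V (m + n)" if "us \<in> homogeneous_words V m" "vs \<in> homogeneous_words V n" for us vs m n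
      using z span[OF that(1)] span[OF that(2)] unfolding br B.wbr_def by blast
  qed
qed

theorem theorem31:
  fixes scale :: "'k::field_char_0 \<Rightarrow> 'v::ab_group_add \<Rightarrow> 'v"
    and V :: "nat \<Rightarrow> 'v set"
    and br :: "('k, 'v) bracket"
  assumes "zero_bounded_b_infinity_algebra scale V br"
  shows "monoid (lozenge_monoid scale V br)
    \<and> monoid (symmetric_character_monoid scale V br)
    \<and> lozenge_monoid scale V br \<cong> symmetric_character_monoid scale V br
    \<and> (\<forall>ang :: ('k, 'v) bracket.
        zero_bounded_B_infinity_algebra scale V ang \<and> induces scale ang br \<longrightarrow>
          monoid (tensor_character_monoid scale V ang)
          \<and> lozenge_monoid scale V br \<cong> tensor_character_monoid scale V ang)"
proof -
  interpret S: b_infinity scale V br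
    by (rule b_infinityI) fact
  let ?L = "lozenge_monoid scale V br"
  have L: "carrier ?L = completion V" "\<one>\<^bsub>?L\<^esub> = (\<lambda>n. 0)" "x \<otimes>\<^bsub>?L\<^esub> y = lozenge scale br x y" for x y
    by (simp_all add: lozenge_monoid_def)
  have sym: "monoid (symmetric_character_monoid scale V br)" "?L \<cong> symmetric_character_monoid scale V br"
    unfolding S.symmetric_character_monoid_eq
    by (rule S.character_monoid_iso[OF S.lozenge_monoid L(1,2)]; simp add: L(3) S.lozenge_product_rel)+
  have tens: "monoid (tensor_character_monoid scale V ang) \<and> ?L \<cong> tensor_character_monoid scale V ang"
    if ang: "zero_bounded_B_infinity_algebra scale V ang" and ind: "induces scale ang br" for ang
  proof -
    interpret A: graded_bracket scale V False ang
      by (rule graded_bracketI_tensor) fact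
    have eq: "tensor_character_monoid scale V ang = character_monoid A.D.D.PA A.D.cop word_counit"
      by (simp add: tensor_character_monoid_def tensor_coproduct_eq A.graded_bracket_axioms tensor_algebra_eq)
    have wbr: "A.B.wbr us vs = tbracket scale ang (tensor_word scale UNIV us) (tensor_word scale UNIV vs)" for us vs
      by (simp add: A.B.wbr_def A.B.bracket_def tbracket_def tensor_algebra_eq tensor_word_def tensor_class_eq)
    have "S.B.wbr (replicate k X) (replicate l Y) = scale (fact k * fact l) (A.B.wbr (replicate k X) (replicate l Y))"
      for k l X Y
    proof -
      \<comment> \<open>A constant word is fixed by all permutations, so all terms of the induced
        bracket coincide.\<close>
      have perm: "permute_list \<sigma> (replicate n Z) = replicate n Z" if "\<sigma> permutes {..<n}" for \<sigma> n and Z :: 'v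
        using permutes_in_image[OF that] by (intro nth_equalityI) (auto simp: permute_list_def)
      have "S.B.wbr (replicate k X) (replicate l Y) =
          (\<Sum>\<sigma> | \<sigma> permutes {..<k}. \<Sum>\<tau> | \<tau> permutes {..<l}.
            A.B.wbr (permute_list \<sigma> (replicate k X)) (permute_list \<tau> (replicate l Y)))"
        using ind[unfolded induces_def, rule_format, of "replicate k X" "replicate l Y"]
        by (simp add: S.sbracket_eq S.symmetric_word_eq wbr flip: S.B.wbr_def)
      also have "\<dots> = (\<Sum>\<sigma> | \<sigma> permutes {..<k}. \<Sum>\<tau> | \<tau> permutes {..<l}.
          A.B.wbr (replicate k X) (replicate l Y))"
        by (intro sum.cong refl) (simp add: perm)
      also have "\<dots> = scale (fact k * fact l) (A.B.wbr (replicate k X) (replicate l Y))"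
        by (simp only: S.sum_constant_scale card_permutations[OF refl] finite_lessThan card_lessThan
            S.scale_scale of_nat_fact)
      finally show ?thesis .
    qed
    \<comment> \<open>The factorials of the exponentials cancel against the number of permutations
      and leave the tensor weight 1, so the same lozenge product satisfies
      \<open>A.product_rel\<close>.\<close>
    then have "scale (1 / (fact k * fact l)) (S.B.wbr (replicate k X) (replicate l Y))
        = scale (weight False k * weight False l) (A.B.wbr (replicate k X) (replicate l Y))" for k l X Y
      by (simp add: weight_def)
    then have "A.product_rel x y (lozenge scale br x y)" if "x \<in> completion V" "y \<in> completion V" for x y
      using S.lozenge_eventually[OF that] unfolding A.product_rel_def by simp
    then show ?thesis
      unfolding eq
      by (intro conjI; intro A.character_monoid_iso[OF S.lozenge_monoid L(1,2)]; simp add: L(3))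
  qed
  show ?thesis
    using S.lozenge_monoid sym tens by blast
qed

end
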